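(* Let $n\ge 4$ and $k\ge 1$ with $n-k\ge 2$. Then the arrangement graph $A_{n,k}$ is super spanning connected: for every integer $l$ with $1\le l\le k(n-k)$ and every pair of distinct vertices $u,v$ of $A_{n,k}$, there is an $l^*$-container of $A_{n,k}$ between $u$ and $v$.
   Context: For integers $n>k\ge 1$, let $\langle n\rangle=\{1,\dots,n\}$. The arrangement graph $A_{n,k}$ has vertex set the set of all sequences $u=u_1u_2\cdots u_k$ with $u_i\in\langle n\rangle$ and $u_i\ne u_j$ for $i\ne j$, and two vertices are adjacent iff they differ in exactly one position; it is $k(n-k)$-regular with connectivity $k(n-k)$. A $k$-container $C(u,v)$ of a graph $G$ is a set of $k$ internally vertex-disjoint paths between $u$ and $v$. A $k$-container is a $k^*$-container if the union of its paths contains every vertex of $G$. $G$ is $k^*$-connected if there is a $k^*$-container between any two distinct vertices of $G$. A graph $G$ is super spanning connected if it is $l^*$-connected for all $1\le l\le\kappa(G)$, where $\kappa(G)$ is its connectivity. *)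

theory Defs
  imports Main
begin

definition is_path :: "'a set \<Rightarrow> ('a \<Rightarrow> 'a \<Rightarrow> bool) \<Rightarrow> 'a \<Rightarrow> 'a \<Rightarrow> 'a list \<Rightarrow> bool" where
  "is_path V E u v P \<longleftrightarrow> P \<noteq> [] \<and> hd P = u \<and> last P = v \<and> distinct P \<and>
     set P \<subseteq> V \<and> (\<forall>i. Suc i < length P \<longrightarrow> E (P ! i) (P ! Suc i))"

definition is_container :: "'a set \<Rightarrow> ('a \<Rightarrow> 'a \<Rightarrow> bool) \<Rightarrow> nat \<Rightarrow> 'a \<Rightarrow> 'a \<Rightarrow> 'a list set \<Rightarrow> bool" where
  "is_container V E k u v C \<longleftrightarrow> card C = k \<and> finite C \<and>
     (\<forall>P\<in>C. is_path V E u v P) \<and>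
     (\<forall>P\<in>C. \<forall>Q\<in>C. P \<noteq> Q \<longrightarrow> set P \<inter> set Q = {u, v})"

definition is_star_container :: "'a set \<Rightarrow> ('a \<Rightarrow> 'a \<Rightarrow> bool) \<Rightarrow> nat \<Rightarrow> 'a \<Rightarrow> 'a \<Rightarrow> 'a list set \<Rightarrow> bool" where
  "is_star_container V E k u v C \<longleftrightarrow> is_container V E k u v C \<and> (\<Union>P\<in>C. set P) = V"

definition star_connected :: "'a set \<Rightarrow> ('a \<Rightarrow> 'a \<Rightarrow> bool) \<Rightarrow> nat \<Rightarrow> bool" where
  "star_connected V E k \<longleftrightarrow>
     (\<forall>u\<in>V. \<forall>v\<in>V. u \<noteq> v \<longrightarrow> (\<exists>C. is_star_container V E k u v C))"

definition arr_vertices :: "nat \<Rightarrow> nat \<Rightarrow> nat list set" where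
  "arr_vertices n k = {u. length u = k \<and> distinct u \<and> set u \<subseteq> {1..n}}"

definition arr_adj :: "nat list \<Rightarrow> nat list \<Rightarrow> bool" where
  "arr_adj u v \<longleftrightarrow> length u = length v \<and> card {i. i < length u \<and> u ! i \<noteq> v ! i} = 1"

end

theory Submission
  imports Defs
begin

text \<open>
  Write \<open>m = n - k\<close> and let \<open>S\<close> be the set of symbols. A spanning container between \<open>u\<close> and \<open>v\<close> is
  encoded by its set of arcs: a well-founded relation in which every vertex other than \<open>u\<close>, \<open>v\<close>
  has exactly one successor and one predecessor, and the number of paths is the out-degree of \<open>u\<close>.

  The proof is by induction on \<open>k\<close>. Fixing the first symbol \<open>t\<close> splits the graph into copies of
  the graph for \<open>S - {t}\<close>, and \<open>t # x\<close>, \<open>s # x\<close> are adjacent whenever both are vertices. A set of copies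
  can be covered by disjoint paths with prescribed sources and sinks, at most one of each per copy, if the pairing
  of sources with sinks is left free; this routes paths through the copies. The induction also carries the statement that
  for adjacent \<open>u\<close>, \<open>v\<close> the set of last inner vertices of the paths may be prescribed.

  If \<open>u\<close> and \<open>v\<close> agree in some position, move it to the front: a container inside one copy is extended by
  paths through other copies. Otherwise let \<open>u = i # a\<close> and \<open>v = j # b\<close>, pick a neighbour \<open>c\<close> of \<open>a\<close> avoiding
  \<open>i\<close> and \<open>j\<close>, take a container from \<open>a\<close> to \<open>c\<close> in copy \<open>i\<close> and one from \<open>c\<close> to \<open>b\<close> in copy \<open>j\<close>, delete the
  arcs at \<open>c\<close>, and join the two families of ends: a neighbour of \<open>c\<close> avoiding \<open>i\<close>, \<open>j\<close> is joined to its
  mirror image directly, and \<open>c[q := j]\<close>, \<open>c[q := i]\<close> are joined through the remaining copies.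
\<close>

section \<open>Containers as sets of arcs\<close>

text \<open>The obstacle in joining at \<open>c\<close> is that two families of ends must match. The
  container from \<open>c\<close> to \<open>b\<close> starts through neighbours of \<open>c\<close>
  that cannot be prescribed, so the one from \<open>a\<close> to \<open>c\<close> has to end in the
  mirror image of that set. This is why the prescribed version exists and why \<open>c\<close> is
  taken adjacent to \<open>a\<close>. With \<open>k * m\<close> paths all neighbours of
  \<open>c\<close> are used on both sides. The up to \<open>m\<close> further paths leave copy
  \<open>i\<close> at \<open>i # a\<close> at once, and the difficulty is then to find enough
  copies: sources must lie in distinct copies, sinks likewise, and the two sets of copies must
  either differ or be everything. Hence the careful counting of reserved copies, and a separate
  rerouting in the extreme case of \<open>Suc k * m\<close> paths between words without a common
  symbol. The two-letter words over four symbols leave too few choices for the routing; they are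
  settled by explicit lists of paths, next to the complete graphs for \<open>k = 1\<close>.\<close>

text \<open>
  In \<open>pflow V A B S T F\<close> the vertices of \<open>A\<close> have no predecessor and arbitrarily many successors, those of \<open>B\<close>
  dually; apart from these, \<open>F\<close> is a cover of \<open>V\<close> by disjoint paths from \<open>S\<close> to \<open>T\<close>.
\<close>

definition pflow :: "'a set \<Rightarrow> 'a set \<Rightarrow> 'a set \<Rightarrow> 'a set \<Rightarrow> 'a set \<Rightarrow> ('a \<times> 'a) set \<Rightarrow> bool" where
  "pflow V A B S T F \<longleftrightarrow> finite V \<and> F \<subseteq> V \<times> V \<and> wf F \<and>
     (\<forall>x\<in>V. (x \<in> B \<longrightarrow> x \<notin> Domain F) \<and>
        (x \<notin> A \<union> B \<longrightarrow> (if x \<in> T then x \<notin> Domain F else \<exists>!y. (x, y) \<in> F))) \<and>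
     (\<forall>x\<in>V. (x \<in> A \<longrightarrow> x \<notin> Range F) \<and>
        (x \<notin> A \<union> B \<longrightarrow> (if x \<in> S then x \<notin> Range F else \<exists>!y. (y, x) \<in> F)))"

definition flow :: "'a set \<Rightarrow> 'a \<Rightarrow> 'a \<Rightarrow> ('a \<times> 'a) set \<Rightarrow> bool" where
  "flow V u v F \<longleftrightarrow> pflow V {u} {v} {} {} F \<and> u \<in> V \<and> v \<in> V \<and> u \<noteq> v"

lemma pflowD:
  assumes "pflow V A B S T F"
  shows "finite V" "F \<subseteq> V \<times> V" "wf F"
    and "\<And>x y. x \<in> B \<Longrightarrow> (x, y) \<notin> F"
    and "\<And>x y. x \<in> A \<Longrightarrow> (y, x) \<notin> F"
    and "\<And>x y. x \<in> T \<Longrightarrow> x \<notin> A \<Longrightarrow> (x, y) \<notin> F"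
    and "\<And>x y. x \<in> S \<Longrightarrow> x \<notin> B \<Longrightarrow> (y, x) \<notin> F"
    and "\<And>x. x \<in> V \<Longrightarrow> x \<notin> A \<Longrightarrow> x \<notin> B \<Longrightarrow> x \<notin> T \<Longrightarrow> \<exists>!y. (x, y) \<in> F"
    and "\<And>x. x \<in> V \<Longrightarrow> x \<notin> A \<Longrightarrow> x \<notin> B \<Longrightarrow> x \<notin> S \<Longrightarrow> \<exists>!y. (y, x) \<in> F"
proof -
  note a = assms[unfolded pflow_def]
  show "finite V" "F \<subseteq> V \<times> V" "wf F" using a by blast+
  show "\<And>x y. x \<in> B \<Longrightarrow> (x, y) \<notin> F" using a by blast
  show "\<And>x y. x \<in> A \<Longrightarrow> (y, x) \<notin> F" using a by blast
  show "\<And>x y. x \<in> T \<Longrightarrow> x \<notin> A \<Longrightarrow> (x, y) \<notin> F"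
    using a by (metis DomainI SigmaE2 UnE subset_iff)
  show "\<And>x y. x \<in> S \<Longrightarrow> x \<notin> B \<Longrightarrow> (y, x) \<notin> F"
    using a by (metis RangeI SigmaE2 UnE subset_iff)
  show "\<And>x. x \<in> V \<Longrightarrow> x \<notin> A \<Longrightarrow> x \<notin> B \<Longrightarrow> x \<notin> T \<Longrightarrow> \<exists>!y. (x, y) \<in> F"
    using a by (metis UnE)
  show "\<And>x. x \<in> V \<Longrightarrow> x \<notin> A \<Longrightarrow> x \<notin> B \<Longrightarrow> x \<notin> S \<Longrightarrow> \<exists>!y. (y, x) \<in> F"
    using a by (metis UnE)
qed

lemma pflowI:
  assumes "finite V" "F \<subseteq> V \<times> V" "wf F"
    and "\<And>x y. x \<in> B \<Longrightarrow> (x, y) \<notin> F"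
    and "\<And>x y. x \<in> A \<Longrightarrow> (y, x) \<notin> F"
    and "\<And>x y. x \<in> T \<Longrightarrow> x \<notin> A \<Longrightarrow> (x, y) \<notin> F"
    and "\<And>x y. x \<in> S \<Longrightarrow> x \<notin> B \<Longrightarrow> (y, x) \<notin> F"
    and "\<And>x. x \<in> V \<Longrightarrow> x \<notin> A \<Longrightarrow> x \<notin> B \<Longrightarrow> x \<notin> T \<Longrightarrow> \<exists>!y. (x, y) \<in> F"
    and "\<And>x. x \<in> V \<Longrightarrow> x \<notin> A \<Longrightarrow> x \<notin> B \<Longrightarrow> x \<notin> S \<Longrightarrow> \<exists>!y. (y, x) \<in> F"
  shows "pflow V A B S T F"
  unfolding pflow_def using assms by (auto simp: Domain_iff Range_iff)

lemma flowD:
  assumes "flow V u v F"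
  shows "finite V" "F \<subseteq> V \<times> V" "wf F" "u \<in> V" "v \<in> V" "u \<noteq> v"
    and "\<And>y. (v, y) \<notin> F"
    and "\<And>y. (y, u) \<notin> F"
    and "\<And>x. x \<in> V \<Longrightarrow> x \<noteq> u \<Longrightarrow> x \<noteq> v \<Longrightarrow> \<exists>!y. (x, y) \<in> F"
    and "\<And>x. x \<in> V \<Longrightarrow> x \<noteq> u \<Longrightarrow> x \<noteq> v \<Longrightarrow> \<exists>!y. (y, x) \<in> F"
  using assms pflowD[of V "{u}" "{v}" "{}" "{}" F] unfolding flow_def by auto

lemma flowI:
  assumes "finite V" "F \<subseteq> V \<times> V" "wf F" "u \<in> V" "v \<in> V" "u \<noteq> v"
    and "\<And>y. (v, y) \<notin> F"
    and "\<And>y. (y, u) \<notin> F"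
    and "\<And>x. x \<in> V \<Longrightarrow> x \<noteq> u \<Longrightarrow> x \<noteq> v \<Longrightarrow> \<exists>!y. (x, y) \<in> F"
    and "\<And>x. x \<in> V \<Longrightarrow> x \<noteq> u \<Longrightarrow> x \<noteq> v \<Longrightarrow> \<exists>!y. (y, x) \<in> F"
  shows "flow V u v F"
  unfolding flow_def by (intro conjI pflowI) (use assms in \<open>simp; fail | blast\<close>)+

lemma flow_unique_out:
  "flow V u v F \<Longrightarrow> x \<noteq> u \<Longrightarrow> (x, y) \<in> F \<Longrightarrow> (x, z) \<in> F \<Longrightarrow> y = z"
  by (metis SigmaD1 flowD(2,7,9) subset_iff)

lemma flow_unique_in:
  "flow V u v F \<Longrightarrow> x \<noteq> v \<Longrightarrow> (y, x) \<in> F \<Longrightarrow> (z, x) \<in> F \<Longrightarrow> y = z"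
  by (metis SigmaD2 flowD(2,8,10) subset_iff)

text \<open>Arcs inside an already acyclic part may keep the rank \<open>f\<close>; every other arc
  has to raise it. Most constructions below get their acyclicity from this, with \<open>f\<close>
  numbering the layers that paths traverse.\<close>

lemma wf_rank:
  fixes f :: "'a \<Rightarrow> nat"
  assumes "wf R0" and "\<And>x y. (x, y) \<in> R \<Longrightarrow> f x < f y \<or> f x = f y \<and> (g x, g y) \<in> R0"
  shows "wf R"
proof -
  have "wf (inv_image (less_than <*lex*> R0) (\<lambda>x. (f x, g x)))"
    using assms(1) by (intro wf_inv_image wf_lex_prod) auto
  then show ?thesis
    by (rule wf_subset) (use assms(2) in \<open>auto simp: inv_image_def\<close>)
qed

lemma wf_Un_disjoint:
  assumes "wf R" "wf R'" "R \<subseteq> V \<times> V" "R' \<subseteq> V' \<times> V'" "V \<inter> V' = {}"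
  shows "wf (R \<union> R')"
  using assms by (intro wf_Un) auto

text \<open>Summing out-degrees and summing in-degrees both give \<open>card F\<close>, and every
  inner vertex contributes one to each sum. Hence the number of paths may be read off at either end,
  which turns sets prescribed at \<open>v\<close> into path counts at \<open>u\<close>.\<close>

lemma flow_card_out_in:
  assumes "flow V u v F"
  shows "card (F `` {u}) = card (F\<inverse> `` {v})"
proof -
  note d = flowD[OF assms]
  have fF: "finite F" using d(1,2) by (meson finite_SigmaI finite_subset)
  have "card F = (\<Sum>x\<in>V. card (F `` {x}))" if "F \<subseteq> V \<times> V" for F
  proof -
    have "F = Sigma V (\<lambda>x. F `` {x})" using that by auto
    moreover have "finite (F `` {x})" for x
      by (rule finite_subset[OF _ d(1)]) (use that in auto)
    ultimately show ?thesis using d(1) by (metis card_SigmaI)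
  qed
  from this[of F] this[of "F\<inverse>"] have "(\<Sum>x\<in>V. card (F `` {x})) = (\<Sum>x\<in>V. card (F\<inverse> `` {x}))"
    using d(2) by (metis card_inverse converse_Times converse_mono)
  moreover have V: "V = insert u (insert v (V - {u,v}))" using d(4,5) by auto
  have "(\<Sum>x\<in>V. card (F `` {x})) = card (F `` {u}) + card (F `` {v}) + (\<Sum>x\<in>V-{u,v}. card (F `` {x}))"
    using d(1,6) by (subst V) simp
  moreover have "(\<Sum>x\<in>V. card (F\<inverse> `` {x})) = card (F\<inverse> `` {u}) + card (F\<inverse> `` {v}) + (\<Sum>x\<in>V-{u,v}. card (F\<inverse> `` {x}))"
    using d(1,6) by (subst V) simp
  moreover have "card (F `` {x}) = 1" if "x \<in> V - {u,v}" for x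
  proof -
    have "\<exists>!y. (x,y) \<in> F" using d(9)[of x] that by simp
    then obtain y where "(x,y) \<in> F" "\<And>z. (x,z) \<in> F \<Longrightarrow> z = y" by blast
    then have "F `` {x} = {y}" by blast
    then show ?thesis by simp
  qed
  moreover have "card (F\<inverse> `` {x}) = 1" if "x \<in> V - {u,v}" for x
  proof -
    have "\<exists>!y. (y,x) \<in> F" using d(10)[of x] that by simp
    then obtain y where "(y,x) \<in> F" "\<And>z. (z,x) \<in> F \<Longrightarrow> z = y" by blast
    then have "F\<inverse> `` {x} = {y}" by blast
    then show ?thesis by simp
  qed
  moreover have "F `` {v} = {}" "F\<inverse> `` {u} = {}" using d(7,8) by auto
  ultimately show ?thesis by simp
qed

text \<open>With a single path the ends lose their special role: the flow is a Hamiltonian path with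
  source \<open>s\<close> and sink \<open>t\<close>. In this form it can become a piece of a larger
  cover.\<close>

lemma flow_one_pflow:
  assumes "flow V s t F" "card (F `` {s}) = 1"
  shows "pflow V {} {} {s} {t} F"
proof -
  note d = flowD[OF assms(1)]
  have i: "card (F\<inverse> `` {t}) = 1" using flow_card_out_in[OF assms(1)] assms(2) by simp
  obtain a where "F `` {s} = {a}" using assms(2) by (rule card_1_singletonE)
  then have o: "\<exists>!y. (s,y) \<in> F" by (metis Image_singleton_iff insertI1 singletonD)
  obtain b where "F\<inverse> `` {t} = {b}" using i by (rule card_1_singletonE)
  then have o': "\<exists>!y. (y,t) \<in> F" by (metis Image_singleton_iff converse_iff insertI1 singletonD)
  show ?thesis
  proof (rule pflowI)
    show "\<exists>!y. (x, y) \<in> F" if "x \<in> V" "x \<notin> {t}" for x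
      using d(9) o that by (cases "x = s") auto
    show "\<exists>!y. (y, x) \<in> F" if "x \<in> V" "x \<notin> {s}" for x
      using d(10) o' that by (cases "x = t") auto
  qed (use d in auto)
qed

lemma pflow_one_flow:
  assumes "pflow V {} {} {s} {t} F" "s \<in> V" "t \<in> V" "s \<noteq> t"
  shows "flow V s t F" "card (F `` {s}) = 1"
proof -
  note d = pflowD[OF assms(1)]
  show "flow V s t F"
    by (rule flowI) (use d assms in auto)
  have "\<exists>!y. (s,y) \<in> F" using d(8)[of s] assms by simp
  then obtain y where "(s,y) \<in> F" "\<And>z. (s,z) \<in> F \<Longrightarrow> z = y" by blast
  then have "F `` {s} = {y}" by blast
  then show "card (F `` {s}) = 1" by simp
qed

lemma map_prod_arc:
  assumes "inj_on f V" "F \<subseteq> V \<times> V" "x \<in> V"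
  shows "(f x, y) \<in> map_prod f f ` F \<longleftrightarrow> (\<exists>z. y = f z \<and> (x, z) \<in> F)"
    "(y, f x) \<in> map_prod f f ` F \<longleftrightarrow> (\<exists>z. y = f z \<and> (z, x) \<in> F)"
proof -
  have *: "p = x" if "f x = f p" "p \<in> V" for p using that inj_onD[OF assms(1)] assms(3) by metis
  show "(f x, y) \<in> map_prod f f ` F \<longleftrightarrow> (\<exists>z. y = f z \<and> (x, z) \<in> F)"
  proof
    assume "(f x, y) \<in> map_prod f f ` F"
    then obtain p q where "(p, q) \<in> F" "f x = f p" "y = f q" by auto
    then show "\<exists>z. y = f z \<and> (x, z) \<in> F" using *[of p] assms(2) by auto
  qed force
  show "(y, f x) \<in> map_prod f f ` F \<longleftrightarrow> (\<exists>z. y = f z \<and> (z, x) \<in> F)"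
  proof
    assume "(y, f x) \<in> map_prod f f ` F"
    then obtain p q where "(p, q) \<in> F" "y = f p" "f x = f q" by auto
    then show "\<exists>z. y = f z \<and> (z, x) \<in> F" using *[of q] assms(2) by auto
  qed force
qed

lemma pflow_image:
  assumes "pflow V A B S T F" "inj_on f V" and sub: "A \<subseteq> V" "B \<subseteq> V" "S \<subseteq> V" "T \<subseteq> V"
  shows "pflow (f ` V) (f ` A) (f ` B) (f ` S) (f ` T) (map_prod f f ` F)"
proof -
  note d = pflowD[OF assms(1)]
  have FV: "x \<in> V" "y \<in> V" if "(x,y) \<in> F" for x y using d(2) that by auto
  note e1 = map_prod_arc(1)[OF assms(2) d(2)] and e2 = map_prod_arc(2)[OF assms(2) d(2)]
  have m: "f x \<in> f ` X \<longleftrightarrow> x \<in> X" if "X \<subseteq> V" "x \<in> V" for x X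
    using that assms(2) by (meson inj_on_image_mem_iff)
  show ?thesis
  proof (rule pflowI)
    show "wf (map_prod f f ` F)"
      by (rule wf_rank[OF d(3), of _ "\<lambda>_. 0" "the_inv_into V f"])
        (use FV assms(2) in \<open>auto simp: the_inv_into_f_f\<close>)
    show "\<exists>!y. (x, y) \<in> map_prod f f ` F" if "x \<in> f ` V" "x \<notin> f ` A" "x \<notin> f ` B" "x \<notin> f ` T" for x
    proof -
      from that(1) obtain z where z: "x = f z" "z \<in> V" by blast
      then have "\<exists>!y. (z,y) \<in> F" using d(8)[of z] that by auto
      then show ?thesis unfolding z(1) e1[OF z(2)] by blast
    qed
    show "\<exists>!y. (y, x) \<in> map_prod f f ` F" if "x \<in> f ` V" "x \<notin> f ` A" "x \<notin> f ` B" "x \<notin> f ` S" for x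
    proof -
      from that(1) obtain z where z: "x = f z" "z \<in> V" by blast
      then have "\<exists>!y. (y,z) \<in> F" using d(9)[of z] that by auto
      then show ?thesis unfolding z(1) e2[OF z(2)] by blast
    qed
    show "(x, y) \<notin> map_prod f f ` F" if "x \<in> f ` B" for x y
    proof -
      from that obtain z where z: "x = f z" "z \<in> B" by blast
      have "z \<in> V" using z(2) sub by blast
      moreover have "z \<notin> {}" using that z by blast
      ultimately show ?thesis using d(4)[of z] z(2) unfolding z(1) e1[OF \<open>z \<in> V\<close>] by blast
    qed
    show "(y, x) \<notin> map_prod f f ` F" if "x \<in> f ` A" for x y
    proof -
      from that obtain z where z: "x = f z" "z \<in> A" by blast
      have "z \<in> V" using z(2) sub by blast
      moreover have "z \<notin> {}" using that z by blast
      ultimately show ?thesis using d(5)[of z] z(2) unfolding z(1) e2[OF \<open>z \<in> V\<close>] by blast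
    qed
    show "(x, y) \<notin> map_prod f f ` F" if "x \<in> f ` T" "x \<notin> f ` A" for x y
    proof -
      from that(1) obtain z where z: "x = f z" "z \<in> T" by blast
      have "z \<in> V" using z(2) sub by blast
      moreover have "z \<notin> A" using that z by blast
      ultimately show ?thesis using d(6)[of z] z(2) unfolding z(1) e1[OF \<open>z \<in> V\<close>] by blast
    qed
    show "(y, x) \<notin> map_prod f f ` F" if "x \<in> f ` S" "x \<notin> f ` B" for x y
    proof -
      from that(1) obtain z where z: "x = f z" "z \<in> S" by blast
      have "z \<in> V" using z(2) sub by blast
      moreover have "z \<notin> B" using that z by blast
      ultimately show ?thesis using d(7)[of z] z(2) unfolding z(1) e2[OF \<open>z \<in> V\<close>] by blast
    qed
    show "map_prod f f ` F \<subseteq> f ` V \<times> f ` V" using d(2) by auto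
  qed (use d(1) in simp)
qed

lemma flow_image:
  assumes "flow V u v F" "inj_on f V"
  shows "flow (f ` V) (f u) (f v) (map_prod f f ` F)"
    "(map_prod f f ` F) `` {f u} = f ` (F `` {u})"
    "(map_prod f f ` F)\<inverse> `` {f v} = f ` (F\<inverse> `` {v})"
proof -
  note d = flowD[OF assms(1)]
  show "flow (f ` V) (f u) (f v) (map_prod f f ` F)"
    using assms d(4,5,6) pflow_image[of V "{u}" "{v}" "{}" "{}" F f] unfolding flow_def by (auto simp: inj_on_eq_iff)
  show "(map_prod f f ` F) `` {f u} = f ` (F `` {u})"
    by (rule set_eqI, simp only: Image_singleton_iff map_prod_arc(1)[OF assms(2) d(2,4)]) blast
  show "(map_prod f f ` F)\<inverse> `` {f v} = f ` (F\<inverse> `` {v})"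
    by (rule set_eqI, simp only: Image_singleton_iff converse_iff map_prod_arc(2)[OF assms(2) d(2,5)]) blast
qed

section \<open>Gluing and composing covers by disjoint paths\<close>

lemma pflow_single: "pflow {x} {} {} {x} {x} {}"
  by (rule pflowI) auto

lemma pflow_empty: "pflow {} {} {} {} {} {}"
  by (rule pflowI) auto

lemma pflow_Un:
  assumes "pflow V {} {} S T F" "pflow V' {} {} S' T' F'" "V \<inter> V' = {}"
    "S \<subseteq> V" "T \<subseteq> V" "S' \<subseteq> V'" "T' \<subseteq> V'"
  shows "pflow (V \<union> V') {} {} (S \<union> S') (T \<union> T') (F \<union> F')"
proof -
  note d = pflowD[OF assms(1)] and d' = pflowD[OF assms(2)]
  show ?thesis
  proof (rule pflowI)
    show "wf (F \<union> F')" using d(2,3) d'(2,3) assms(3) by (intro wf_Un_disjoint) auto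
    have a: "(x,y) \<in> F \<Longrightarrow> x \<in> V \<and> y \<in> V \<and> x \<notin> V' \<and> y \<notin> V'"
       "(x,y) \<in> F' \<Longrightarrow> x \<in> V' \<and> y \<in> V' \<and> x \<notin> V \<and> y \<notin> V" for x y using d(2) d'(2) assms(3) by auto
    show "\<exists>!y. (x, y) \<in> F \<union> F'" if "x \<in> V \<union> V'" "x \<notin> T \<union> T'" for x
      using that d(8)[of x] d'(8)[of x] a by (metis Un_iff empty_iff)
    show "\<exists>!y. (y, x) \<in> F \<union> F'" if "x \<in> V \<union> V'" "x \<notin> S \<union> S'" for x
      using that d(9)[of x] d'(9)[of x] a by (metis Un_iff empty_iff)
    show "(x, y) \<notin> F \<union> F'" if "x \<in> T \<union> T'" for x y
      using that a[of x y] d(6)[of x y] d'(6)[of x y] assms(5,7) by auto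
    show "(y, x) \<notin> F \<union> F'" if "x \<in> S \<union> S'" for x y
      using that a[of y x] d(7)[of x y] d'(7)[of x y] assms(4,6) by auto
  qed (use d d' in auto)
qed

text \<open>\<open>a\<close> is the only sink of the first part, so the arc \<open>(a, b)\<close>
  uses it up together with the source \<open>b\<close> and leaves all sinks to the second part. This
  is how a path passes from one copy to the next.\<close>

lemma pflow_glue:
  assumes "pflow V {} {} S {a} F" "pflow V' {} {} S' T' F'" "V \<inter> V' = {}"
    "S \<subseteq> V" "a \<in> V" "S' \<subseteq> V'" "T' \<subseteq> V'" "b \<in> S'"
  shows "pflow (V \<union> V') {} {} (S \<union> (S' - {b})) T' (insert (a, b) (F \<union> F'))"
proof -
  note d = pflowD[OF assms(1)] and d' = pflowD[OF assms(2)]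
  have a: "(x,y) \<in> F \<Longrightarrow> x \<in> V \<and> y \<in> V \<and> x \<notin> V' \<and> y \<notin> V'"
     "(x,y) \<in> F' \<Longrightarrow> x \<in> V' \<and> y \<in> V' \<and> x \<notin> V \<and> y \<notin> V" for x y using d(2) d'(2) assms(3) by auto
  have ab: "a \<notin> V'" "b \<in> V'" "b \<notin> V" using assms by auto
  show ?thesis
  proof (rule pflowI)
    have w: "wf (F \<union> F')" using d(2,3) d'(2,3) assms(3) by (intro wf_Un_disjoint) auto
    show "wf (insert (a, b) (F \<union> F'))"
      by (rule wf_rank[OF w, of _ "\<lambda>x. if x \<in> V then 0 else 1" id]) (use a ab assms in auto)
    show "\<exists>!y. (x, y) \<in> insert (a, b) (F \<union> F')" if "x \<in> V \<union> V'" "x \<notin> T'" for x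
    proof (cases "x = a")
      case True
      then show ?thesis using d(6)[of a] a ab by auto
    next
      case False
      then show ?thesis using that d(8)[of x] d'(8)[of x] a by (metis Un_iff empty_iff insert_iff prod.inject)
    qed
    show "\<exists>!y. (y, x) \<in> insert (a, b) (F \<union> F')" if "x \<in> V \<union> V'" "x \<notin> S \<union> (S' - {b})" for x
    proof (cases "x = b")
      case True
      then show ?thesis using d'(7)[of b] a ab assms(8) by auto
    next
      case False
      then show ?thesis using that d(9)[of x] d'(9)[of x] a by (metis Diff_iff Un_iff empty_iff insert_iff prod.inject)
    qed
    show "(x, y) \<notin> insert (a, b) (F \<union> F')" if "x \<in> T'" for x y
      using that a[of x y] d'(6)[of x y] assms(7) ab by auto
    show "(y, x) \<notin> insert (a, b) (F \<union> F')" if "x \<in> S \<union> (S' - {b})" for x y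
      using that a[of y x] d(7)[of x y] d'(7)[of x y] assms(4,6) ab by auto
  qed (use d d' ab assms in auto)
qed

text \<open>All links \<open>m\<close> go upwards in the order \<open>V1\<close>, \<open>W\<close>, \<open>V3\<close>, so no cycle can arise.\<close>

lemma flow_compose:
  assumes p1: "pflow V1 {u} {} {} T1 F1" and p2: "pflow W {} {} S2 T2 F2" and p3: "pflow V3 {} {v} S3 {} F3"
    and dis: "V1 \<inter> W = {}" "V1 \<inter> V3 = {}" "W \<inter> V3 = {}"
    and sub: "T1 \<subseteq> V1" "S2 \<subseteq> W" "T2 \<subseteq> W" "S3 \<subseteq> V3" "u \<in> V1" "v \<in> V3"
    and dom: "Domain m \<subseteq> insert u (T1 \<union> T2)" and ran: "Range m \<subseteq> insert v (S2 \<union> S3)"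
    and up: "\<And>x y. (x, y) \<in> m \<Longrightarrow> x \<in> W \<Longrightarrow> y \<in> V3"
    and out: "\<And>x. x \<in> T1 \<union> T2 \<Longrightarrow> x \<noteq> u \<Longrightarrow> \<exists>!y. (x, y) \<in> m"
    and inn: "\<And>y. y \<in> S2 \<union> S3 \<Longrightarrow> y \<noteq> v \<Longrightarrow> \<exists>!x. (x, y) \<in> m"
  shows "flow (V1 \<union> W \<union> V3) u v (F1 \<union> F2 \<union> F3 \<union> m)"
proof -
  note d1 = pflowD[OF p1] and d2 = pflowD[OF p2] and d3 = pflowD[OF p3]
  let ?F = "F1 \<union> F2 \<union> F3 \<union> m"
  have a1: "(x,y) \<in> F1 \<Longrightarrow> x \<in> V1 \<and> y \<in> V1 \<and> x \<notin> W \<and> y \<notin> W \<and> x \<notin> V3 \<and> y \<notin> V3" for x y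
    using d1(2) dis by auto
  have a2: "(x,y) \<in> F2 \<Longrightarrow> x \<notin> V1 \<and> y \<notin> V1 \<and> x \<in> W \<and> y \<in> W \<and> x \<notin> V3 \<and> y \<notin> V3" for x y
    using d2(2) dis by auto
  have a3: "(x,y) \<in> F3 \<Longrightarrow> x \<notin> V1 \<and> y \<notin> V1 \<and> x \<notin> W \<and> y \<notin> W \<and> x \<in> V3 \<and> y \<in> V3" for x y
    using d3(2) dis by auto
  have mx: "(x,y) \<in> m \<Longrightarrow> x \<in> insert u (T1 \<union> T2)" for x y using dom by auto
  have my: "(x,y) \<in> m \<Longrightarrow> y \<in> insert v (S2 \<union> S3)" for x y using ran by auto
  have t1: "x \<in> T1 \<Longrightarrow> x \<in> V1 \<and> x \<notin> W \<and> x \<notin> V3" for x using sub dis by auto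
  have t2: "x \<in> T2 \<Longrightarrow> x \<notin> V1 \<and> x \<in> W \<and> x \<notin> V3" for x using sub dis by auto
  have s2: "x \<in> S2 \<Longrightarrow> x \<notin> V1 \<and> x \<in> W \<and> x \<notin> V3" for x using sub dis by auto
  have s3: "x \<in> S3 \<Longrightarrow> x \<notin> V1 \<and> x \<notin> W \<and> x \<in> V3" for x using sub dis by auto
  have uv: "u \<in> V1" "u \<notin> W" "u \<notin> V3" "v \<notin> V1" "v \<notin> W" "v \<in> V3" using sub dis by auto
  show ?thesis
  proof (rule flowI)
    show "?F \<subseteq> (V1 \<union> W \<union> V3) \<times> (V1 \<union> W \<union> V3)"
    proof
      fix e assume e: "e \<in> ?F"
      obtain x y where xy: "e = (x,y)" by (cases e)
      show "e \<in> (V1 \<union> W \<union> V3) \<times> (V1 \<union> W \<union> V3)"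
        using e a1[of x y] a2[of x y] a3[of x y] mx[of x y] my[of x y] t1[of x] t2[of x] s2[of y] s3[of y] uv
        unfolding xy by auto
    qed
    have "wf (F1 \<union> F2)" using d1(2,3) d2(2,3) dis by (intro wf_Un_disjoint) auto
    then have w: "wf (F1 \<union> F2 \<union> F3)"
      by (rule wf_Un_disjoint[of _ _ "V1 \<union> W" V3]) (use d1(2) d2(2) d3(2,3) dis in auto)
    show "wf ?F"
    proof (rule wf_rank[OF w, of _ "\<lambda>x. if x \<in> V1 then 0 else if x \<in> W then 1 else 2" id])
      fix x y assume "(x,y) \<in> ?F"
      then show "(if x \<in> V1 then 0 else if x \<in> W then 1 else 2) < (if y \<in> V1 then 0 else if y \<in> W then 1 else 2::nat) \<or>
         (if x \<in> V1 then 0 else if x \<in> W then 1 else 2) = (if y \<in> V1 then 0 else if y \<in> W then 1 else 2::nat) \<and>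
         (id x, id y) \<in> F1 \<union> F2 \<union> F3"
        using a1[of x y] a2[of x y] a3[of x y] mx[of x y] my[of x y] t1[of x] t2[of x] s2[of y] s3[of y] uv up[of x y]
        by auto
    qed
    show "(v, y) \<notin> ?F" for y
      using a1[of v y] a2[of v y] d3(4)[of v y] mx[of v y] t1[of v] t2[of v] uv by auto
    show "(y, u) \<notin> ?F" for y
      using d1(5)[of u y] a2[of y u] a3[of y u] my[of y u] s2[of u] s3[of u] uv by auto
    fix x assume x: "x \<in> V1 \<union> W \<union> V3" "x \<noteq> u" "x \<noteq> v"
    show "\<exists>!y. (x, y) \<in> ?F"
    proof (cases "x \<in> T1 \<union> T2")
      case True
      then obtain y where y: "(x,y) \<in> m" "\<And>z. (x,z) \<in> m \<Longrightarrow> z = y" using out x by metis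
      have "(x,z) \<notin> F1 \<union> F2 \<union> F3" for z
        using True d1(6)[of x z] d2(6)[of x z] a1[of x z] a2[of x z] a3[of x z] t1[of x] t2[of x] x by auto
      then show ?thesis using y by blast
    next
      case False
      then have nm: "(x,z) \<notin> m" for z using mx[of x z] x by auto
      consider "x \<in> V1" | "x \<in> W" | "x \<in> V3" using x by auto
      then show ?thesis
      proof cases
        case 1
        then have "\<exists>!y. (x,y) \<in> F1" using d1(8)[of x] x False by auto
        moreover have "(x,z) \<notin> F2 \<union> F3" for z using a2[of x z] a3[of x z] 1 by auto
        ultimately show ?thesis using nm by (metis Un_iff)
      next
        case 2
        then have "\<exists>!y. (x,y) \<in> F2" using d2(8)[of x] x False by auto
        moreover have "(x,z) \<notin> F1 \<union> F3" for z using a1[of x z] a3[of x z] 2 by auto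
        ultimately show ?thesis using nm by (metis Un_iff)
      next
        case 3
        then have "\<exists>!y. (x,y) \<in> F3" using d3(8)[of x] x False by auto
        moreover have "(x,z) \<notin> F1 \<union> F2" for z using a1[of x z] a2[of x z] 3 by auto
        ultimately show ?thesis using nm by (metis Un_iff)
      qed
    qed
    show "\<exists>!y. (y, x) \<in> ?F"
    proof (cases "x \<in> S2 \<union> S3")
      case True
      then obtain y where y: "(y,x) \<in> m" "\<And>z. (z,x) \<in> m \<Longrightarrow> z = y" using inn x by metis
      have "(z,x) \<notin> F1 \<union> F2 \<union> F3" for z
        using True d2(7)[of x z] d3(7)[of x z] a1[of z x] a2[of z x] a3[of z x] s2[of x] s3[of x] x by auto
      then show ?thesis using y by blast
    next
      case False
      then have nm: "(z,x) \<notin> m" for z using my[of z x] x by auto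
      consider "x \<in> V1" | "x \<in> W" | "x \<in> V3" using x by auto
      then show ?thesis
      proof cases
        case 1
        then have "\<exists>!y. (y,x) \<in> F1" using d1(9)[of x] x False by auto
        moreover have "(z,x) \<notin> F2 \<union> F3" for z using a2[of z x] a3[of z x] 1 by auto
        ultimately show ?thesis using nm by (metis Un_iff)
      next
        case 2
        then have "\<exists>!y. (y,x) \<in> F2" using d2(9)[of x] x False by auto
        moreover have "(z,x) \<notin> F1 \<union> F3" for z using a1[of z x] a3[of z x] 2 by auto
        ultimately show ?thesis using nm by (metis Un_iff)
      next
        case 3
        then have "\<exists>!y. (y,x) \<in> F3" using d3(9)[of x] x False by auto
        moreover have "(z,x) \<notin> F1 \<union> F2" for z using a1[of z x] a2[of z x] 3 by auto
        ultimately show ?thesis using nm by (metis Un_iff)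
      qed
    qed
  qed (use d1(1) d2(1) d3(1) uv in auto)
qed

text \<open>New paths run in parallel to the old ones: each source in \<open>S\<close> is entered
  from \<open>u\<close>, each sink in \<open>T\<close> is left for \<open>v\<close>. The end sets
  are stated exactly because path counts and prescribed sets are computed from them.\<close>

lemma flow_par:
  assumes f: "flow V u v F" and p: "pflow W {} {} S T H" and dis: "V \<inter> W = {}" "S \<subseteq> W" "T \<subseteq> W"
  defines "F' \<equiv> F \<union> H \<union> {u} \<times> S \<union> T \<times> {v}"
  shows "flow (V \<union> W) u v F'" "F' `` {u} = F `` {u} \<union> S" "F'\<inverse> `` {v} = F\<inverse> `` {v} \<union> T"
proof -
  note d = flowD[OF f] and e = pflowD[OF p]
  have a: "(x,y) \<in> F \<Longrightarrow> x \<in> V \<and> y \<in> V \<and> x \<notin> W \<and> y \<notin> W"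
     "(x,y) \<in> H \<Longrightarrow> x \<in> W \<and> y \<in> W \<and> x \<notin> V \<and> y \<notin> V" for x y using d(2) e(2) dis by auto
  have uv: "u \<notin> W" "v \<notin> W" using d dis by auto
  have st: "x \<in> S \<Longrightarrow> x \<notin> V" "x \<in> T \<Longrightarrow> x \<notin> V" for x using dis by auto
  show "flow (V \<union> W) u v F'"
  proof (rule flowI)
    show "F' \<subseteq> (V \<union> W) \<times> (V \<union> W)" using d(2,4,5) e(2) dis unfolding F'_def by auto
    have w: "wf (F \<union> H)" using d(2,3) e(2,3) dis by (intro wf_Un_disjoint) auto
    show "wf F'"
      by (rule wf_rank[OF w, of _ "\<lambda>x. if x = u then 0 else if x = v then 2 else 1" id])
        (use d(6,7,8) e(2) uv dis in \<open>auto simp: F'_def split: if_splits\<close>)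
    show "(v, y) \<notin> F'" "(y, u) \<notin> F'" for y using d(6,7,8) uv a[of v y] a[of y u] st dis unfolding F'_def by auto
    fix x assume x: "x \<in> V \<union> W" "x \<noteq> u" "x \<noteq> v"
    show "\<exists>!y. (x, y) \<in> F'"
    proof (cases "x \<in> T")
      case True
      then have "(x,y) \<in> F' \<longleftrightarrow> y = v" for y using x a[of x y] e(6)[of x y] st unfolding F'_def by auto
      then show ?thesis by simp
    next
      case False
      then have "(x,y) \<in> F' \<longleftrightarrow> (x,y) \<in> F \<or> (x,y) \<in> H" for y using x unfolding F'_def by auto
      then show ?thesis using x False a d(9)[of x] e(8)[of x] by (cases "x \<in> V") (auto; metis)+
    qed
    show "\<exists>!y. (y, x) \<in> F'"
    proof (cases "x \<in> S")
      case True
      then have "(y,x) \<in> F' \<longleftrightarrow> y = u" for y using x a[of y x] e(7)[of x y] st unfolding F'_def by auto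
      then show ?thesis by simp
    next
      case False
      then have "(y,x) \<in> F' \<longleftrightarrow> (y,x) \<in> F \<or> (y,x) \<in> H" for y using x unfolding F'_def by auto
      then show ?thesis using x False a d(10)[of x] e(9)[of x] by (cases "x \<in> V") (auto; metis)+
    qed
  qed (use d e in auto)
  show "F' `` {u} = F `` {u} \<union> S" using uv a d(6) dis unfolding F'_def by auto
  show "F'\<inverse> `` {v} = F\<inverse> `` {v} \<union> T" using uv a d(6) dis unfolding F'_def by auto
qed

text \<open>The disjunction \<open>new\<close> describes two surgeries on the arc from
  \<open>z\<close> to \<open>x\<close>: a detour through \<open>W\<close>, or sending
  \<open>z\<close> straight to \<open>v\<close> and reaching \<open>x\<close> from \<open>u\<close>
  through \<open>W\<close>. The degree conditions are checked in the same way for both; acyclicity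
  needs different ranks and is therefore a hypothesis.\<close>

lemma flow_splice:
  assumes f: "flow V u v F" and zx: "(z, x) \<in> F" and p: "pflow W {} {} {s} {t} H"
    and dis: "V \<inter> W = {}" "s \<in> W" "t \<in> W"
    and new: "z' = s \<and> s' = z \<or> z' = v \<and> s' = u \<and> z \<noteq> u \<and> x \<noteq> v"
  defines "F' \<equiv> (F - {(z, x)}) \<union> H \<union> {(z, z'), (s', s), (t, x)}"
  assumes w: "wf F'"
  shows "flow (V \<union> W) u v F'"
proof -
  note d = flowD[OF f] and e = pflowD[OF p]
  have a: "(x,y) \<in> F \<Longrightarrow> x \<in> V \<and> y \<in> V \<and> x \<notin> W \<and> y \<notin> W"
     "(x,y) \<in> H \<Longrightarrow> x \<in> W \<and> y \<in> W \<and> x \<notin> V \<and> y \<notin> V" for x y using d(2) e(2) dis by auto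
  have uv: "u \<notin> W" "v \<notin> W" using d dis by auto
  have zx': "z \<in> V" "x \<in> V" "z \<notin> W" "x \<notin> W" "z \<noteq> v" "x \<noteq> u" "s \<notin> V" "t \<notin> V"
    using a[of z x] zx dis d(7,8) by auto
  show ?thesis
  proof (rule flowI)
    show "F' \<subseteq> (V \<union> W) \<times> (V \<union> W)" using d(2,4,5) zx' e(2) dis new unfolding F'_def by auto
    show "(v, y) \<notin> F'" "(y, u) \<notin> F'" for y
      using d(6,7,8) uv a[of v y] a[of y u] zx' dis new unfolding F'_def by auto
    fix y assume y: "y \<in> V \<union> W" "y \<noteq> u" "y \<noteq> v"
    show "\<exists>!q. (y, q) \<in> F'"
    proof -
      consider "y = z" | "y = t" | "y \<noteq> z" "y \<noteq> t" "y \<in> V" | "y \<noteq> z" "y \<noteq> t" "y \<in> W" using y by blast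
      then show ?thesis
      proof cases
        case 1
        then have "(y,q) \<in> F' \<longleftrightarrow> q = z'" for q
          using a[of z q] zx' zx flow_unique_out[OF f, of z x q] y dis new unfolding F'_def by auto
        then show ?thesis by simp
      next
        case 2
        then have "(y,q) \<in> F' \<longleftrightarrow> q = x" for q
          using a[of t q] zx' e(6)[of t q] dis uv new unfolding F'_def by auto
        then show ?thesis by simp
      next
        case 3
        then have "(y,q) \<in> F' \<longleftrightarrow> (y,q) \<in> F" for q using a[of y q] y new unfolding F'_def by auto
        then show ?thesis using d(9)[of y] 3 y by simp
      next
        case 4
        then have "(y,q) \<in> F' \<longleftrightarrow> (y,q) \<in> H" for q using a[of y q] y new unfolding F'_def by auto
        then show ?thesis using e(8)[of y] 4 y by simp
      qed
    qed
    show "\<exists>!q. (q, y) \<in> F'"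
    proof -
      consider "y = x" | "y = s" | "y \<noteq> x" "y \<noteq> s" "y \<in> V" | "y \<noteq> x" "y \<noteq> s" "y \<in> W" using y by blast
      then show ?thesis
      proof cases
        case 1
        then have "(q,y) \<in> F' \<longleftrightarrow> q = t" for q
          using a[of q x] zx' zx flow_unique_in[OF f, of x z q] y dis new unfolding F'_def by auto
        then show ?thesis by simp
      next
        case 2
        then have "(q,y) \<in> F' \<longleftrightarrow> q = s'" for q
          using a[of q s] zx' e(7)[of s q] dis uv new unfolding F'_def by auto
        then show ?thesis by simp
      next
        case 3
        then have "(q,y) \<in> F' \<longleftrightarrow> (q,y) \<in> F" for q using a[of q y] y new unfolding F'_def by auto
        then show ?thesis using d(10)[of y] 3 y by simp
      next
        case 4
        then have "(q,y) \<in> F' \<longleftrightarrow> (q,y) \<in> H" for q using a[of q y] y new unfolding F'_def by auto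
        then show ?thesis using e(9)[of y] 4 y by simp
      qed
    qed
  qed (use d e w in auto)
qed

text \<open>A detour keeps the number of paths: if it starts at \<open>u\<close>, one out-neighbour
  of \<open>u\<close> is merely exchanged for another. The predecessors of \<open>v\<close> can
  change only if the detour ends in \<open>v\<close> itself.\<close>

lemma flow_insert:
  assumes f: "flow V u v F" and zx: "(z, x) \<in> F" and p: "pflow W {} {} {s} {t} H"
    and dis: "V \<inter> W = {}" "s \<in> W" "t \<in> W"
  defines "F' \<equiv> (F - {(z, x)}) \<union> H \<union> {(z, s), (t, x)}"
  shows "flow (V \<union> W) u v F'" "card (F' `` {u}) = card (F `` {u})"
    "x \<noteq> v \<Longrightarrow> F'\<inverse> `` {v} = F\<inverse> `` {v}"
proof -
  note d = flowD[OF f] and e = pflowD[OF p]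
  have a: "(x,y) \<in> F \<Longrightarrow> x \<in> V \<and> y \<in> V \<and> x \<notin> W \<and> y \<notin> W"
     "(x,y) \<in> H \<Longrightarrow> x \<in> W \<and> y \<in> W \<and> x \<notin> V \<and> y \<notin> V" for x y using d(2) e(2) dis by auto
  have uv: "u \<notin> W" "v \<notin> W" using d dis by auto
  have zx': "z \<in> V" "x \<in> V" "z \<notin> W" "x \<notin> W" "z \<noteq> v" "x \<noteq> u" "s \<notin> V" "t \<notin> V"
    using a[of z x] zx dis d(7,8) by auto
  \<comment> \<open>All of \<open>W\<close> gets the position of \<open>x\<close> in the old order,
    just before \<open>x\<close> itself; inside \<open>W\<close> the order of \<open>H\<close>
    decides.\<close>
  have w: "wf (F <*lex*> (less_than <*lex*> H))" using d(3) e(3) by (intro wf_lex_prod) auto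
  have "wf F'"
    by (rule wf_rank[OF w, of _ "\<lambda>_. 0" "\<lambda>y. if y \<in> W then (x, 0, y) else (y, 1, y)"])
      (use a zx zx' dis in \<open>auto simp: F'_def split: if_splits\<close>)
  then show "flow (V \<union> W) u v F'"
    using flow_splice[OF f zx p dis, of s z] unfolding F'_def by simp
  have fin: "finite (F `` {u})" using d(1,2) by (auto intro: finite_subset[of _ V])
  show "card (F' `` {u}) = card (F `` {u})"
  proof (cases "z = u")
    case True
    then have "F' `` {u} = insert s (F `` {u} - {x})" using a[of u] zx' uv dis unfolding F'_def by auto
    moreover have "s \<notin> F `` {u}" using a zx' by auto
    ultimately show ?thesis using fin zx True
      by (metis Diff_iff Image_singleton_iff card.remove card_insert_disjoint finite_Diff)
  next
    case False
    then have "F' `` {u} = F `` {u}" using a[of u] zx' uv dis unfolding F'_def by auto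
    then show ?thesis by simp
  qed
  show "F'\<inverse> `` {v} = F\<inverse> `` {v}" if "x \<noteq> v"
    using that a[of _ v] uv zx' dis unfolding F'_def by auto
qed

text \<open>One path is cut in two: the part up to \<open>z\<close> goes to \<open>v\<close>
  directly, the rest is reached from \<open>u\<close> through \<open>W\<close>. This gains a path,
  whereas a detour gains none.\<close>

lemma flow_jump:
  assumes f: "flow V u v F" and zx: "(z, x) \<in> F" and p: "pflow W {} {} {s} {t} H"
    and dis: "V \<inter> W = {}" "s \<in> W" "t \<in> W" and nz: "z \<noteq> u" "x \<noteq> v"
  defines "F' \<equiv> (F - {(z, x)}) \<union> H \<union> {(z, v), (u, s), (t, x)}"
  shows "flow (V \<union> W) u v F'" "F' `` {u} = insert s (F `` {u})" "s \<notin> F `` {u}"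
proof -
  note d = flowD[OF f] and e = pflowD[OF p]
  have a: "(x,y) \<in> F \<Longrightarrow> x \<in> V \<and> y \<in> V \<and> x \<notin> W \<and> y \<notin> W"
     "(x,y) \<in> H \<Longrightarrow> x \<in> W \<and> y \<in> W \<and> x \<notin> V \<and> y \<notin> V" for x y using d(2) e(2) dis by auto
  have uv: "u \<notin> W" "v \<notin> W" using d dis by auto
  have zx': "z \<in> V" "x \<in> V" "z \<notin> W" "x \<notin> W" "z \<noteq> v" "x \<noteq> u" "s \<notin> V" "t \<notin> V"
    using a[of z x] zx dis d(7,8) by auto
  have w: "wf (F \<union> H)" using d(2,3) e(2,3) dis by (intro wf_Un_disjoint) auto
  \<comment> \<open>No cycle arises because \<open>W\<close> is entered from \<open>u\<close> only.\<close>
  have "wf F'"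
    by (rule wf_rank[OF w, of _ "\<lambda>y. if y = u then 0 else if y \<in> W then 1 else if y = v then 3 else 2" id])
      (use a zx zx' uv dis d(6,7,8) nz in \<open>auto simp: F'_def split: if_splits\<close>)
  then show "flow (V \<union> W) u v F'"
    using flow_splice[OF f zx p dis, of v u] nz unfolding F'_def by simp
  show "F' `` {u} = insert s (F `` {u})" using a[of u] zx' uv dis nz d(6) unfolding F'_def by auto
  show "s \<notin> F `` {u}" using a zx' by auto
qed

section \<open>Flows from explicit paths, and containers from flows\<close>

lemma path_pflow:
  assumes "distinct p" "p \<noteq> []" "successively R p"
  shows "\<exists>F. pflow (set p) {} {} {hd p} {last p} F \<and> (\<forall>(x,y)\<in>F. R x y)"
  using assms
proof (induction p rule: induct_list012)
  case (2 x)
  then show ?case using pflow_single[of x] by (intro exI[of _ "{}"]) simp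
next
  case (3 x y zs)
  then obtain F where F: "pflow (set (y # zs)) {} {} {y} {last (y # zs)} F" "\<forall>(x,y)\<in>F. R x y" by auto
  have "pflow ({x} \<union> set (y # zs)) {} {} ({x} \<union> ({y} - {y})) {last (y # zs)} (insert (x, y) ({} \<union> F))"
    using 3 by (intro pflow_glue[OF pflow_single F(1)]) auto
  then have "pflow (set (x # y # zs)) {} {} {hd (x # y # zs)} {last (x # y # zs)} (insert (x, y) F)"
    by (simp add: insert_commute)
  then show ?case using F(2) 3(5) by (intro exI[of _ "insert (x, y) F"]) (simp add: successively_Cons)
qed simp

text \<open>Serves the cases settled by listing paths; the lists in \<open>ps\<close> hold the inner
  vertices. The edge from \<open>u\<close> to \<open>v\<close> has no inner vertex, hence the
  separate flag \<open>d\<close>.\<close>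

lemma paths_flow:
  assumes "u \<noteq> v" "distinct (concat ps)" "u \<notin> set (concat ps)" "v \<notin> set (concat ps)" "[] \<notin> set ps"
    "\<forall>p\<in>set ps. successively R (u # p @ [v])" "d \<longrightarrow> R u v"
  shows "\<exists>F. flow ({u, v} \<union> set (concat ps)) u v F \<and> F `` {u} = hd ` set ps \<union> (if d then {v} else {}) \<and>
    F\<inverse> `` {v} = last ` set ps \<union> (if d then {u} else {}) \<and> (\<forall>(x,y)\<in>F. R x y)"
  using assms
proof (induction ps)
  case Nil
  have "flow {u,v} u v (if d then {(u,v)} else {})"
    by (rule flowI) (use Nil(1) in \<open>auto simp: wf_insert\<close>)
  then show ?case using Nil by (intro exI[of _ "if d then {(u,v)} else {}"]) auto
next
  case (Cons p ps)
  obtain F where F: "flow ({u, v} \<union> set (concat ps)) u v F" "F `` {u} = hd ` set ps \<union> (if d then {v} else {})"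
    "F\<inverse> `` {v} = last ` set ps \<union> (if d then {u} else {})" "\<forall>(x,y)\<in>F. R x y"
    using Cons by auto
  have p: "p \<noteq> []" "distinct p" "successively R (u # p @ [v])" using Cons.prems by auto
  then have R: "successively R p" "R u (hd p)" "R (last p) v"
    by (auto simp: successively_append_iff successively_Cons)
  obtain H where H: "pflow (set p) {} {} {hd p} {last p} H" "\<forall>(x,y)\<in>H. R x y"
    using path_pflow[OF p(2,1) R(1)] by blast
  have dis: "({u, v} \<union> set (concat ps)) \<inter> set p = {}" using Cons.prems by auto
  have hl: "{hd p} \<subseteq> set p" "{last p} \<subseteq> set p" using p(1) by auto
  note fp = flow_par[OF F(1) H(1) dis hl]
  have "{u, v} \<union> set (concat ps) \<union> set p = {u, v} \<union> set (concat (p # ps))" by auto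
  then show ?case using fp F(2-4) H(2) R
    by (intro exI[of _ "F \<union> H \<union> {u} \<times> {hd p} \<union> {last p} \<times> {v}"]) auto
qed

text \<open>Unique successors lead from each out-neighbour of \<open>u\<close> to \<open>v\<close>;
  the walk stops because a finite well-founded relation has a well-founded converse. Unique
  predecessors keep two such walks apart until \<open>v\<close>, and walking back from an inner
  vertex leads to \<open>u\<close>, so all inner vertices are covered. \<open>l \<noteq> 0\<close>
  provides a path, hence covers \<open>u\<close> and \<open>v\<close>.\<close>

lemma flow_imp_star_container:
  assumes f: "flow V u v F" and c: "card (F `` {u}) = l" "l \<noteq> 0" and E: "\<forall>(x,y)\<in>F. E x y"
  shows "\<exists>C. is_star_container V E l u v C"
proof -
  note d = flowD[OF f]
  have fF: "finite F" using d(1,2) by (meson finite_SigmaI finite_subset)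
  have wc: "wf (F\<inverse>)" using fF d(3) by (simp add: wf_iff_acyclic_if_finite)
  have ac: "(x,x) \<notin> F\<^sup>+" for x using d(3) by (simp add: wf_acyclic acyclic_def[symmetric] wf_not_refl wf_trancl)
  \<comment> \<open>The list contains exactly the vertices reachable from \<open>x\<close>, so that
    disjointness and covering become statements about the closure of \<open>F\<close>.\<close>
  have ex: "\<exists>p. p \<noteq> [] \<and> hd p = x \<and> last p = v \<and> distinct p \<and> set p = {z. (x,z) \<in> F\<^sup>*} \<and> successively (\<lambda>x y. (x,y) \<in> F) p"
    if "x \<in> V" "x \<noteq> u" for x
    using wc that
  proof (induction x rule: wf_induct_rule)
    case (less x)
    show ?case
    proof (cases "x = v")
      case True
      have "(v,z) \<in> F\<^sup>* \<longleftrightarrow> z = v" for z using d(7) by (metis converse_rtranclE rtrancl.rtrancl_refl)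
      then show ?thesis using True by (intro exI[of _ "[v]"]) auto
    next
      case False
      then have "\<exists>!y. (x,y) \<in> F" using d(9)[of x] less(2,3) by simp
      then obtain y where y: "(x,y) \<in> F" by blast
      then have "y \<in> V" "y \<noteq> u" using d(2,8) by auto
      then obtain p where p: "p \<noteq> []" "hd p = y" "last p = v" "distinct p" "set p = {z. (y,z) \<in> F\<^sup>*}"
        "successively (\<lambda>x y. (x,y) \<in> F) p" using less.IH[of y] y by auto
      have "x \<notin> set p" unfolding p(5) using y ac[of x] by (auto dest: rtrancl_into_trancl2)
      moreover have "(x,z) \<in> F\<^sup>* \<longleftrightarrow> z = x \<or> (y,z) \<in> F\<^sup>*" for z
        using y flow_unique_out[OF f less(3) y] by (metis converse_rtranclE converse_rtrancl_into_rtrancl rtrancl.rtrancl_refl)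
      ultimately show ?thesis using p y
        by (intro exI[of _ "x # p"]) (auto simp: successively_Cons)
    qed
  qed
  then obtain P where P: "\<And>x. x \<in> V \<Longrightarrow> x \<noteq> u \<Longrightarrow> P x \<noteq> [] \<and> hd (P x) = x \<and> last (P x) = v \<and> distinct (P x) \<and>
    set (P x) = {z. (x,z) \<in> F\<^sup>*} \<and> successively (\<lambda>x y. (x,y) \<in> F) (P x)" by metis
  define N0 where "N0 = F `` {u}"
  have N0: "x \<in> V" "x \<noteq> u" "(u,x) \<in> F" if "x \<in> N0" for x using that d(2,8) unfolding N0_def by auto
  have N0_ne: "N0 \<noteq> {}" using c unfolding N0_def by auto
  have nu: "(x,u) \<notin> F\<^sup>*" if "x \<noteq> u" for x using that d(8) by (meson rtranclE)
  \<comment> \<open>If two walks from out-neighbours of \<open>u\<close> share a vertex other than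
    \<open>v\<close>, they share its predecessor too; going back like this can only end in a common
    start.\<close>
  have same: "x = x'" if "x \<in> N0" "x' \<in> N0" "(x,z) \<in> F\<^sup>*" "(x',z) \<in> F\<^sup>*" "z \<noteq> v" for x x' z
    using that(3,4,5)
  proof (induction rule: rtrancl_induct)
    case base
    show ?case
    proof (rule ccontr)
      assume "x \<noteq> x'"
      then obtain y where "(x',y) \<in> F\<^sup>*" "(y,x) \<in> F" using base(1) by (metis rtranclE)
      then show False using flow_unique_in[OF f base(2), of u y] N0(3)[OF that(1)] nu[of x'] N0(2)[OF that(2)] by auto
    qed
  next
    case (step y z)
    then have yv: "y \<noteq> v" using d(7) by auto
    show ?case
    proof (cases "x' = z")
      case True
      then have "y = u" using flow_unique_in[OF f step(5), of u y] N0(3)[OF that(2)] step by auto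
      then show ?thesis using nu[of x] N0(2)[OF that(1)] step by auto
    next
      case False
      then obtain y' where y': "(x',y') \<in> F\<^sup>*" "(y',z) \<in> F" using step(4) by (metis rtranclE)
      then have "y' = y" using flow_unique_in[OF f step(5) y'(2) step(2)] by simp
      then show ?thesis using step.IH yv y'(1) by simp
    qed
  qed
  define C where "C = (\<lambda>x. u # P x) ` N0"
  have PN: "P x \<noteq> []" "hd (P x) = x" "last (P x) = v" "distinct (P x)" "set (P x) = {z. (x,z) \<in> F\<^sup>*}"
    "successively (\<lambda>x y. (x,y) \<in> F) (P x)" if "x \<in> N0" for x
    using P[OF N0(1,2)[OF that]] by simp_all
  have inj: "inj_on (\<lambda>x. u # P x) N0"
  proof (rule inj_onI)
    fix x y assume xy: "x \<in> N0" "y \<in> N0" "u # P x = u # P y"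
    then have "hd (P x) = hd (P y)" by simp
    then show "x = y" using PN(2)[OF xy(1)] PN(2)[OF xy(2)] by simp
  qed
  have fO: "finite N0" unfolding N0_def using fF by (simp add: finite_Image)
  have sP: "set (u # P x) = insert u {z. (x,z) \<in> F\<^sup>*}" if "x \<in> N0" for x
    using PN(5)[OF that] by simp
  have vP: "(x,v) \<in> F\<^sup>*" if "x \<in> N0" for x
    using PN(1,3,5)[OF that] last_in_set[of "P x"] by simp
  have FV: "(x,z) \<in> F\<^sup>* \<Longrightarrow> x \<in> V \<Longrightarrow> z \<in> V" for x z using d(2) by (metis SigmaD2 rtranclE subsetD)
  have "is_path V E u v (u # P x)" if "x \<in> N0" for x
  proof -
    note Px = PN[OF that]
    have "successively (\<lambda>x y. (x,y) \<in> F) (u # P x)" using Px N0(3)[OF that] by (simp add: successively_Cons)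
    then have "E ((u # P x) ! i) ((u # P x) ! Suc i)" if "Suc i < length (u # P x)" for i
      using successively_nth[of "\<lambda>x y. (x,y) \<in> F" "u # P x" i] that E by auto
    moreover have "u \<notin> set (P x)" using Px nu N0[OF that] by auto
    moreover have "set (P x) \<subseteq> V" using Px FV N0[OF that] by auto
    ultimately show ?thesis unfolding is_path_def using Px d(4) by auto
  qed
  moreover have "set A \<inter> set B = {u,v}" if "A \<in> C" "B \<in> C" "A \<noteq> B" for A B
  proof -
    obtain x y where xy: "A = u # P x" "B = u # P y" "x \<in> N0" "y \<in> N0" "x \<noteq> y" using \<open>A \<in> C\<close> \<open>B \<in> C\<close> \<open>A \<noteq> B\<close> unfolding C_def by auto
    show ?thesis using sP[OF xy(3)] sP[OF xy(4)] vP[OF xy(3)] vP[OF xy(4)] same[OF xy(3,4)] xy(1,2,5)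
      by auto
  qed
  moreover have "(\<Union>Q\<in>C. set Q) = V"
  proof
    show "(\<Union>Q\<in>C. set Q) \<subseteq> V" using sP FV N0 d(4) unfolding C_def by auto
    show "V \<subseteq> (\<Union>Q\<in>C. set Q)"
    proof
      fix z assume z: "z \<in> V"
      have "z = u \<or> z = v \<or> (\<exists>x\<in>N0. (x,z) \<in> F\<^sup>*)"
        using d(3) z
      proof (induction z rule: wf_induct_rule)
        case (less z)
        show ?case
        proof (cases "z = u \<or> z = v")
          case False
          then have "\<exists>!y. (y,z) \<in> F" using d(10)[of z] less(2) by simp
          then obtain y where y: "(y,z) \<in> F" by blast
          show ?thesis
          proof (cases "y = u")
            case True
            then show ?thesis using y unfolding N0_def by auto
          next
            case False
            then have "y \<noteq> v" "y \<in> V" using y d(2,7) by auto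
            then obtain x where "x \<in> N0" "(x,y) \<in> F\<^sup>*" using less.IH[OF y] False by auto
            then show ?thesis using y by (meson rtrancl.rtrancl_into_rtrancl)
          qed
        qed auto
      qed
      then show "z \<in> (\<Union>Q\<in>C. set Q)"
      proof (elim disjE)
        assume "\<exists>x\<in>N0. (x,z) \<in> F\<^sup>*"
        then show ?thesis using sP unfolding C_def by auto
      qed (use N0_ne sP vP in \<open>auto simp: C_def\<close>)
    qed
  qed
  moreover have "card C = l" using card_image[OF inj] c unfolding C_def N0_def by simp
  moreover have "finite C" using fO unfolding C_def by simp
  ultimately show ?thesis
    unfolding is_star_container_def is_container_def by (intro exI[of _ C]) (auto simp: C_def)
qed

section \<open>Arrangement graphs, copies and routing\<close>

definition arr :: "nat set \<Rightarrow> nat \<Rightarrow> nat list set" where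
  "arr S k = {u. length u = k \<and> distinct u \<and> set u \<subseteq> S}"

abbreviation real_arcs :: "(nat list \<times> nat list) set \<Rightarrow> bool" where
  "real_arcs F \<equiv> \<forall>(x, y)\<in>F. arr_adj x y"

definition sflow :: "nat set \<Rightarrow> nat \<Rightarrow> nat list \<Rightarrow> nat list \<Rightarrow> (nat list \<times> nat list) set \<Rightarrow> bool" where
  "sflow S k u v F \<longleftrightarrow> flow (arr S k) u v F \<and> real_arcs F"

definition spans :: "nat set \<Rightarrow> nat \<Rightarrow> bool" where
  "spans S k \<longleftrightarrow> (\<forall>u\<in>arr S k. \<forall>v\<in>arr S k. u \<noteq> v \<longrightarrow>
     (\<forall>l. 1 \<le> l \<and> l \<le> k * (card S - k) \<longrightarrow> (\<exists>F. sflow S k u v F \<and> card (F `` {u}) = l)))"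

text \<open>\<open>L = {u}\<close> is excluded because the edge from \<open>u\<close> to
  \<open>v\<close> would then be the only path. Adjacent pairs suffice, since containers are joined
  at a neighbour of \<open>a\<close>; and adjacent words of length at least two share a position, so
  the induction step for this statement can always start inside one copy.\<close>

definition spans_into :: "nat set \<Rightarrow> nat \<Rightarrow> bool" where
  "spans_into S k \<longleftrightarrow> (\<forall>u\<in>arr S k. \<forall>v\<in>arr S k. arr_adj u v \<longrightarrow>
     (\<forall>L. L \<subseteq> {x \<in> arr S k. arr_adj x v} \<and> L \<noteq> {} \<and> L \<noteq> {u} \<longrightarrow>
        (\<exists>F. sflow S k u v F \<and> F\<inverse> `` {v} = L)))"

section \<open>Adjacency and counting of arrangements\<close>

lemma adj_sym: "arr_adj x y \<longleftrightarrow> arr_adj y x"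
proof -
  have "length x = length y \<Longrightarrow> {i. i < length x \<and> x ! i \<noteq> y ! i} = {i. i < length y \<and> y ! i \<noteq> x ! i}"
    by (rule Collect_cong) (simp add: eq_commute)
  then show ?thesis unfolding arr_adj_def by (cases "length x = length y") simp_all
qed

lemma adj_irrefl: "\<not> arr_adj x x"
  unfolding arr_adj_def by simp

lemma adj_update: "arr_adj x y \<longleftrightarrow> (\<exists>q<length x. \<exists>t. t \<noteq> x ! q \<and> y = x[q := t])"
proof
  assume a: "arr_adj x y"
  then obtain q where q: "{i. i < length x \<and> x ! i \<noteq> y ! i} = {q}"
    unfolding arr_adj_def by (auto simp: card_1_singleton_iff)
  have "y = x[q := y ! q]"
  proof (rule nth_equalityI)
    show "length y = length (x[q := y ! q])" using a unfolding arr_adj_def by simp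
    fix i assume "i < length y"
    then have i: "i < length x" using a unfolding arr_adj_def by simp
    show "y ! i = x[q := y ! q] ! i"
    proof (cases "i = q")
      case False
      then have "i \<notin> {i. i < length x \<and> x ! i \<noteq> y ! i}" unfolding q by simp
      then show ?thesis using i False by simp
    qed (use i in simp)
  qed
  moreover have "q \<in> {i. i < length x \<and> x ! i \<noteq> y ! i}" unfolding q by simp
  then have "q < length x" "y ! q \<noteq> x ! q" by simp_all
  ultimately show "\<exists>q<length x. \<exists>t. t \<noteq> x ! q \<and> y = x[q := t]" by blast
next
  assume "\<exists>q<length x. \<exists>t. t \<noteq> x ! q \<and> y = x[q := t]"
  then obtain q t where q: "q < length x" "t \<noteq> x ! q" "y = x[q := t]" by blast
  then have "{i. i < length x \<and> x ! i \<noteq> y ! i} = {q}" by (auto simp: nth_list_update)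
  then show "arr_adj x y" unfolding arr_adj_def using q by simp
qed

lemma adj_Cons_same [simp]: "arr_adj (t # x) (t # y) \<longleftrightarrow> arr_adj x y"
proof -
  have "{i. i < length (t # x) \<and> (t # x) ! i \<noteq> (t # y) ! i} = Suc ` {i. i < length x \<and> x ! i \<noteq> y ! i}"
    by (auto simp: image_iff nth_Cons' gr0_conv_Suc)
  then show ?thesis unfolding arr_adj_def by (simp add: card_image)
qed

lemma adj_Cons_diff [simp]: "s \<noteq> t \<Longrightarrow> arr_adj (s # x) (t # y) \<longleftrightarrow> x = y"
proof -
  assume st: "s \<noteq> t"
  have "{i. i < length (s # x) \<and> (s # x) ! i \<noteq> (t # y) ! i} = insert 0 (Suc ` {i. i < length x \<and> x ! i \<noteq> y ! i})"
  proof (rule set_eqI)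
    show "i \<in> {i. i < length (s # x) \<and> (s # x) ! i \<noteq> (t # y) ! i} \<longleftrightarrow>
      i \<in> insert 0 (Suc ` {i. i < length x \<and> x ! i \<noteq> y ! i})" for i
      using st by (cases i) auto
  qed
  moreover have "finite {i. i < length x \<and> x ! i \<noteq> y ! i}" by simp
  ultimately have "arr_adj (s # x) (t # y) \<longleftrightarrow> length x = length y \<and> {i. i < length x \<and> x ! i \<noteq> y ! i} = {}"
    unfolding arr_adj_def by (auto simp: card_image)
  also have "\<dots> \<longleftrightarrow> x = y" by (auto intro: nth_equalityI)
  finally show ?thesis .
qed

lemma finite_arr: "finite S \<Longrightarrow> finite (arr S k)"
  unfolding arr_def by (rule finite_subset[OF _ finite_lists_length_eq[of S k]]) auto

lemma arr_mono: "S \<subseteq> S' \<Longrightarrow> x \<in> arr S k \<Longrightarrow> x \<in> arr S' k"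
  unfolding arr_def by auto

lemma arr_update:
  "c \<in> arr S k \<Longrightarrow> q < k \<Longrightarrow> t \<in> S' \<Longrightarrow> t \<notin> set c - {c ! q} \<Longrightarrow> set c - {c ! q} \<subseteq> S' \<Longrightarrow> c[q := t] \<in> arr S' k"
  unfolding arr_def by (auto simp: set_update_distinct distinct_list_update)

lemma adj_arr:
  assumes "c \<in> arr S k" "d \<in> arr S' k" "arr_adj c d"
  obtains q t where "q < k" "t \<notin> set c" "t \<in> S'" "d = c[q := t]" "c = d[q := c ! q]"
proof -
  obtain q t where q: "q < length c" "t \<noteq> c ! q" "d = c[q := t]" using assms(3) adj_update by blast
  have c: "length c = k" "distinct c" and d: "distinct d" "set d \<subseteq> S'" using assms unfolding arr_def by auto
  have "t \<in> S'" using d q set_update_distinct[OF c(2) q(1)] by auto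
  moreover have "t \<notin> set c"
  proof
    assume "t \<in> set c"
    then obtain r where r: "r < length c" "c ! r = t" by (auto simp: in_set_conv_nth)
    then have "r \<noteq> q" using q by auto
    then have "d ! r = d ! q" using r q by simp
    moreover have "r < length d" "q < length d" using r q by auto
    ultimately show False using nth_eq_iff_index_eq[OF d(1)] \<open>r \<noteq> q\<close> by blast
  qed
  ultimately show ?thesis using that q c by auto
qed

lemma adj_updateI: "c \<in> arr S k \<Longrightarrow> q < k \<Longrightarrow> t \<noteq> c ! q \<Longrightarrow> arr_adj c (c[q := t])"
  unfolding adj_update arr_def by auto

lemma card_nbrs:
  assumes "finite S" "c \<in> arr S k"
  shows "card {d \<in> arr S k. arr_adj c d} = k * (card S - k)"
proof -
  have c: "length c = k" "distinct c" "set c \<subseteq> S" using assms(2) unfolding arr_def by auto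
  have "{d \<in> arr S k. arr_adj c d} = (\<lambda>(q,t). c[q := t]) ` ({..<k} \<times> (S - set c))"
  proof (intro equalityI subsetI)
    fix d assume "d \<in> {d \<in> arr S k. arr_adj c d}"
    then obtain q t where "q < k" "t \<notin> set c" "t \<in> S" "d = c[q := t]"
      using adj_arr[OF assms(2), of d S] by (metis (no_types, lifting) mem_Collect_eq)
    then show "d \<in> (\<lambda>(q,t). c[q := t]) ` ({..<k} \<times> (S - set c))" by auto
  next
    fix d assume "d \<in> (\<lambda>(q,t). c[q := t]) ` ({..<k} \<times> (S - set c))"
    then obtain q t where "q < k" "t \<in> S" "t \<notin> set c" "d = c[q := t]" by auto
    moreover have "t \<noteq> c ! q" using \<open>t \<notin> set c\<close> \<open>q < k\<close> c(1) by auto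
    ultimately show "d \<in> {d \<in> arr S k. arr_adj c d}"
      using arr_update[OF assms(2), of q t S] adj_updateI[OF assms(2), of q t] c by auto
  qed
  moreover have "inj_on (\<lambda>(q,t). c[q := t]) ({..<k} \<times> (S - set c))"
  proof (rule inj_onI, clarsimp)
    fix q t r s assume *: "q < k" "r < k" "t \<in> S" "t \<notin> set c" "s \<in> S" "s \<notin> set c" "c[q := t] = c[r := s]"
    have "c[q := t] ! q = t" using c *(1) by simp
    moreover have "q \<noteq> r \<Longrightarrow> c[r := s] ! q \<in> set c" using c *(1) by simp
    ultimately have "q = r" using * by metis
    then show "q = r \<and> t = s" using * c by (metis nth_list_update_eq)
  qed
  moreover have "card (S - set c) = card S - k"
    using c assms(1) by (simp add: card_Diff_subset distinct_card)
  ultimately show ?thesis by (simp add: card_image card_cartesian_product)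
qed

text \<open>The number of arrangements is a falling factorial of \<open>card S\<close>. Its first
  factor for \<open>k = 1\<close>, and its first two factors for \<open>k \<ge> 2\<close>, are
  bounds large enough for the small sets \<open>X\<close> that occur.\<close>

lemma arr_avoid:
  assumes "finite S" "k \<ge> 1" "k \<le> card S" "finite X" "card X < card S" "k \<ge> 2 \<longrightarrow> card X < card S * (card S - 1)"
  shows "\<exists>e\<in>arr S k. e \<notin> X"
proof -
  have c: "card (arr S k) = \<Prod>{card S - k + 1 .. card S}"
    unfolding arr_def by (rule card_lists_distinct_length_eq) (use assms in auto)
  have "card X < card (arr S k)"
  proof (cases "k \<ge> 2")
    case False
    then have "k = 1" using assms by simp
    then have "{card S - k + 1 .. card S} = {card S}" using assms(3) by auto
    then show ?thesis using c assms(5) by simp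
  next
    case True
    let ?n = "card S"
    have "{?n - 1, ?n} \<subseteq> {?n - k + 1 .. ?n}" using True assms(3) by auto
    then have "\<Prod>{?n - 1, ?n} dvd \<Prod>{?n - k + 1 .. ?n}" by (intro prod_dvd_prod_subset) auto
    moreover have "\<Prod>{?n - k + 1 .. ?n} > 0" by (intro prod_pos) auto
    moreover have "\<Prod>{?n - 1, ?n} = (?n - 1) * ?n" using True assms(3) by (subst prod.insert) auto
    ultimately have "(?n - 1) * ?n \<le> card (arr S k)" using c by (metis dvd_imp_le)
    then show ?thesis using assms(6) True by (simp add: mult.commute)
  qed
  then have "\<not> arr S k \<subseteq> X" using card_mono[OF assms(4)] by (metis leD)
  then show ?thesis by blast
qed

section \<open>Splitting into copies by the first symbol\<close>

text \<open>\<open>k\<close> is the length of the words in the copies, \<open>Suc k\<close> that of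
  the words under construction. \<open>room\<close> leaves out \<open>k = 1\<close>,
  \<open>m = 2\<close>: there two copies have only two words in common, too few for a crossing point
  when two words may be forbidden.\<close>

locale arr_step =
  fixes S :: "nat set" and k m :: nat
  assumes fin: "finite S" and card_S: "card S = Suc k + m" and k1: "k \<ge> 1" and m2: "m \<ge> 2"
    and room: "k \<ge> 2 \<or> m \<ge> 3"
    and IH_spans: "\<And>t. t \<in> S \<Longrightarrow> spans (S - {t}) k"
    and IH_into: "\<And>t. t \<in> S \<Longrightarrow> spans_into (S - {t}) k"
begin

definition cp :: "nat \<Rightarrow> nat list set" where
  "cp t = (#) t ` arr (S - {t}) k"

definition reg :: "nat set \<Rightarrow> nat list set" where
  "reg K = (\<Union>t\<in>K. cp t)"

lemma Cons_cp [simp]: "s # x \<in> cp t \<longleftrightarrow> s = t \<and> x \<in> arr (S - {t}) k"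
  unfolding cp_def by auto

lemma Cons_reg [simp]: "s # x \<in> reg K \<longleftrightarrow> s \<in> K \<and> x \<in> arr (S - {s}) k"
  unfolding reg_def by auto

lemma reg_cases: "y \<in> reg K \<Longrightarrow> (\<And>s x. y = s # x \<Longrightarrow> s \<in> K \<Longrightarrow> x \<in> arr (S - {s}) k \<Longrightarrow> P) \<Longrightarrow> P"
  unfolding reg_def cp_def by auto

lemma hd_reg: "y \<in> reg K \<Longrightarrow> hd y \<in> K"
  by (auto elim!: reg_cases)

lemma reg_hd_Cons: "y \<in> reg K \<Longrightarrow> hd y = t \<Longrightarrow> \<exists>x\<in>arr (S - {t}) k. y = t # x"
  by (auto elim!: reg_cases)

lemma reg_hd_in: "y \<in> reg K \<Longrightarrow> hd y \<in> K' \<Longrightarrow> y \<in> reg K'"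
  by (auto elim!: reg_cases)

lemma reg_S: "reg S = arr S (Suc k)"
proof (intro equalityI subsetI)
  fix x assume "x \<in> arr S (Suc k)"
  then show "x \<in> reg S" unfolding arr_def reg_def cp_def by (cases x) auto
qed (auto simp: arr_def reg_def cp_def)

lemma reg_Un: "reg (A \<union> B) = reg A \<union> reg B" unfolding reg_def by auto

lemma reg_single: "reg {t} = cp t" unfolding reg_def by auto

lemma reg_disj: "A \<inter> B = {} \<Longrightarrow> reg A \<inter> reg B = {}" unfolding reg_def cp_def by auto

lemma finite_cp: "finite (cp t)" unfolding cp_def using fin by (auto intro: finite_arr)

lemma finite_reg: "finite K \<Longrightarrow> finite (reg K)" unfolding reg_def using finite_cp by auto

lemma card_del: "t \<in> S \<Longrightarrow> card (S - {t}) = k + m"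
  using card_S fin by simp

lemma card_cp_nbrs:
  assumes "t \<in> S" "c \<in> arr (S - {t}) k"
  shows "card {d \<in> arr (S - {t}) k. arr_adj c d} = k * m"
  using card_nbrs[OF _ assms(2)] fin card_del[OF assms(1)] by simp

lemma cp_flow:
  assumes "sflow (S - {t}) k a b F"
  shows "flow (cp t) (t # a) (t # b) (map_prod ((#) t) ((#) t) ` F)"
    "(map_prod ((#) t) ((#) t) ` F) `` {t # a} = (#) t ` (F `` {a})"
    "(map_prod ((#) t) ((#) t) ` F)\<inverse> `` {t # b} = (#) t ` (F\<inverse> `` {b})"
    "real_arcs (map_prod ((#) t) ((#) t) ` F)"
proof -
  have "real_arcs F" using assms unfolding sflow_def by simp
  then show "real_arcs (map_prod ((#) t) ((#) t) ` F)" by fastforce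
qed (use flow_image[of "arr (S - {t}) k" a b F "(#) t"] assms in \<open>auto simp: sflow_def cp_def\<close>)

lemma ham_copy:
  assumes "t \<in> S" "a \<in> arr (S - {t}) k" "b \<in> arr (S - {t}) k" "a \<noteq> b"
  shows "\<exists>H. pflow (cp t) {} {} {t # a} {t # b} H \<and> real_arcs H"
proof -
  have "1 \<le> k * (card (S - {t}) - k)" using card_del[OF assms(1)] k1 m2 by simp
  then obtain F where F: "sflow (S - {t}) k a b F" "card (F `` {a}) = 1"
    using IH_spans[OF assms(1)] assms(2-4) unfolding spans_def by blast
  have "card ((map_prod ((#) t) ((#) t) ` F) `` {t # a}) = 1"
    using cp_flow(2)[OF F(1)] F(2) by (simp add: card_image)
  then show ?thesis using flow_one_pflow[OF cp_flow(1)[OF F(1)]] cp_flow(4)[OF F(1)] by blast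
qed

lemma inj_on_hd_unique: "inj_on hd A \<Longrightarrow> s # x \<in> A \<Longrightarrow> s # y \<in> A \<Longrightarrow> x = y"
  by (metis inj_onD list.inject list.sel(1))

text \<open>
  Which source is joined to which sink is left open. If the copies of sources and of sinks
  coincide, each copy is covered by one Hamiltonian path; otherwise a copy with a source but no sink is
  traversed and its path enters a copy without source, which becomes a new source.
\<close>

lemma routing:
  assumes "K \<subseteq> S" "Src \<subseteq> reg K" "Snk \<subseteq> reg K" "inj_on hd Src" "inj_on hd Snk" "Src \<inter> Snk = {}"
    "card Src = card Snk" "hd ` Src \<noteq> hd ` Snk \<or> hd ` Src = K"
  shows "\<exists>R. pflow (reg K) {} {} Src Snk R \<and> real_arcs R"
  using assms
proof (induction "card K" arbitrary: K Src Snk)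
  case 0
  have "finite K" using 0(2) fin by (rule finite_subset)
  then have "K = {}" using 0(1) by simp
  then show ?case using 0 pflow_empty unfolding reg_def by (intro exI[of _ "{}"]) auto
next
  case (Suc n)
  have fK: "finite K" using Suc.prems(1) fin by (rule finite_subset)
  have fS: "finite Src" "finite Snk"
    using Suc.prems(2,3) finite_reg[OF fK] by (auto intro: finite_subset)
  have hdK: "hd ` Src \<subseteq> K" "hd ` Snk \<subseteq> K" using Suc.prems(2,3) hd_reg by blast+
  show ?case
  proof (cases "hd ` Src = hd ` Snk")
    case True
    obtain t where t: "t \<in> K" using Suc.hyps by fastforce
    then obtain x y where xy: "x \<in> Src" "hd x = t" "y \<in> Snk" "hd y = t"
      using True Suc.prems(8) by (metis imageE)
    obtain xs ys where xs: "x = t # xs" "xs \<in> arr (S - {t}) k" and ys: "y = t # ys" "ys \<in> arr (S - {t}) k"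
      using xy Suc.prems(2,3) reg_hd_Cons by (metis subsetD)
    have ne: "xs \<noteq> ys" using xy xs ys Suc.prems(6) by auto
    obtain H where H: "pflow (cp t) {} {} {x} {y} H" "real_arcs H"
      using ham_copy[OF _ xs(2) ys(2) ne] t Suc.prems(1) xs ys by auto
    define Src' where "Src' = Src - {x}"
    define Snk' where "Snk' = Snk - {y}"
    define K' where "K' = K - {t}"
    have KK: "K = {t} \<union> K'" using t unfolding K'_def by auto
    have h1: "hd ` Src' = K'"
      using True Suc.prems(8) xy inj_on_image_set_diff[OF Suc.prems(4), of Src "{x}"]
      unfolding Src'_def K'_def by simp
    have h2: "hd ` Snk' = K'"
      using True Suc.prems(8) xy inj_on_image_set_diff[OF Suc.prems(5), of Snk "{y}"]
      unfolding Snk'_def K'_def by simp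
    have in1: "Src' \<subseteq> reg K'"
    proof
      fix z assume z: "z \<in> Src'"
      then have "hd z \<in> K'" using h1 by auto
      moreover have "z \<in> reg K" using z Suc.prems(2) unfolding Src'_def by auto
      ultimately show "z \<in> reg K'" using reg_hd_in by blast
    qed
    have in2: "Snk' \<subseteq> reg K'"
    proof
      fix z assume z: "z \<in> Snk'"
      then have "hd z \<in> K'" using h2 by auto
      moreover have "z \<in> reg K" using z Suc.prems(3) unfolding Snk'_def by auto
      ultimately show "z \<in> reg K'" using reg_hd_in by blast
    qed
    have "\<exists>R. pflow (reg K') {} {} Src' Snk' R \<and> real_arcs R"
    proof (rule Suc.hyps(1))
      show "n = card K'" using Suc.hyps(2) t unfolding K'_def by simp
      show "K' \<subseteq> S" using Suc.prems(1) unfolding K'_def by auto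
      show "inj_on hd Src'" "inj_on hd Snk'"
        using Suc.prems(4,5) unfolding Src'_def Snk'_def by (auto intro: inj_on_subset)
      show "Src' \<inter> Snk' = {}" using Suc.prems(6) unfolding Src'_def Snk'_def by auto
      show "card Src' = card Snk'" using Suc.prems(7) xy fS unfolding Src'_def Snk'_def by simp
      show "hd ` Src' \<noteq> hd ` Snk' \<or> hd ` Src' = K'" using h1 by simp
    qed (use in1 in2 in auto)
    then obtain R where R: "pflow (reg K') {} {} Src' Snk' R" "real_arcs R" by blast
    have "pflow (cp t \<union> reg K') {} {} ({x} \<union> Src') ({y} \<union> Snk') (H \<union> R)"
      by (rule pflow_Un[OF H(1) R(1)])
        (use in1 in2 xs ys reg_disj[of "{t}" K'] in \<open>auto simp: reg_single K'_def\<close>)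
    moreover have "cp t \<union> reg K' = reg K" using KK reg_Un[of "{t}" K'] reg_single by simp
    moreover have "{x} \<union> Src' = Src" "{y} \<union> Snk' = Snk" using xy unfolding Src'_def Snk'_def by auto
    ultimately show ?thesis using H R by (intro exI[of _ "H \<union> R"]) auto
  next
    case False
    have ch: "card (hd ` Src) = card (hd ` Snk)" using Suc.prems by (simp add: card_image)
    have "\<not> hd ` Src \<subseteq> hd ` Snk" using False ch fS by (metis card_subset_eq finite_imageI)
    then obtain s where s: "s \<in> hd ` Src" "s \<notin> hd ` Snk" by auto
    have "\<not> hd ` Snk \<subseteq> hd ` Src" using False ch fS by (metis card_subset_eq finite_imageI)
    then obtain t0 where t0: "t0 \<in> hd ` Snk" "t0 \<notin> hd ` Src" by auto
    \<comment> \<open>The path moves on to a copy without source. One that also has no sink is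
      preferred, as the source copies and sink copies then differ in \<open>t\<close>. If there is
      none, every copy carries a source or a sink, and the new source copies can equal the sink
      copies only by filling \<open>K'\<close>.\<close>
    obtain t where t: "t \<in> K" "t \<notin> hd ` Src" "t \<in> hd ` Snk \<longrightarrow> K \<subseteq> hd ` Src \<union> hd ` Snk"
      using t0 hdK by (cases "K \<subseteq> hd ` Src \<union> hd ` Snk") auto
    obtain x where x: "x \<in> Src" "hd x = s" using s by auto
    obtain xs where xs: "x = s # xs" "xs \<in> arr (S - {s}) k" "s \<in> K"
      using x Suc.prems(2) by (auto elim!: reg_cases)
    have st: "s \<noteq> t" using t x by auto
    \<comment> \<open>The crossing word must differ from \<open>xs\<close>, since a Hamiltonian path
      of a copy needs distinct ends, and from the sink that copy \<open>t\<close> may contain, since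
      sources and sinks have to stay disjoint.\<close>
    define X where "X = {xs} \<union> {ys. t # ys \<in> Snk}"
    have sub: "\<exists>y. {ys. t # ys \<in> Snk} \<subseteq> {y}"
      using inj_on_hd_unique[OF Suc.prems(5)] by (metis (mono_tags, lifting) mem_Collect_eq singletonI subsetI)
    then obtain y where "X \<subseteq> {xs, y}" unfolding X_def by auto
    then have cX: "finite X" "card X \<le> 2"
      by (auto intro: finite_subset order.trans[OF card_mono[of "{xs, y}" X]] simp: card_insert_if)
    have cSt: "card (S - {s,t}) = k + m - 1"
      using card_S fin st xs t Suc.prems(1) by (subst card_Diff_subset) auto
    have "\<exists>e\<in>arr (S - {s,t}) k. e \<notin> X"
    proof (rule arr_avoid)
      show "2 \<le> k \<longrightarrow> card X < card (S - {s, t}) * (card (S - {s, t}) - 1)"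
      proof
        assume "2 \<le> k"
        then have "3 \<le> card (S - {s,t})" "2 \<le> card (S - {s,t}) - 1" using cSt m2 by auto
        then have "3 * 2 \<le> card (S - {s, t}) * (card (S - {s, t}) - 1)" by (rule mult_le_mono)
        then show "card X < card (S - {s, t}) * (card (S - {s, t}) - 1)" using cX by simp
      qed
    qed (use cX cSt fin k1 m2 room in auto)
    then obtain e where e: "e \<in> arr (S - {s,t}) k" "e \<noteq> xs" "t # e \<notin> Snk" unfolding X_def by auto
    have e': "e \<in> arr (S - {s}) k" "e \<in> arr (S - {t}) k" using e(1) by (auto intro: arr_mono[rotated])
    obtain H where H: "pflow (cp s) {} {} {x} {s # e} H" "real_arcs H"
      using ham_copy[OF _ xs(2) e'(1)] e(2) xs Suc.prems(1) by auto
    define K' where "K' = K - {s}"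
    define Src' where "Src' = insert (t # e) (Src - {x})"
    have KK: "K = {s} \<union> K'" using xs unfolding K'_def by auto
    have te: "t # e \<notin> Src" using t by force
    have hS: "hd ` (Src - {x}) = hd ` Src - {s}" using x inj_on_image_set_diff[OF Suc.prems(4), of Src "{x}"] by simp
    have h1: "hd ` Src' = insert t (hd ` Src - {s})" unfolding Src'_def using hS by auto
    have in1: "Src' \<subseteq> reg K'"
    proof
      fix z assume z: "z \<in> Src'"
      then have "hd z \<in> insert t (hd ` Src - {s})" unfolding h1[symmetric] by (rule imageI)
      then have "hd z \<in> K'" using hdK t(1) st unfolding K'_def by auto
      moreover have "z \<in> reg K" using z Suc.prems(2) t e' unfolding Src'_def by auto
      ultimately show "z \<in> reg K'" using reg_hd_in by blast
    qed
    have in2: "Snk \<subseteq> reg K'"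
    proof
      fix z assume z: "z \<in> Snk"
      then have "hd z \<in> hd ` Snk" by (rule imageI)
      then have "hd z \<in> K'" using hdK(2) s(2) unfolding K'_def by auto
      moreover have "z \<in> reg K" using z Suc.prems(3) by auto
      ultimately show "z \<in> reg K'" using reg_hd_in by blast
    qed
    have "\<exists>R. pflow (reg K') {} {} Src' Snk R \<and> real_arcs R"
    proof (rule Suc.hyps(1))
      show "n = card K'" using Suc.hyps(2) xs unfolding K'_def by simp
      show "K' \<subseteq> S" using Suc.prems(1) unfolding K'_def by auto
      show "inj_on hd Src'" using Suc.prems(4) t unfolding Src'_def by (auto simp: inj_on_def)
      show "Src' \<inter> Snk = {}" using Suc.prems(6) e unfolding Src'_def by auto
      show "card Src' = card Snk" using Suc.prems(7) te x fS unfolding Src'_def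
        by (metis Diff_iff card_Suc_Diff1 card_insert_disjoint finite_Diff)
      show "hd ` Src' \<noteq> hd ` Snk \<or> hd ` Src' = K'"
      proof (cases "t \<in> hd ` Snk")
        case False
        then show ?thesis using h1 by auto
      next
        case True
        then have "K \<subseteq> hd ` Src \<union> hd ` Snk" using t by auto
        moreover have "insert t (A - {s}) = B \<Longrightarrow> insert t (A - {s}) = K - {s}"
          if "K \<subseteq> A \<union> B" "A \<subseteq> K" "B \<subseteq> K" "s \<notin> B" for A B using that t(1) st by blast
        ultimately show ?thesis using h1 hdK s(2) unfolding K'_def by metis
      qed
    qed (use Suc.prems in1 in2 in auto)
    then obtain R where R: "pflow (reg K') {} {} Src' Snk R" "real_arcs R" by blast
    have "pflow (cp s \<union> reg K') {} {} ({x} \<union> (Src' - {t # e})) Snk (insert (s # e, t # e) (H \<union> R))"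
      by (rule pflow_glue[OF H(1) R(1)])
        (use in1 in2 xs e' reg_disj[of "{s}" K'] in \<open>auto simp: reg_single K'_def Src'_def\<close>)
    moreover have "cp s \<union> reg K' = reg K" using KK reg_Un[of "{s}" K'] reg_single by simp
    moreover have "{x} \<union> (Src' - {t # e}) = Src" using x te unfolding Src'_def by auto
    ultimately show ?thesis using H R st by (intro exI[of _ "insert (s # e, t # e) (H \<union> R)"]) auto
  qed
qed

text \<open>The copies not yet covered are visited by a detour on the arc from \<open>i # z\<close>
  to \<open>i # x\<close>. As \<open>z\<close> has at most one symbol that \<open>x\<close> lacks,
  one of \<open>p\<close>, \<open>q\<close> avoids \<open>z\<close>, and the other avoids
  \<open>x\<close>. So the detour enters and leaves the missing copies through two different ones,
  as the routing requires.\<close>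

lemma absorb_copies:
  assumes f: "flow (reg A) u v F" and r: "real_arcs F" and A: "A \<subseteq> S"
    and pq: "p \<in> S - A" "q \<in> S - A" "p \<noteq> q" and zx: "(i # z, i # x) \<in> F" "p \<notin> set x" "q \<notin> set x"
  shows "\<exists>F'. sflow S (Suc k) u v F' \<and> card (F' `` {u}) = card (F `` {u}) \<and>
    (i # x \<noteq> v \<longrightarrow> F'\<inverse> `` {v} = F\<inverse> `` {v})"
proof -
  note d = flowD[OF f]
  have i: "i \<in> A" "z \<in> arr (S - {i}) k" "x \<in> arr (S - {i}) k" using zx(1) d(2) by auto
  have "arr_adj z x" using r zx by auto
  then obtain a where a: "a < k" "z = x[a := z ! a]" using adj_arr[OF i(2,3)] by metis
  then have "set z \<subseteq> insert (z ! a) (set x)" by (metis set_update_subset_insert)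
  then have "p \<notin> set z \<or> q \<notin> set z" using zx pq(3) by auto
  then obtain t t' where t: "t \<in> S - A" "t' \<in> S - A" "t \<noteq> t'" "t \<notin> set z" "t' \<notin> set x"
    using pq zx by metis
  have zt: "z \<in> arr (S - {t}) k" "x \<in> arr (S - {t'}) k" using i t unfolding arr_def by auto
  obtain R where R: "pflow (reg (S - A)) {} {} {t # z} {t' # x} R" "real_arcs R"
    using routing[of "S - A" "{t # z}" "{t' # x}"] t zt by auto
  have ti: "t \<noteq> i" "t' \<noteq> i" using t i by auto
  note ins = flow_insert[OF f zx(1) R(1)]
  have dis: "reg A \<inter> reg (S - A) = {}" by (rule reg_disj) auto
  have mem: "t # z \<in> reg (S - A)" "t' # x \<in> reg (S - A)" using t zt by auto
  have un: "reg A \<union> reg (S - A) = arr S (Suc k)" using reg_Un[of A "S - A"] A reg_S by (simp add: Un_absorb1)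
  show ?thesis
    using ins[OF dis mem] r R(2) ti unfolding un sflow_def
    by (intro exI[of _ "F - {(i # z, i # x)} \<union> R \<union> {(i # z, t # z), (t' # x, i # x)}"]) auto
qed

end

section \<open>Joining two copies\<close>

text \<open>The paths are opened at their end \<open>w\<close>: every arc into \<open>w\<close>
  goes, except the one from \<open>x0\<close>, which keeps \<open>w\<close> as the end of a path. If
  \<open>u\<close> is itself an opened predecessor, it keeps its freedom to have several
  successors.\<close>

lemma flow_cut_in:
  assumes "flow V u w P" "x0 \<in> P\<inverse> `` {w}"
  shows "pflow V {u} {} {} (insert w (P\<inverse> `` {w} - {x0})) (P - (- {x0}) \<times> {w})"
proof -
  note d = flowD[OF assms(1)]
  let ?F = "P - (- {x0}) \<times> {w}"
  show ?thesis
  proof (rule pflowI)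
    show "wf ?F" using d(3) by (rule wf_subset) auto
    show "(x, y) \<notin> ?F" if "x \<in> insert w (P\<inverse> `` {w} - {x0})" "x \<notin> {u}" for x y
    proof (cases "x = w")
      case False
      then have "(x, w) \<in> P" "x \<noteq> x0" using that(1) by auto
      then show ?thesis using flow_unique_out[OF assms(1), of x w y] that(2) by auto
    qed (use d(7) in auto)
    show "\<exists>!y. (x, y) \<in> ?F" if x: "x \<in> V" "x \<notin> {u}" "x \<notin> insert w (P\<inverse> `` {w} - {x0})" for x
    proof -
      have "(x, y) \<in> ?F \<longleftrightarrow> (x, y) \<in> P" for y using x(3) by auto
      then show ?thesis using d(9)[of x] x by simp
    qed
    show "\<exists>!y. (y, x) \<in> ?F" if x: "x \<in> V" "x \<notin> {u}" for x
    proof (cases "x = w")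
      case True
      have "(y, x) \<in> ?F \<longleftrightarrow> y = x0" for y using assms(2) True by auto
      then show ?thesis by simp
    next
      case False
      then have "(y, x) \<in> ?F \<longleftrightarrow> (y, x) \<in> P" for y by auto
      then show ?thesis using d(10)[of x] x False by simp
    qed
  qed (use d in auto)
qed

text \<open>The dual operation at the start: of the arcs leaving \<open>w\<close> only the one to
  \<open>y0\<close> stays.\<close>

lemma flow_cut_out:
  assumes "flow V w v Q" "y0 \<in> Q `` {w}"
  shows "pflow V {} {v} (insert w (Q `` {w} - {y0})) {} (Q - {w} \<times> (- {y0}))"
proof -
  note d = flowD[OF assms(1)]
  let ?F = "Q - {w} \<times> (- {y0})"
  show ?thesis
  proof (rule pflowI)
    show "wf ?F" using d(3) by (rule wf_subset) auto
    show "(y, x) \<notin> ?F" if "x \<in> insert w (Q `` {w} - {y0})" "x \<notin> {v}" for x y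
    proof (cases "x = w")
      case False
      then have "(w, x) \<in> Q" "x \<noteq> y0" using that(1) by auto
      then show ?thesis using flow_unique_in[OF assms(1), of x w y] that(2) by auto
    qed (use d(8) in auto)
    show "\<exists>!y. (y, x) \<in> ?F" if x: "x \<in> V" "x \<notin> {v}" "x \<notin> insert w (Q `` {w} - {y0})" for x
    proof -
      have "(y, x) \<in> ?F \<longleftrightarrow> (y, x) \<in> Q" for y using x(3) by auto
      then show ?thesis using d(10)[of x] x by simp
    qed
    show "\<exists>!y. (x, y) \<in> ?F" if x: "x \<in> V" "x \<notin> {v}" for x
    proof (cases "x = w")
      case True
      have "(x, y) \<in> ?F \<longleftrightarrow> y = y0" for y using assms(2) True by auto
      then show ?thesis by simp
    next
      case False
      then have "(x, y) \<in> ?F \<longleftrightarrow> (x, y) \<in> Q" for y by auto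
      then show ?thesis using d(9)[of x] x False by simp
    qed
  qed (use d in auto)
qed

text \<open>Here the end \<open>w\<close> itself is taken out, so that the single path stops at
  \<open>x\<close>; \<open>w\<close> can then be restored as the end of other paths.\<close>

lemma flow_remove_sink:
  assumes "flow V u w P" "P\<inverse> `` {w} = {x}"
  shows "pflow (V - {w}) {u} {} {} {x} (P - {(x, w)})"
proof -
  note d = flowD[OF assms(1)]
  have i: "(y, w) \<in> P \<longleftrightarrow> y = x" for y using assms(2) by auto
  show ?thesis
  proof (rule pflowI)
    show "wf (P - {(x, w)})" using d(3) by (rule wf_subset) auto
    show "P - {(x, w)} \<subseteq> (V - {w}) \<times> (V - {w})" using d(2,7) i by auto
    show "(y, z) \<notin> P - {(x, w)}" if "y \<in> {x}" "y \<notin> {u}" for y z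
      using flow_unique_out[OF assms(1), of x w z] i that by auto
    show "\<exists>!z. (y, z) \<in> P - {(x, w)}" if y: "y \<in> V - {w}" "y \<notin> {u}" "y \<notin> {x}" for y
    proof -
      have "(y, z) \<in> P - {(x, w)} \<longleftrightarrow> (y, z) \<in> P" for z using y by auto
      then show ?thesis using d(9)[of y] y by simp
    qed
    show "\<exists>!z. (z, y) \<in> P - {(x, w)}" if y: "y \<in> V - {w}" "y \<notin> {u}" for y
    proof -
      have "(z, y) \<in> P - {(x, w)} \<longleftrightarrow> (z, y) \<in> P" for z using y by auto
      then show ?thesis using d(10)[of y] y by simp
    qed
  qed (use d in auto)
qed

lemma pflow_sink_only: "pflow {v} {} {v} {} {} {}"
  by (rule pflowI) auto

section \<open>The automorphism exchanging the first position with another one\<close>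

definition swp :: "nat \<Rightarrow> 'a list \<Rightarrow> 'a list" where
  "swp p x = x[0 := x ! p, p := x ! 0]"

lemma length_swp [simp]: "length (swp p x) = length x"
  unfolding swp_def by simp

lemma nth_swp:
  assumes "p < length x" "i < length x"
  shows "swp p x ! i = x ! (if i = 0 then p else if i = p then 0 else i)"
proof -
  have "0 < length x" using assms by linarith
  then show ?thesis using assms unfolding swp_def by (simp add: nth_list_update del: length_greater_0_conv)
qed

lemma swp_swp: "p < length x \<Longrightarrow> swp p (swp p x) = x"
proof -
  assume p: "p < length x"
  then have "x \<noteq> []" by auto
  then show ?thesis using p by (intro nth_equalityI) (auto simp: nth_swp)
qed

lemma swp_arr: "x \<in> arr S k \<Longrightarrow> p < k \<Longrightarrow> swp p x \<in> arr S k"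
  unfolding arr_def swp_def by (cases k) auto

lemma adj_swp:
  assumes "p < length x" "length x = length y"
  shows "arr_adj (swp p x) (swp p y) \<longleftrightarrow> arr_adj x y"
proof -
  let ?f = "\<lambda>i. if i = 0 then p else if i = p then 0 else i"
  have ne: "x \<noteq> []" "y \<noteq> []" using assms by auto
  have "{i. i < length x \<and> swp p x ! i \<noteq> swp p y ! i} = ?f ` {i. i < length x \<and> x ! i \<noteq> y ! i}"
  proof (intro equalityI subsetI)
    fix i assume i: "i \<in> {i. i < length x \<and> swp p x ! i \<noteq> swp p y ! i}"
    then have "?f i \<in> {i. i < length x \<and> x ! i \<noteq> y ! i}" using assms ne by (auto simp: nth_swp split: if_splits)
    moreover have "i = ?f (?f i)" by simp
    ultimately show "i \<in> ?f ` {i. i < length x \<and> x ! i \<noteq> y ! i}" by (rule rev_image_eqI)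
  next
    fix i assume "i \<in> ?f ` {i. i < length x \<and> x ! i \<noteq> y ! i}"
    then show "i \<in> {i. i < length x \<and> swp p x ! i \<noteq> swp p y ! i}" using assms ne by (auto simp: nth_swp split: if_splits)
  qed
  moreover have "card (?f ` A) = card A" for A by (rule card_image) (auto simp: inj_on_def)
  ultimately have "card {i. i < length x \<and> swp p x ! i \<noteq> swp p y ! i} = card {i. i < length x \<and> x ! i \<noteq> y ! i}"
    by (simp only:)
  then show ?thesis unfolding arr_adj_def using assms(2) by simp
qed

text \<open>The exchange is an automorphism and its own inverse, so a container for the exchanged
  ends can be carried back along with its count at \<open>u\<close> and its end set at
  \<open>v\<close>. Thus any position may be treated as the first.\<close>

lemma sflow_swp:
  assumes "sflow S k (swp p u) (swp p v) F" "p < k" "u \<in> arr S k" "v \<in> arr S k"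
  shows "\<exists>F'. sflow S k u v F' \<and> card (F' `` {u}) = card (F `` {swp p u}) \<and>
    F'\<inverse> `` {v} = swp p ` (F\<inverse> `` {swp p v})"
proof -
  have F: "flow (arr S k) (swp p u) (swp p v) F" "real_arcs F" using assms(1) unfolding sflow_def by auto
  have len: "length x = k" if "x \<in> arr S k" for x using that unfolding arr_def by simp
  have inv: "swp p (swp p x) = x" if "x \<in> arr S k" for x using swp_swp len that assms(2) by metis
  have inj: "inj_on (swp p) (arr S k)" using inv by (metis inj_onI)
  have im: "swp p ` arr S k = arr S k"
  proof
    show "swp p ` arr S k \<subseteq> arr S k" using swp_arr assms(2) by auto
    show "arr S k \<subseteq> swp p ` arr S k" using inv swp_arr assms(2) by (metis imageI subsetI)
  qed
  let ?F = "map_prod (swp p) (swp p) ` F"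
  note fi = flow_image[OF F(1) inj, unfolded im inv[OF assms(3)] inv[OF assms(4)]]
  have "real_arcs ?F"
  proof clarsimp
    fix x y assume xy: "(x, y) \<in> F"
    then have "x \<in> arr S k" "y \<in> arr S k" using flowD(2)[OF F(1)] by auto
    then show "arr_adj (swp p x) (swp p y)" using xy F(2) adj_swp len assms(2) by auto
  qed
  moreover have "card (swp p ` (F `` {swp p u})) = card (F `` {swp p u})"
    by (rule card_image, rule inj_on_subset[OF inj]) (use flowD(2)[OF F(1)] in auto)
  ultimately show ?thesis using fi unfolding sflow_def by (intro exI[of _ ?F]) simp
qed

context arr_step
begin

text \<open>\<open>P\<close> is opened at its end and \<open>Q\<close> at its start, both at
  \<open>c\<close>. The arcs kept, from \<open>x0\<close> and to \<open>y0\<close>, lie with the arc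
  from \<open>i # c\<close> to \<open>j # c\<close> on one path; \<open>M\<close> links the other
  loose ends, directly or by way of the copies in \<open>K\<close>. Links out of \<open>K\<close>
  lead to copy \<open>j\<close> only, which rules out cycles. The arcs of \<open>P\<close> that do
  not enter \<open>c\<close> are recorded in the conclusion because detours and cuts are later made
  on them.\<close>

lemma join_copies:
  fixes P Q R M
  assumes ij: "i \<in> S" "j \<in> S" "i \<noteq> j"
    and P: "sflow (S - {i}) k a c P" "x0 \<in> P\<inverse> `` {c}"
    and Q: "sflow (S - {j}) k c b Q" "y0 \<in> Q `` {c}"
    and K: "K \<subseteq> S - {i, j}" and R: "pflow (reg K) {} {} Src Snk R" "real_arcs R" "Src \<subseteq> reg K" "Snk \<subseteq> reg K"
    and dom: "Domain M \<subseteq> insert (i # a) ((#) i ` (P\<inverse> `` {c} - {x0}) \<union> Snk)"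
    and ran: "Range M \<subseteq> insert (j # b) ((#) j ` (Q `` {c} - {y0}) \<union> Src)"
    and up: "\<And>x y. (x, y) \<in> M \<Longrightarrow> x \<in> Snk \<Longrightarrow> hd y = j"
    and out: "\<And>x. x \<in> P\<inverse> `` {c} \<Longrightarrow> x \<noteq> x0 \<Longrightarrow> x \<noteq> a \<Longrightarrow> \<exists>!y. (i # x, y) \<in> M"
      "\<And>x. x \<in> Snk \<Longrightarrow> \<exists>!y. (x, y) \<in> M"
    and inn: "\<And>y. y \<in> Q `` {c} \<Longrightarrow> y \<noteq> y0 \<Longrightarrow> y \<noteq> b \<Longrightarrow> \<exists>!x. (x, j # y) \<in> M"
      "\<And>y. y \<in> Src \<Longrightarrow> \<exists>!x. (x, y) \<in> M"
    and rm: "real_arcs M"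
  shows "\<exists>F. flow (reg ({i, j} \<union> K)) (i # a) (j # b) F \<and> real_arcs F \<and>
    F `` {i # a} = (#) i ` (P `` {a} - (if a = x0 then {} else {c})) \<union> M `` {i # a} \<and>
    (\<forall>x y. (x, y) \<in> P \<longrightarrow> y \<noteq> c \<longrightarrow> (i # x, i # y) \<in> F)"
proof -
  have fP: "flow (arr (S - {i}) k) a c P" "real_arcs P" and fQ: "flow (arr (S - {j}) k) c b Q" "real_arcs Q"
    using P(1) Q(1) unfolding sflow_def by auto
  note dP = flowD[OF fP(1)] and dQ = flowD[OF fQ(1)]
  define P' where "P' = P - (- {x0}) \<times> {c}"
  define Q' where "Q' = Q - {c} \<times> (- {y0})"
  define X where "X = P\<inverse> `` {c} - {x0}"
  define Y where "Y = Q `` {c} - {y0}"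
  have XV: "X \<subseteq> arr (S - {i}) k" "c \<notin> X" and YV: "Y \<subseteq> arr (S - {j}) k" "c \<notin> Y"
    using dP(2,7) dQ(2,8) unfolding X_def Y_def by auto
  have p1: "pflow (cp i) {i # a} {} {} (insert (i # c) ((#) i ` X)) (map_prod ((#) i) ((#) i) ` P')"
    using pflow_image[OF flow_cut_in[OF fP(1) P(2)], of "(#) i"] XV dP(4,5)
    unfolding P'_def X_def cp_def by simp
  have p3: "pflow (cp j) {} {j # b} (insert (j # c) ((#) j ` Y)) {} (map_prod ((#) j) ((#) j) ` Q')"
    using pflow_image[OF flow_cut_out[OF fQ(1) Q(2)], of "(#) j"] YV dQ(4,5)
    unfolding Q'_def Y_def cp_def by simp
  have cij: "i # c \<in> cp i" "j # c \<in> cp j" "i # a \<in> cp i" "j # b \<in> cp j" using dP dQ by auto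
  have ncp: "x \<in> reg K \<Longrightarrow> hd x \<noteq> i \<and> hd x \<noteq> j" for x using hd_reg[of x K] K by auto
  let ?M = "insert (i # c, j # c) M"
  have mc: "(i # c, y) \<notin> M" "(x, j # c) \<notin> M" for x y
  proof -
    have "i # c \<notin> Domain M" using dom XV(2) dP(6) R(4) ncp unfolding X_def by fastforce
    then show "(i # c, y) \<notin> M" by blast
    have "j # c \<notin> Range M" using ran YV(2) dQ(6) R(3) ncp unfolding Y_def by fastforce
    then show "(x, j # c) \<notin> M" by blast
  qed
  have hdcp: "x \<in> cp t \<Longrightarrow> hd x = t" for x t unfolding cp_def by auto
  have fl: "flow (cp i \<union> reg K \<union> cp j) (i # a) (j # b)
     (map_prod ((#) i) ((#) i) ` P' \<union> R \<union> map_prod ((#) j) ((#) j) ` Q' \<union> ?M)"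
  proof (rule flow_compose[OF p1 R(1) p3])
    show "cp i \<inter> reg K = {}" "cp i \<inter> cp j = {}" "reg K \<inter> cp j = {}"
      using reg_disj[of "{i}" K] reg_disj[of "{i}" "{j}"] reg_disj[of K "{j}"] ij K by (auto simp: reg_single)
    show "insert (i # c) ((#) i ` X) \<subseteq> cp i" using XV cij by auto
    show "insert (j # c) ((#) j ` Y) \<subseteq> cp j" using YV cij by auto
    show "Domain ?M \<subseteq> insert (i # a) (insert (i # c) ((#) i ` X) \<union> Snk)" using dom unfolding X_def by auto
    show "Range ?M \<subseteq> insert (j # b) (Src \<union> insert (j # c) ((#) j ` Y))" using ran unfolding Y_def by auto
    show "y \<in> cp j" if "(x, y) \<in> ?M" "x \<in> reg K" for x y
    proof -
      have hx: "hd x \<noteq> i" using ncp that(2) by auto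
      then have M: "(x, y) \<in> M" using that(1) by auto
      then have "x \<in> Snk" using dom hx by fastforce
      then have "hd y = j" using up M by auto
      moreover have "y \<in> insert (j # b) ((#) j ` Y \<union> Src)" using ran M unfolding Y_def by auto
      ultimately consider "y = j # b" | z where "y = j # z" "z \<in> Y" | "y \<in> Src" "hd y = j" by blast
      then show ?thesis using cij YV R(3) ncp by cases auto
    qed
    show "\<exists>!y. (x, y) \<in> ?M" if xx: "x \<in> insert (i # c) ((#) i ` X) \<union> Snk" "x \<noteq> i # a" for x
    proof (cases "x = i # c")
      case True
      then show ?thesis using mc by auto
    next
      case False
      consider z where "x = i # z" "z \<in> P\<inverse> `` {c}" "z \<noteq> x0" "z \<noteq> a" | "x \<in> Snk"
        using xx False unfolding X_def by blast
      then have "\<exists>!y. (x, y) \<in> M" using out by cases simp_all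
      then show ?thesis using False by simp
    qed
    show "\<exists>!x. (x, y) \<in> ?M" if yy: "y \<in> Src \<union> insert (j # c) ((#) j ` Y)" "y \<noteq> j # b" for y
    proof (cases "y = j # c")
      case True
      then show ?thesis using mc by auto
    next
      case False
      consider z where "y = j # z" "z \<in> Q `` {c}" "z \<noteq> y0" "z \<noteq> b" | "y \<in> Src"
        using yy False unfolding Y_def by blast
      then have "\<exists>!x. (x, y) \<in> M" using inn by cases simp_all
      then show ?thesis using False by simp
    qed
  qed (use R cij in auto)
  let ?F = "map_prod ((#) i) ((#) i) ` P' \<union> R \<union> map_prod ((#) j) ((#) j) ` Q' \<union> ?M"
  have un: "cp i \<union> reg K \<union> cp j = reg ({i, j} \<union> K)"
    unfolding reg_def by auto
  have "P' \<subseteq> P" "Q' \<subseteq> Q" unfolding P'_def Q'_def by auto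
  then have "real_arcs ?F" using fP(2) fQ(2) R(2) rm ij by fastforce
  moreover have "?F `` {i # a} = (#) i ` (P `` {a} - (if a = x0 then {} else {c})) \<union> M `` {i # a}"
  proof -
    have "(i # a, y) \<notin> R" for y using pflowD(2)[OF R(1)] ncp[of "i # a"] by auto
    moreover have "(i # a, y) \<in> map_prod ((#) i) ((#) i) ` P' \<longleftrightarrow> (\<exists>z. y = i # z \<and> (a, z) \<in> P')" for y by auto
    moreover have "(i # a, y) \<notin> map_prod ((#) j) ((#) j) ` Q'" for y using ij by auto
    moreover have "(a, z) \<in> P' \<longleftrightarrow> z \<in> P `` {a} - (if a = x0 then {} else {c})" for z unfolding P'_def by auto
    ultimately show ?thesis using dP(6) ij(3) by auto
  qed
  moreover have "(i # x, i # y) \<in> ?F" if "(x, y) \<in> P" "y \<noteq> c" for x y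
    using that unfolding P'_def by auto
  ultimately show ?thesis using fl unfolding un by (intro exI[of _ ?F]) blast
qed

section \<open>Containers between two vertices of one copy\<close>

lemma card_free:
  assumes "t \<in> S" "a \<in> arr (S - {t}) k"
  shows "card (S - {t} - set a) = m" "finite (S - {t} - set a)"
proof -
  have "card (set a) = k" "set a \<subseteq> S - {t}" using assms(2) unfolding arr_def by (auto simp: distinct_card)
  then show "card (S - {t} - set a) = m" using card_del[OF assms(1)] fin by (subst card_Diff_subset) auto
  show "finite (S - {t} - set a)" using fin by simp
qed

lemma fiber_reg: "(\<lambda>t. t # a) ` E \<subseteq> reg K \<longleftrightarrow> E \<subseteq> K \<and> (\<forall>t\<in>E. a \<in> arr (S - {t}) k)"
  by auto

lemma arr_other: "a \<in> arr (S - {i}) k \<Longrightarrow> t \<notin> set a \<Longrightarrow> a \<in> arr (S - {t}) k"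
  unfolding arr_def by auto

text \<open>\<open>T\<close> tells from which other copies \<open>i # b\<close> is entered; the
  matching exits of \<open>i # a\<close> need an equally large set \<open>E\<close> of copies.
  \<open>E\<close> has to avoid the symbols of \<open>a\<close> and \<open>T\<close> those of
  \<open>b\<close>; either side offers \<open>m\<close> symbols.\<close>

lemma same_copy:
  assumes i: "i \<in> S" and F: "sflow (S - {i}) k a b F" and T: "T \<subseteq> S - {i} - set b"
  shows "\<exists>F'. sflow S (Suc k) (i # a) (i # b) F' \<and> F'\<inverse> `` {i # b} = (#) i ` (F\<inverse> `` {b}) \<union> (\<lambda>t. t # b) ` T"
proof -
  have fF: "flow (arr (S - {i}) k) a b F" "real_arcs F" using F unfolding sflow_def by auto
  note d = flowD[OF fF(1)] and c = cp_flow[OF F]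
  let ?C = "map_prod ((#) i) ((#) i) ` F"
  have par: "\<exists>F'. flow (reg (insert i K)) (i # a) (i # b) F' \<and> real_arcs F' \<and> ?C \<subseteq> F' \<and>
      F'\<inverse> `` {i # b} = (#) i ` (F\<inverse> `` {b}) \<union> (\<lambda>t. t # b) ` T"
    if E: "E \<subseteq> S - {i} - set a" "card E = card T" and K: "K \<subseteq> S - {i}" "E \<subseteq> K" "T \<subseteq> K" "E \<noteq> T \<or> E = K" for E K
  proof -
    have in1: "(\<lambda>t. t # a) ` E \<subseteq> reg K" "(\<lambda>t. t # b) ` T \<subseteq> reg K"
      using E T K d(4,5) arr_other[of a i] arr_other[of b i] by (auto simp: fiber_reg)
    have "\<exists>R. pflow (reg K) {} {} ((\<lambda>t. t # a) ` E) ((\<lambda>t. t # b) ` T) R \<and> real_arcs R"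
    proof (rule routing)
      show "card ((\<lambda>t. t # a) ` E) = card ((\<lambda>t. t # b) ` T)"
        using E(2) by (subst (1 2) card_image) (auto simp: inj_on_def)
      show "hd ` (\<lambda>t. t # a) ` E \<noteq> hd ` (\<lambda>t. t # b) ` T \<or> hd ` (\<lambda>t. t # a) ` E = K"
        using K(4) by (simp add: image_image)
    qed (use K in1 d(6) in \<open>auto simp: inj_on_def\<close>)
    then obtain R where R: "pflow (reg K) {} {} ((\<lambda>t. t # a) ` E) ((\<lambda>t. t # b) ` T) R" "real_arcs R" by blast
    have dis: "cp i \<inter> reg K = {}" using reg_disj[of "{i}" K] K by (auto simp: reg_single)
    have un: "cp i \<union> reg K = reg (insert i K)" using reg_Un[of "{i}" K] by (auto simp: reg_single)
    note fp = flow_par[OF c(1) R(1) dis in1]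
    have ni: "t \<noteq> i" "i \<noteq> t" if "t \<in> E \<union> T" for t using E T that by auto
    show ?thesis
      using fp c(3,4) R(2) ni unfolding un
      by (intro exI[of _ "?C \<union> R \<union> {i # a} \<times> (\<lambda>t. t # a) ` E \<union> (\<lambda>t. t # b) ` T \<times> {i # b}"]) auto
  qed
  show ?thesis
  proof (cases "T \<subseteq> S - {i} - set a")
    \<comment> \<open>Some symbol of \<open>T\<close> occurs in \<open>a\<close>, so no admissible
      \<open>E\<close> equals \<open>T\<close>, and a single routing covers all other
      copies.\<close>
    case False
    have "card T \<le> card (S - {i} - set a)"
      using T card_free[OF i d(5)] card_free[OF i d(4)] by (metis card_mono)
    then obtain E where E: "E \<subseteq> S - {i} - set a" "card E = card T"
      by (meson obtain_subset_with_card_n)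
    then have "E \<noteq> T" using False by auto
    then obtain F' where F': "flow (reg (insert i (S - {i}))) (i # a) (i # b) F'" "real_arcs F'"
      "F'\<inverse> `` {i # b} = (#) i ` (F\<inverse> `` {b}) \<union> (\<lambda>t. t # b) ` T"
      using par[OF E, of "S - {i}"] E T by blast
    then show ?thesis unfolding sflow_def using reg_S i by (auto simp: insert_absorb)
  next
    \<comment> \<open>With \<open>E = T\<close> each copy in \<open>T\<close> is crossed by a path
      of its own, and the routing covers only these. The other copies are absorbed afterwards by a
      detour on an arc of the container in copy \<open>i\<close>.\<close>
    case True
    obtain F' where F': "flow (reg (insert i T)) (i # a) (i # b) F'" "real_arcs F'" "?C \<subseteq> F'"
      "F'\<inverse> `` {i # b} = (#) i ` (F\<inverse> `` {b}) \<union> (\<lambda>t. t # b) ` T"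
      using par[OF True refl, of T] T by blast
    have ab: "length a = k" "length b = k" "distinct a" "distinct b" "set a \<subseteq> S - {i}" "set b \<subseteq> S - {i}"
      using d(4,5) unfolding arr_def by auto
    \<comment> \<open>\<open>p\<close> from \<open>b\<close> and \<open>q\<close> from
      \<open>a\<close> lie outside \<open>T\<close>, so their copies are still uncovered. A word
      \<open>x\<close> avoiding both is neither \<open>a\<close> nor \<open>b\<close> and hence has
      a predecessor in \<open>F\<close>.\<close>
    obtain p where p: "p \<in> set b" using ab(2) k1 by (cases b) auto
    have "\<exists>q. q \<in> set a \<and> q \<noteq> p"
    proof (rule ccontr)
      assume "\<not> ?thesis"
      then have "set a \<subseteq> {p}" by auto
      then have "card (set a) \<le> 1" using card_mono[of "{p}" "set a"] by simp
      then have "k \<le> 1" using ab(1,3) by (simp add: distinct_card)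
      then have k: "k = 1" using k1 by simp
      then obtain x y where "a = [x]" "b = [y]" using ab(1,2) by (metis One_nat_def length_0_conv length_Suc_conv)
      then show False using \<open>set a \<subseteq> {p}\<close> p d(6) by simp
    qed
    then obtain q where q: "q \<in> set a" "q \<noteq> p" by auto
    have pS: "p \<in> S" "q \<in> S" "p \<noteq> i" "q \<noteq> i" using p q ab by auto
    have "card (S - {i, p, q}) = k + m - 2"
      using card_S fin i pS q by (subst card_Diff_subset) auto
    then have "\<exists>x\<in>arr (S - {i, p, q}) k. x \<notin> {}"
      by (intro arr_avoid) (use fin k1 m2 room in auto)
    then obtain x where x: "x \<in> arr (S - {i, p, q}) k" by auto
    have x': "x \<in> arr (S - {i}) k" "p \<notin> set x" "q \<notin> set x" using x unfolding arr_def by auto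
    then have xab: "x \<noteq> a" "x \<noteq> b" using p q by auto
    then obtain z where "(z, x) \<in> F" using d(10)[OF x'(1)] by blast
    then have "(i # z, i # x) \<in> F'" using F'(3) by auto
    then have "\<exists>F''. sflow S (Suc k) (i # a) (i # b) F'' \<and> card (F'' `` {i # a}) = card (F' `` {i # a}) \<and>
        (i # x \<noteq> i # b \<longrightarrow> F''\<inverse> `` {i # b} = F'\<inverse> `` {i # b})"
      by (intro absorb_copies[OF F'(1,2), of p q]) (use i T True p q pS x' in auto)
    then show ?thesis using F'(4) xab by auto
  qed
qed

text \<open>Treats the case where the prescribed set inside the copy is empty or \<open>{a}\<close>,
  which the induction hypothesis does not cover. A Hamiltonian path of the copy loses its last
  vertex \<open>b\<close>, so it ends in some \<open>x\<close> and must leave the copy there;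
  \<open>i # b\<close> is then entered from outside, and from \<open>i # a\<close> if
  \<open>d\<close> holds.\<close>

lemma same_copy_outer:
  assumes i: "i \<in> S" and a: "a \<in> arr (S - {i}) k" and b: "b \<in> arr (S - {i}) k" and adj: "arr_adj a b"
    and T: "T \<subseteq> S - {i} - set b" "T \<noteq> {}"
  shows "\<exists>F. sflow S (Suc k) (i # a) (i # b) F \<and> F\<inverse> `` {i # b} = (if d then {i # a} else {}) \<union> (\<lambda>t. t # b) ` T"
proof -
  have ab: "a \<noteq> b" using adj adj_irrefl by auto
  obtain P where P: "sflow (S - {i}) k a b P" "card (P `` {a}) = 1"
    using IH_spans[OF i] a b ab card_del[OF i] k1 m2 unfolding spans_def by fastforce
  have fP: "flow (arr (S - {i}) k) a b P" "real_arcs P" using P unfolding sflow_def by auto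
  note dP = flowD[OF fP(1)] and c = cp_flow[OF P(1)]
  have "card (P\<inverse> `` {b}) = 1" using P(2) flow_card_out_in[OF fP(1)] by simp
  then obtain x where x: "P\<inverse> `` {b} = {x}" by (rule card_1_singletonE)
  then have xb: "(x, b) \<in> P" by auto
  then have xV: "x \<in> arr (S - {i}) k" "arr_adj x b" using dP(2) fP(2) by auto
  obtain r where r: "r < k" "b ! r \<notin> set x" "b ! r \<in> S - {i}"
  proof (rule adj_arr[OF xV(1) b xV(2)])
    fix r t assume "r < k" "t \<notin> set x" "t \<in> S - {i}" "b = x[r := t]"
    moreover from this have "b ! r = t" using xV(1) unfolding arr_def by simp
    ultimately show thesis using that by simp
  qed
  \<comment> \<open>The symbol that \<open>b\<close> has and \<open>x\<close> lacks names the copy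
    to which the path moves on. As \<open>rho\<close> occurs in \<open>b\<close>, that copy carries
    a source but no sink, and the routing may cover all other copies.\<close>
  define rho where "rho = b ! r"
  have rho: "rho \<in> S - {i}" "rho \<notin> set x" "rho \<in> set b" "rho \<notin> T"
    using r T(1) b unfolding rho_def arr_def by auto
  obtain al where al: "set a - set b \<subseteq> {al}"
  proof -
    obtain q t where q: "a = b[q := t]" using adj_arr[OF b a] adj adj_sym by metis
    have "set a \<subseteq> insert t (set b)" unfolding q by (rule set_update_subset_insert)
    then show ?thesis using that[of t] by auto
  qed
  \<comment> \<open>\<open>a\<close> and \<open>b\<close> being adjacent, at most one symbol of
    \<open>T\<close> occurs in \<open>a\<close>; if there is one, it becomes \<open>t0\<close>. The
    copies in \<open>E\<close> can then be entered from \<open>i # a\<close>, and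
    \<open>rho # x\<close> makes up for the missing source.\<close>
  obtain t0 where t0: "t0 \<in> T" "T \<inter> set a \<subseteq> {t0}"
  proof (cases "T \<inter> set a = {}")
    case True
    then show ?thesis using that T(2) by blast
  next
    case False
    then have "al \<in> T" "T \<inter> set a \<subseteq> {al}" using T(1) al by blast+
    then show ?thesis using that by blast
  qed
  define E where "E = T - {t0}"
  have fT: "finite T" using T fin finite_subset by blast
  have E: "E \<subseteq> S - {i} - set a" "E \<subseteq> T" "card T = Suc (card E)"
  proof -
    show "card T = Suc (card E)" unfolding E_def using card.remove[OF fT t0(1)] .
  qed (use T(1) t0(2) in \<open>auto simp: E_def\<close>)
  define Src where "Src = insert (rho # x) ((\<lambda>t. t # a) ` E)"
  define Snk where "Snk = (\<lambda>t. t # b) ` T"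
  define K where "K = S - {i}"
  have in1: "Src \<subseteq> reg K" "Snk \<subseteq> reg K"
    using E T rho a b xV arr_other[of a i] arr_other[of b i] arr_other[of x i] unfolding Src_def Snk_def K_def by auto
  have "\<exists>R. pflow (reg K) {} {} Src Snk R \<and> real_arcs R"
  proof (rule routing)
    have "rho # x \<notin> (\<lambda>t. t # a) ` E" using rho E by auto
    then show "card Src = card Snk" using E(3) fT unfolding Src_def Snk_def E_def
      by (simp add: card_image inj_on_def)
    have "rho \<in> hd ` Src" "rho \<notin> hd ` Snk" using rho unfolding Src_def Snk_def by auto
    then show "hd ` Src \<noteq> hd ` Snk \<or> hd ` Src = K" by auto
    show "inj_on hd Src" "inj_on hd Snk" "Src \<inter> Snk = {}"
      using rho E(2) ab unfolding Src_def Snk_def by (auto simp: inj_on_def)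
  qed (use in1 in \<open>auto simp: K_def\<close>)
  then obtain R where R: "pflow (reg K) {} {} Src Snk R" "real_arcs R" by blast
  have "pflow (cp i - {i # b}) {i # a} {} {} {i # x} (map_prod ((#) i) ((#) i) ` P - {(i # x, i # b)})"
    using flow_remove_sink[OF c(1)] c(3) x by simp
  note p1 = this
  define m' where "m' = {(i # x, rho # x)} \<union> {i # a} \<times> (\<lambda>t. t # a) ` E \<union> Snk \<times> {i # b} \<union> (if d then {(i # a, i # b)} else {})"
  let ?F = "map_prod ((#) i) ((#) i) ` P - {(i # x, i # b)} \<union> R \<union> {} \<union> m'"
  have inb: "i # a \<in> cp i" "i # b \<in> cp i" "i # x \<in> cp i" using a b xV by auto
  have xnb: "x \<noteq> b" using xV adj_irrefl by auto
  have dK: "y \<in> reg K \<Longrightarrow> hd y \<noteq> i" for y using hd_reg[of y K] unfolding K_def by auto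
  have dcp: "y \<in> cp i \<Longrightarrow> hd y = i" for y unfolding cp_def by auto
  have hE: "(i # z) \<notin> Src" "i # z \<notin> Snk" for z using dK[of "i # z"] in1 by auto
  have fl: "flow (cp i - {i # b} \<union> reg K \<union> {i # b}) (i # a) (i # b) ?F"
  proof (rule flow_compose[OF p1 R(1) pflow_sink_only])
    show "(cp i - {i # b}) \<inter> reg K = {}" "reg K \<inter> {i # b} = {}"
      using reg_disj[of "{i}" K] by (auto simp: K_def reg_single)
    show "Domain m' \<subseteq> insert (i # a) ({i # x} \<union> Snk)" unfolding m'_def by (auto split: if_splits)
    show "Range m' \<subseteq> insert (i # b) (Src \<union> {})" unfolding m'_def Src_def by (auto split: if_splits)
    show "y \<in> {i # b}" if "(z, y) \<in> m'" "z \<in> reg K" for z y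
      using that(1) dK[OF that(2)] unfolding m'_def by (auto split: if_splits)
    show "\<exists>!y. (z, y) \<in> m'" if "z \<in> {i # x} \<union> Snk" "z \<noteq> i # a" for z
    proof (cases "z = i # x")
      case True
      then have "(z, y) \<in> m' \<longleftrightarrow> y = rho # x" for y using that(2) hE unfolding m'_def by auto
      then show ?thesis by simp
    next
      case False
      then have "(z, y) \<in> m' \<longleftrightarrow> y = i # b" for y using that hE unfolding m'_def by auto
      then show ?thesis by simp
    qed
    show "\<exists>!z. (z, y) \<in> m'" if "y \<in> Src \<union> {}" "y \<noteq> i # b" for y
    proof (cases "y = rho # x")
      case True
      have "rho \<notin> E" using rho E by auto
      then have "(z, y) \<in> m' \<longleftrightarrow> z = i # x" for z using that(2) True unfolding m'_def by auto
      then show ?thesis by simp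
    next
      case False
      then have "(z, y) \<in> m' \<longleftrightarrow> z = i # a" for z using that unfolding m'_def Src_def by auto
      then show ?thesis by simp
    qed
  qed (use in1 inb xnb ab in auto)
  have "cp i - {i # b} \<union> reg K \<union> {i # b} = arr S (Suc k)"
    using reg_Un[of "{i}" K] inb(2) i reg_S unfolding K_def by (auto simp: reg_single insert_absorb)
  moreover have "real_arcs ?F"
  proof -
    have "i \<noteq> t \<and> t \<noteq> i" if "t \<in> T" for t using T(1) that by auto
    then have "real_arcs m'" using rho E(2) adj unfolding m'_def Snk_def by (auto split: if_splits)
    then show ?thesis using R(2) c(4) by blast
  qed
  moreover have "?F\<inverse> `` {i # b} = (if d then {i # a} else {}) \<union> (\<lambda>t. t # b) ` T"
  proof -
    have "(y, i # b) \<in> map_prod ((#) i) ((#) i) ` P \<longleftrightarrow> y = i # x" for y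
      using c(3) x by (metis (no_types, lifting) Image_singleton_iff converse_iff image_insert image_empty singleton_iff)
    moreover have "(y, i # b) \<notin> R" for y using pflowD(2)[OF R(1)] dK[of "i # b"] by auto
    moreover have "(y, i # b) \<in> m' \<longleftrightarrow> y \<in> (if d then {i # a} else {}) \<union> (\<lambda>t. t # b) ` T" for y
      using rho E unfolding m'_def Snk_def by auto
    ultimately show ?thesis by auto
  qed
  ultimately show ?thesis using fl unfolding sflow_def by (intro exI[of _ ?F]) simp
qed

end

lemma set_swp: "p < length x \<Longrightarrow> set (swp p x) = set x"
  unfolding swp_def by (rule set_swap) auto

lemma hd_swp: "p < length x \<Longrightarrow> hd (swp p x) = x ! p"
proof -
  assume p: "p < length x"
  then have x: "x \<noteq> []" by auto
  then have "hd (swp p x) = swp p x ! 0" by (metis hd_conv_nth length_0_conv length_swp)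
  then show ?thesis using p x by (simp add: nth_swp)
qed

lemma arr_Cons: "i # x \<in> arr S (Suc k) \<longleftrightarrow> i \<in> S \<and> x \<in> arr (S - {i}) k"
  unfolding arr_def by auto

lemma arr_SucE:
  assumes "u \<in> arr S (Suc k)"
  obtains i x where "u = i # x" "i \<in> S" "x \<in> arr (S - {i}) k"
  using assms by (cases u) (auto simp: arr_def)

lemma swp_Cons:
  assumes "u \<in> arr S (Suc k)" "p < Suc k"
  obtains a where "swp p u = u ! p # a" "u ! p \<in> S" "a \<in> arr (S - {u ! p}) k"
proof -
  have "length u = Suc k" using assms unfolding arr_def by simp
  then have "hd (swp p u) = u ! p" using hd_swp assms(2) by metis
  then show ?thesis using arr_SucE[OF swp_arr[OF assms]] that by (metis list.sel(1))
qed

section \<open>Induction step for words that agree in a position\<close>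

context arr_step
begin

text \<open>\<open>L\<close> splits into the predecessors \<open>L0\<close> inside copy
  \<open>i\<close> and the words \<open>t # b\<close> from other copies, with symbols
  \<open>T\<close>. The induction hypothesis serves \<open>L0\<close> unless it is empty or
  \<open>{a}\<close>.\<close>

lemma spans_into_same_hd:
  assumes i: "i \<in> S" and a: "a \<in> arr (S - {i}) k" and b: "b \<in> arr (S - {i}) k" and adj: "arr_adj a b"
    and L: "L \<subseteq> {x \<in> arr S (Suc k). arr_adj x (i # b)}" "L \<noteq> {}" "L \<noteq> {i # a}"
  shows "\<exists>F. sflow S (Suc k) (i # a) (i # b) F \<and> F\<inverse> `` {i # b} = L"
proof -
  define L0 where "L0 = {x. i # x \<in> L}"
  define T where "T = {t. t \<noteq> i \<and> t # b \<in> L}"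
  have LT: "L = (#) i ` L0 \<union> (\<lambda>t. t # b) ` T"
  proof (intro equalityI subsetI)
    fix x assume x: "x \<in> L"
    then obtain t y where ty: "x = t # y" using L(1) arr_SucE by blast
    show "x \<in> (#) i ` L0 \<union> (\<lambda>t. t # b) ` T"
    proof (cases "t = i")
      case False
      then have "y = b" using L(1) x ty by auto
      then show ?thesis using ty x False unfolding T_def by auto
    qed (use x ty in \<open>auto simp: L0_def\<close>)
  qed (auto simp: L0_def T_def)
  have T: "T \<subseteq> S - {i} - set b" using L(1) unfolding T_def arr_def by auto
  have L0: "L0 \<subseteq> {x \<in> arr (S - {i}) k. arr_adj x b}" using L(1) unfolding L0_def by (auto simp: arr_Cons)
  show ?thesis
  proof (cases "L0 = {} \<or> L0 = {a}")
    case False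
    then obtain F where F: "sflow (S - {i}) k a b F" "F\<inverse> `` {b} = L0"
      using IH_into[OF i] a b adj L0 unfolding spans_into_def by blast
    show ?thesis using same_copy[OF i F(1) T] F(2) LT by simp
  next
    case True
    then have "T \<noteq> {}" using L(2,3) LT by auto
    note so = same_copy_outer[OF i a b adj T this]
    have "L = (if a \<in> L0 then {i # a} else {}) \<union> (\<lambda>t. t # b) ` T" using True LT by auto
    then show ?thesis using so[of "a \<in> L0"] by simp
  qed
qed

text \<open>Adjacent words differ in one position only, and length \<open>Suc k \<ge> 2\<close>
  leaves another where they agree; brought to the front, it puts both words in the same
  copy.\<close>

lemma spans_into_step: "spans_into S (Suc k)"
  unfolding spans_into_def
proof (intro ballI impI allI)
  fix u v L
  assume u: "u \<in> arr S (Suc k)" and v: "v \<in> arr S (Suc k)" and adj: "arr_adj u v"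
    and L: "L \<subseteq> {x \<in> arr S (Suc k). arr_adj x v} \<and> L \<noteq> {} \<and> L \<noteq> {u}"
  obtain q t where q: "q < Suc k" "v = u[q := t]" using adj_arr[OF u v adj] by metis
  obtain p where p: "p < Suc k" "p \<noteq> q" using k1 by (cases "q = 0") (auto intro: that[of 0] that[of 1])
  have len: "length x = Suc k" if "x \<in> arr S (Suc k)" for x using that unfolding arr_def by simp
  have pv: "v ! p = u ! p" using p q len[OF u] by simp
  obtain a where a: "swp p u = u ! p # a" "u ! p \<in> S" "a \<in> arr (S - {u ! p}) k"
    using swp_Cons[OF u p(1)] .
  obtain b where b: "swp p v = u ! p # b" "b \<in> arr (S - {u ! p}) k"
    using swp_Cons[OF v p(1)] pv by metis
  have ainv: "swp p (swp p x) = x" if "x \<in> arr S (Suc k)" for x using swp_swp len that p(1) by metis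
  have adjs: "arr_adj (swp p x) (swp p y) \<longleftrightarrow> arr_adj x y" if "x \<in> arr S (Suc k)" "y \<in> arr S (Suc k)" for x y
    using adj_swp[of p x y] len that p(1) by simp
  have "\<exists>F. sflow S (Suc k) (u ! p # a) (u ! p # b) F \<and> F\<inverse> `` {u ! p # b} = swp p ` L"
  proof (rule spans_into_same_hd[OF a(2,3) b(2)])
    show "arr_adj a b" using adjs[OF u v] adj a(1) b(1) by simp
    show "swp p ` L \<subseteq> {x \<in> arr S (Suc k). arr_adj x (u ! p # b)}"
      using L swp_arr[OF _ p(1)] adjs[OF _ v] b(1) by auto
    show "swp p ` L \<noteq> {}" using L by simp
    show "swp p ` L \<noteq> {u ! p # a}"
    proof
      assume *: "swp p ` L = {u ! p # a}"
      have "x = u" if "x \<in> L" for x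
      proof -
        have "swp p x = swp p u" using * that a(1) by auto
        then show ?thesis using ainv[OF u] ainv[of x] L that by auto
      qed
      then show False using L by auto
    qed
  qed
  then obtain F where F: "sflow S (Suc k) (swp p u) (swp p v) F" "F\<inverse> `` {swp p v} = swp p ` L"
    using a(1) b(1) by metis
  obtain F' where F': "sflow S (Suc k) u v F'" "F'\<inverse> `` {v} = swp p ` swp p ` L"
    using sflow_swp[OF F(1) p(1) u v] F(2) by auto
  moreover have "swp p ` swp p ` L = L" using ainv L by (force simp: image_image)
  ultimately show "\<exists>F. sflow S (Suc k) u v F \<and> F\<inverse> `` {v} = L" by auto
qed

text \<open>As many paths as possible, up to \<open>k * m\<close>, come from inside the copy; the
  remaining ones, at most \<open>m\<close>, enter \<open>i # b\<close> from other copies. The count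
  is made at \<open>i # b\<close>, where the set of predecessors is known.\<close>

lemma spans_same_hd:
  assumes i: "i \<in> S" and a: "a \<in> arr (S - {i}) k" and b: "b \<in> arr (S - {i}) k" and ab: "a \<noteq> b"
    and l: "1 \<le> l" "l \<le> Suc k * m"
  shows "\<exists>F. sflow S (Suc k) (i # a) (i # b) F \<and> card (F `` {i # a}) = l"
proof -
  define l0 where "l0 = min l (k * m)"
  have l0: "1 \<le> l0" "l0 \<le> k * m" "l - l0 \<le> m" using l k1 m2 unfolding l0_def by auto
  obtain F where F: "sflow (S - {i}) k a b F" "card (F `` {a}) = l0"
    using IH_spans[OF i] a b ab l0 card_del[OF i] unfolding spans_def by fastforce
  obtain T where T: "T \<subseteq> S - {i} - set b" "card T = l - l0"
    using card_free[OF i b] l0(3) by (metis obtain_subset_with_card_n)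
  have fF: "flow (arr (S - {i}) k) a b F" using F unfolding sflow_def by simp
  obtain F' where F': "sflow S (Suc k) (i # a) (i # b) F'"
    "F'\<inverse> `` {i # b} = (#) i ` (F\<inverse> `` {b}) \<union> (\<lambda>t. t # b) ` T"
    using same_copy[OF i F(1) T(1)] by blast
  have fin': "finite T" "finite (F\<inverse> `` {b})"
    using finite_subset[OF T(1)] fin flowD(1,2)[OF fF] by (auto intro: finite_subset[of _ "arr (S - {i}) k"])
  have "card (F' `` {i # a}) = card (F'\<inverse> `` {i # b})"
    by (rule flow_card_out_in[of "arr S (Suc k)"]) (use F'(1) in \<open>simp add: sflow_def\<close>)
  also have "\<dots> = card (F\<inverse> `` {b}) + card T"
    unfolding F'(2) using T(1) fin' by (subst card_Un_disjoint) (auto simp: card_image inj_on_def)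
  also have "\<dots> = l" using flow_card_out_in[OF fF] F(2) T(2) l0_def by simp
  finally show ?thesis using F'(1) by blast
qed

lemma spans_agree:
  assumes u: "u \<in> arr S (Suc k)" and v: "v \<in> arr S (Suc k)" and uv: "u \<noteq> v" and p: "p < Suc k" "u ! p = v ! p"
    and l: "1 \<le> l" "l \<le> Suc k * m"
  shows "\<exists>F. sflow S (Suc k) u v F \<and> card (F `` {u}) = l"
proof -
  have len: "length x = Suc k" if "x \<in> arr S (Suc k)" for x using that unfolding arr_def by simp
  obtain a where a: "swp p u = u ! p # a" "u ! p \<in> S" "a \<in> arr (S - {u ! p}) k"
    using swp_Cons[OF u p(1)] .
  obtain b where b: "swp p v = u ! p # b" "b \<in> arr (S - {u ! p}) k"
    using swp_Cons[OF v p(1)] p(2) by metis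
  have "swp p (swp p x) = x" if "x \<in> arr S (Suc k)" for x using swp_swp len that p(1) by metis
  then have "a \<noteq> b" using a(1) b(1) uv u v by metis
  then obtain F where "sflow S (Suc k) (u ! p # a) (u ! p # b) F" "card (F `` {u ! p # a}) = l"
    using spans_same_hd[OF a(2,3) b(2) _ l] by blast
  then show ?thesis using sflow_swp[of S "Suc k" p u v F] u v p(1) a(1) b(1) by auto
qed

lemma spans_one:
  assumes "u \<in> arr S (Suc k)" "v \<in> arr S (Suc k)" "hd u \<noteq> hd v"
  shows "\<exists>F. sflow S (Suc k) u v F \<and> card (F `` {u}) = 1"
proof -
  have uv: "u \<noteq> v" using assms by auto
  have "\<exists>R. pflow (reg S) {} {} {u} {v} R \<and> real_arcs R"
    by (rule routing) (use assms reg_S uv in auto)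
  then obtain R where R: "pflow (arr S (Suc k)) {} {} {u} {v} R" "real_arcs R" using reg_S by auto
  show ?thesis using pflow_one_flow[OF R(1) assms(1,2) uv] R(2) unfolding sflow_def by blast
qed

end

text \<open>Position \<open>q\<close> stands for the word \<open>c[q := i]\<close>, which fits into
  copy \<open>c ! q\<close> and into copies named by symbols outside \<open>c\<close>, here
  \<open>D\<close>. \<open>e\<close> picks distinct copies outside the reserved set
  \<open>T\<close>: it keeps \<open>c ! q\<close> where possible and moves the other positions into
  \<open>D - T\<close>. By the bound on \<open>card T\<close> these are at most one too many, so
  giving up a single position \<open>qs\<close> is enough.\<close>

lemma assign_specials:
  fixes c :: "nat list"
  assumes c: "distinct c" "length c = k" "k \<ge> 1" and D: "finite D" "D \<inter> set c = {}"
    and T: "T \<subseteq> D \<union> set c" "card T \<le> Suc (card D)"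
  obtains qs e where "qs < k" "inj_on e ({..<k} - {qs})"
    "\<forall>q. q < k \<longrightarrow> q \<noteq> qs \<longrightarrow> e q \<in> insert (c ! q) D - T"
proof -
  define Q where "Q = {q. q < k \<and> c ! q \<in> T}"
  have fT: "finite T" using T(1) D(1) finite_subset by blast
  have inj: "inj_on ((!) c) {..<k}" using c by (simp add: inj_on_nth)
  have Qk: "Q \<subseteq> {..<k}" unfolding Q_def by auto
  have QT: "(!) c ` Q = T \<inter> set c" 
  proof
    show "(!) c ` Q \<subseteq> T \<inter> set c" unfolding Q_def using c(2) by auto
    show "T \<inter> set c \<subseteq> (!) c ` Q" unfolding Q_def using c(2) by (auto simp: in_set_conv_nth image_iff)
  qed
  have cQ: "card Q = card (T \<inter> set c)" using QT card_image[OF inj_on_subset[OF inj Qk]] by simp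
  have "card T = card (T \<inter> D) + card (T \<inter> set c)"
  proof -
    have "T = (T \<inter> D) \<union> (T \<inter> set c)" "(T \<inter> D) \<inter> (T \<inter> set c) = {}" using T(1) D(2) by blast+
    then show ?thesis using fT card_Un_disjoint[of "T \<inter> D" "T \<inter> set c"] by simp
  qed
  moreover have "card D = card (T \<inter> D) + card (D - T)"
    using D(1) by (metis Int_commute card_Diff_subset_Int card_Int_Diff finite_Int)
  ultimately have le: "card Q \<le> Suc (card (D - T))" using cQ T(2) by simp
  have fQ: "finite Q" using Qk finite_subset by blast
  obtain qs where qs: "qs < k" "card (Q - {qs}) \<le> card (D - T)"
  proof (cases "Q = {}")
    case True
    then show ?thesis using that[of 0] c(3) by simp
  next
    case False
    then obtain q where q: "q \<in> Q" by auto
    then have "card (Q - {q}) \<le> card (D - T)" using le fQ by simp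
    then show ?thesis using that[of q] q Qk by auto
  qed
  obtain g where g: "inj_on g (Q - {qs})" "g ` (Q - {qs}) \<subseteq> D - T"
    using card_le_inj[OF _ _ qs(2)] fQ D(1) by blast
  define e where "e q = (if q \<in> Q then g q else c ! q)" for q
  have gD: "g q \<in> D" "g q \<notin> T" if "q \<in> Q" "q \<noteq> qs" for q using g(2) that by auto
  have "inj_on e ({..<k} - {qs})"
  proof (rule inj_onI)
    fix q r assume qr: "q \<in> {..<k} - {qs}" "r \<in> {..<k} - {qs}" "e q = e r"
    have nD: "c ! s \<notin> D" if "s < k" for s using D(2) c(2) that nth_mem by blast
    have q: "q < k" "q \<noteq> qs" "r < k" "r \<noteq> qs" using qr by auto
    have eQ: "s \<in> Q \<Longrightarrow> e s = g s" "s \<notin> Q \<Longrightarrow> e s = c ! s" for s unfolding e_def by simp_all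
    consider "q \<in> Q" "r \<in> Q" | "q \<in> Q" "r \<notin> Q" | "q \<notin> Q" "r \<in> Q" | "q \<notin> Q" "r \<notin> Q" by blast
    then show "q = r"
    proof cases
      case 1
      then show ?thesis using inj_onD[OF g(1), of q r] qr(3) q eQ by simp
    next
      case 2
      then show ?thesis using gD(1)[OF 2(1) q(2)] nD[OF q(3)] qr(3) eQ by simp
    next
      case 3
      then show ?thesis using gD(1)[OF 3(2) q(4)] nD[OF q(1)] qr(3) eQ by simp
    next
      case 4
      then show ?thesis using inj_onD[OF inj, of q r] qr(3) q eQ by simp
    qed
  qed
  moreover have "e q \<in> insert (c ! q) D - T" if "q < k" "q \<noteq> qs" for q
    using that gD[of q] unfolding e_def Q_def by auto
  ultimately show ?thesis using that[OF qs(1)] by blast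
qed

section \<open>Vertices that differ in every position\<close>

context arr_step
begin

definition far :: "nat \<Rightarrow> nat \<Rightarrow> nat list \<Rightarrow> nat list \<Rightarrow> bool" where
  "far i j a b \<longleftrightarrow> i \<in> S \<and> j \<in> S \<and> i \<noteq> j \<and> a \<in> arr (S - {i}) k \<and> b \<in> arr (S - {j}) k \<and>
     (\<forall>q<k. a ! q \<noteq> b ! q)"

text \<open>The data of the centre \<open>c = a[p := t]\<close>. If \<open>j\<close> occurs in
  \<open>a\<close>, it has to be the symbol replaced, so that \<open>c\<close> avoids both
  \<open>i\<close> and \<open>j\<close> and belongs to both copies.\<close>

definition pivot :: "nat \<Rightarrow> nat \<Rightarrow> nat list \<Rightarrow> nat \<Rightarrow> nat \<Rightarrow> bool" where
  "pivot i j a p t \<longleftrightarrow> p < k \<and> t \<in> S - {i, j} - set a \<and> (j \<in> set a \<longrightarrow> a ! p = j)"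

lemma pivotD:
  assumes f: "far i j a b" and p: "pivot i j a p t"
  defines "c \<equiv> a[p := t]"
  shows "c \<in> arr (S - {i, j}) k" "c \<in> arr (S - {i}) k" "c \<in> arr (S - {j}) k" "arr_adj a c" "arr_adj c a"
    "i \<notin> set c" "j \<notin> set c" "length c = k" "distinct c" "set c = insert t (set a - {a ! p})"
    "length a = k" "distinct a" "i \<notin> set a" "length b = k" "distinct b" "j \<notin> set b" "set a \<subseteq> S" "set b \<subseteq> S"
    "a ! p \<notin> set c" "p < k" "c ! p = t"
proof -
  have a: "length a = k" "distinct a" "set a \<subseteq> S - {i}" and b: "length b = k" "distinct b" "set b \<subseteq> S - {j}"
    using f unfolding far_def arr_def by auto
  have pt: "p < k" "t \<in> S" "t \<noteq> i" "t \<noteq> j" "t \<notin> set a" "j \<in> set a \<Longrightarrow> a ! p = j" using p unfolding pivot_def by auto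
  show sc: "set c = insert t (set a - {a ! p})" unfolding c_def using a pt by (simp add: set_update_distinct)
  show "length a = k" "distinct a" "i \<notin> set a" "length b = k" "distinct b" "j \<notin> set b" "set a \<subseteq> S" "set b \<subseteq> S" "p < k"
    using a b pt by auto
  show "length c = k" "distinct c" using a pt unfolding c_def by (auto simp: distinct_list_update)
  show "i \<notin> set c" "j \<notin> set c" using a pt unfolding sc by auto
  then show "c \<in> arr (S - {i, j}) k" "c \<in> arr (S - {i}) k" "c \<in> arr (S - {j}) k"
    using \<open>length c = k\<close> \<open>distinct c\<close> a pt sc unfolding arr_def by auto
  show "a ! p \<notin> set c" using pt a(1) nth_mem[of p a] unfolding sc by auto
  show "c ! p = t" using pt a(1) unfolding c_def by simp
  show "arr_adj a c" unfolding adj_update c_def using a pt nth_mem[of p a] by (metis)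
  then show "arr_adj c a" using adj_sym by blast
qed

lemma copy_spans:
  assumes "t \<in> S" "a \<in> arr (S - {t}) k" "b \<in> arr (S - {t}) k" "a \<noteq> b" "1 \<le> l" "l \<le> k * m"
  shows "\<exists>F. sflow (S - {t}) k a b F \<and> card (F `` {a}) = l"
proof -
  have "l \<le> k * (card (S - {t}) - k)" using card_del[OF assms(1)] assms(6) by simp
  then show ?thesis using IH_spans[OF assms(1)] assms unfolding spans_def by blast
qed

lemma copy_into:
  assumes "t \<in> S" "a \<in> arr (S - {t}) k" "b \<in> arr (S - {t}) k" "arr_adj a b"
    "L \<subseteq> {x \<in> arr (S - {t}) k. arr_adj x b}" "L \<noteq> {}" "L \<noteq> {a}"
  shows "\<exists>F. sflow (S - {t}) k a b F \<and> F\<inverse> `` {b} = L"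
  using IH_into[OF assms(1)] assms unfolding spans_into_def by blast

lemma card_rest:
  assumes "i \<in> S" "j \<in> S" "i \<noteq> j"
  shows "card (S - {i, j}) = k + m - 1" "c \<in> arr (S - {i, j}) k \<Longrightarrow> card (S - {i, j} - set c) = m - 1"
proof -
  show 1: "card (S - {i, j}) = k + m - 1" using assms card_S fin by (subst card_Diff_subset) auto
  assume "c \<in> arr (S - {i, j}) k"
  then have "card (set c) = k" "set c \<subseteq> S - {i, j}" unfolding arr_def by (auto simp: distinct_card)
  then show "card (S - {i, j} - set c) = m - 1" using 1 by (subst card_Diff_subset) auto
qed

lemma nbr_E:
  assumes "c \<in> arr S' k" "y \<in> arr S'' k" "arr_adj c y"
  obtains q t where "q < k" "t \<in> S''" "t \<notin> set c" "y = c[q := t]"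
  using adj_arr[OF assms] by metis

lemma update_inj:
  assumes "q < length c" "q' < length c" "t \<notin> set c" "c[q := t] = c[q' := t']"
  shows "q = q'" "t = t'"
proof -
  have "c[q' := t'] ! q = t" using assms by (metis nth_list_update_eq)
  then show "q = q'" using assms(1,3) by (metis nth_list_update_neq nth_mem)
  then show "t = t'" using assms by (metis nth_list_update_eq)
qed

text \<open>\<open>Q\<close> is chosen before \<open>P\<close>: its first inner vertices
  \<open>Y\<close> come out as they may, and \<open>P\<close> is then required to end in their
  reflection. This is where \<open>l \<ge> 2\<close> enters, since the set prescribed for
  \<open>P\<close> must not be \<open>{a}\<close>.\<close>

lemma far_spans_low:
  assumes f: "far i j a b" and pv: "pivot i j a p t" and cb: "a[p := t] \<noteq> b" and l: "2 \<le> l" "l \<le> k * m"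
  shows "\<exists>F. sflow S (Suc k) (i # a) (j # b) F \<and> card (F `` {i # a}) = l"
proof -
  define c where "c = a[p := t]"
  note c = pivotD[OF f pv, folded c_def]
  have ij: "i \<in> S" "j \<in> S" "i \<noteq> j" and a: "a \<in> arr (S - {i}) k" and b: "b \<in> arr (S - {j}) k"
    using f unfolding far_def by auto
  obtain Q where Q: "sflow (S - {j}) k c b Q" "card (Q `` {c}) = l"
    using copy_spans[OF ij(2) c(3) b, of l] cb l unfolding c_def by auto
  have fQ: "flow (arr (S - {j}) k) c b Q" "real_arcs Q" using Q(1) unfolding sflow_def by auto
  define Y where "Y = Q `` {c}"
  have YE: "y \<in> arr (S - {j}) k" "arr_adj c y" if "y \<in> Y" for y
    using that fQ(2) flowD(2)[OF fQ(1)] unfolding Y_def by auto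
  \<comment> \<open>The reflection trades \<open>i\<close> for \<open>j\<close>:
    \<open>c[q := i]\<close> becomes \<open>c[q := j]\<close>, and neighbours of \<open>c\<close>
    without \<open>i\<close> stay fixed.\<close>
  define tau where "tau y = map (\<lambda>s. if s = i then j else s) y" for y :: "nat list"
  have tau_up: "tau (c[q := s]) = c[q := (if s = i then j else s)]" for q s
  proof -
    have "tau c = c" unfolding tau_def using c(6) by (auto intro!: map_idI)
    then show ?thesis unfolding tau_def by (simp add: map_update)
  qed
  have tau_id: "tau y = y" if "i \<notin> set y" for y unfolding tau_def using that by (auto intro!: map_idI)
  have Yform: "\<exists>q s. q < k \<and> s \<in> S - {j} \<and> s \<notin> set c \<and> y = c[q := s]" if yY: "y \<in> Y" for y
    using nbr_E[OF c(3) YE[OF yY]] by metis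
  have tauE: "tau y \<in> arr (S - {i}) k" "arr_adj (tau y) c" "i \<notin> set (tau y)" if "y \<in> Y" for y
  proof -
    from Yform[OF that] obtain q s where q: "q < k" "s \<in> S - {j}" "s \<notin> set c" "y = c[q := s]" by blast
    let ?s = "if s = i then j else s"
    have s: "?s \<in> S - {i}" "?s \<notin> set c" using q ij c by auto
    have ty: "tau y = c[q := ?s]" using q tau_up by simp
    show "tau y \<in> arr (S - {i}) k"
      unfolding ty by (rule arr_update[OF c(1) q(1) s(1)]) (use s c(1) in \<open>auto simp: arr_def\<close>)
    then show "i \<notin> set (tau y)" unfolding arr_def by auto
    have "arr_adj c (tau y)" unfolding ty by (rule adj_updateI[OF c(1) q(1)]) (use s q c(8) nth_mem[of q c] in auto)
    then show "arr_adj (tau y) c" using adj_sym by blast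
  qed
  have tau_inj: "inj_on tau Y"
  proof (rule inj_onI)
    fix y y' assume y: "y \<in> Y" "y' \<in> Y" "tau y = tau y'"
    obtain q s where q: "q < k" "s \<in> S - {j}" "s \<notin> set c" "y = c[q := s]" using Yform[OF y(1)] by blast
    obtain q' s' where q': "q' < k" "s' \<in> S - {j}" "s' \<notin> set c" "y' = c[q' := s']" using Yform[OF y(2)] by blast
    have "c[q := (if s = i then j else s)] = c[q' := (if s' = i then j else s')]" using y(3) q(4) q'(4) tau_up by simp
    moreover have "q < length c" "q' < length c" "(if s = i then j else s) \<notin> set c" using q q' c(7,8) by auto
    ultimately have "q = q'" "(if s = i then j else s) = (if s' = i then j else s')"
      using update_inj[of q c q' "if s = i then j else s"] by blast+
    then show "y = y'" using q q' by (auto split: if_splits)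
  qed
  have Yl: "card Y = l" using Q(2) unfolding Y_def by simp
  define X where "X = tau ` Y"
  have Xl: "card X = l" unfolding X_def using card_image[OF tau_inj] Yl by simp
  have "X \<subseteq> {x \<in> arr (S - {i}) k. arr_adj x c}" unfolding X_def using tauE by auto
  moreover have "X \<noteq> {}" "X \<noteq> {a}" using Xl l by auto
  ultimately obtain P where P: "sflow (S - {i}) k a c P" "P\<inverse> `` {c} = X"
    using copy_into[OF ij(1) a c(2,4)] by blast
  have fP: "flow (arr (S - {i}) k) a c P" "real_arcs P" using P(1) unfolding sflow_def by auto
  note dP = flowD[OF fP(1)]
  have Pl: "card (P `` {a}) = l" using flow_card_out_in[OF fP(1)] P(2) Xl by simp
  have fPa: "finite (P `` {a})" by (rule finite_subset[OF _ dP(1)]) (use dP(2) in auto)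
  have "Y \<noteq> {}" using Yl l by auto
  then obtain y0 where y0: "y0 \<in> Y" "(\<exists>y\<in>Y. i \<in> set y) \<longrightarrow> i \<in> set y0" by auto
  define Ys where "Ys = {y \<in> Y. i \<in> set y \<and> y \<noteq> y0}"
  \<comment> \<open>For \<open>y = c[q := i]\<close> this is \<open>c ! q\<close>, the one symbol of
    \<open>c\<close> missing from \<open>y\<close>. Copy \<open>r y\<close> contains both
    \<open>y\<close> and its reflection, and a Hamiltonian path of that copy joins them.\<close>
  define r where "r y = (THE s. s \<in> set c \<and> s \<notin> set y)" for y
  have rY: "r y \<in> set c" "r y \<notin> set y" "r y \<notin> set (tau y)" "\<exists>q<k. y = c[q := i] \<and> r y = c ! q"
    if "y \<in> Y" "i \<in> set y" for y
  proof -
    from Yform[OF that(1)] obtain q s where q: "q < k" "s \<in> S - {j}" "s \<notin> set c" "y = c[q := s]" by blast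
    have sy: "set y = insert s (set c - {c ! q})" using q c by (simp add: set_update_distinct)
    then have "s = i" using that(2) c(6) by auto
    have "r y = c ! q" unfolding r_def
      by (rule the_equality) (use sy q c(8) nth_mem[of q c] in auto)
    then show "\<exists>q<k. y = c[q := i] \<and> r y = c ! q" using q \<open>s = i\<close> by auto
    show "r y \<in> set c" "r y \<notin> set y" using \<open>r y = c ! q\<close> sy q c(8) nth_mem[of q c] by auto
    moreover have "r y \<noteq> j" using \<open>r y \<in> set c\<close> c(7) by auto
    ultimately show "r y \<notin> set (tau y)" unfolding tau_def by (auto split: if_splits)
  qed
  have r_inj: "y = y'" if yy: "y \<in> Y" "y' \<in> Y" "i \<in> set y" "i \<in> set y'" "r y = r y'" for y y'
  proof -
    obtain q where q: "q < k" "y = c[q := i]" "r y = c ! q" using rY(4)[OF yy(1,3)] by blast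
    obtain q' where q': "q' < k" "y' = c[q' := i]" "r y' = c ! q'" using rY(4)[OF yy(2,4)] by blast
    have "q = q'" using q q' yy(5) c(8,9) by (metis nth_eq_iff_index_eq)
    then show ?thesis using q q' by simp
  qed
  define K where "K = r ` Ys"
  have Kc: "K \<subseteq> set c" using rY(1) unfolding K_def Ys_def by auto
  have KS: "K \<subseteq> S - {i, j}" using Kc c(1) unfolding arr_def by auto
  define Src where "Src = (\<lambda>y. r y # tau y) ` Ys"
  define Snk where "Snk = (\<lambda>y. r y # y) ` Ys"
  have YsY: "y \<in> Ys \<Longrightarrow> y \<in> Y \<and> i \<in> set y \<and> y \<noteq> y0" for y unfolding Ys_def by auto
  have in1: "Src \<subseteq> reg K" "Snk \<subseteq> reg K"
  proof -
    show "Src \<subseteq> reg K"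
    proof
      fix x assume "x \<in> Src"
      then obtain y where y: "y \<in> Ys" "x = r y # tau y" unfolding Src_def by auto
      note yY = YsY[OF y(1)]
      have "tau y \<in> arr (S - {r y}) k" using tauE(1)[of y] rY(3)[of y] yY arr_other by blast
      then show "x \<in> reg K" using y unfolding K_def by auto
    qed
    show "Snk \<subseteq> reg K"
    proof
      fix x assume "x \<in> Snk"
      then obtain y where y: "y \<in> Ys" "x = r y # y" unfolding Snk_def by auto
      note yY = YsY[OF y(1)]
      have "y \<in> arr (S - {r y}) k" using YE(1)[of y] rY(2)[of y] yY arr_other by blast
      then show "x \<in> reg K" using y unfolding K_def by auto
    qed
  qed
  have r_inj': "inj_on r Ys" by (rule inj_onI) (use YsY r_inj in blast)
  have "\<exists>R. pflow (reg K) {} {} Src Snk R \<and> real_arcs R"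
  proof (rule routing)
    show "K \<subseteq> S" using KS by auto
    show "inj_on hd Src" "inj_on hd Snk"
      unfolding Src_def Snk_def using r_inj' by (auto simp: inj_on_def)
    show "Src \<inter> Snk = {}"
    proof -
      have "tau y \<noteq> y'" if "y \<in> Ys" "y' \<in> Ys" for y y' using tauE(3)[of y] YsY that by metis
      then show ?thesis unfolding Src_def Snk_def by auto
    qed
    have "hd ` Src = K" "hd ` Snk = K" unfolding Src_def Snk_def K_def by (auto simp: image_image)
    then show "hd ` Src \<noteq> hd ` Snk \<or> hd ` Src = K" by simp
    have "card Src = card (hd ` Src)" "card Snk = card (hd ` Snk)"
      using \<open>inj_on hd Src\<close> \<open>inj_on hd Snk\<close> by (simp_all add: card_image)
    then show "card Src = card Snk" using \<open>hd ` Src = K\<close> \<open>hd ` Snk = K\<close> by simp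
  qed (use in1 in auto)
  then obtain R where R: "pflow (reg K) {} {} Src Snk R" "real_arcs R" by blast
  define M where "M = {(i # y, j # y) |y. y \<in> Y \<and> y \<noteq> y0 \<and> i \<notin> set y} \<union> {(i # tau y, r y # tau y) |y. y \<in> Ys}
    \<union> {(r y # y, j # y) |y. y \<in> Ys}"
  have rij: "r y \<noteq> i" "r y \<noteq> j" "i \<noteq> r y" "j \<noteq> r y" if "y \<in> Ys" for y using rY(1)[of y] YsY[OF that] c(6,7) by auto
  have M_i: "(i # x, z) \<in> M \<longleftrightarrow> (\<exists>y\<in>Y. y \<noteq> y0 \<and> x = tau y \<and> z = (if i \<in> set y then r y # tau y else j # y))" for x z
    unfolding M_def Ys_def using rij tau_id unfolding Ys_def by auto
  have M_out: "\<exists>!z. (i # x, z) \<in> M" if "x \<in> X" "x \<noteq> tau y0" for x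
  proof -
    obtain y where y: "y \<in> Y" "x = tau y" "y \<noteq> y0" using \<open>x \<in> X\<close> \<open>x \<noteq> tau y0\<close> unfolding X_def by auto
    have "(i # x, z) \<in> M \<longleftrightarrow> z = (if i \<in> set y then r y # tau y else j # y)" for z
      unfolding M_i using y inj_onD[OF tau_inj] by metis
    then show ?thesis by simp
  qed
  have M_j: "(z, j # y) \<in> M \<longleftrightarrow> y \<in> Y \<and> y \<noteq> y0 \<and> z = (if i \<in> set y then r y # y else i # y)" for y z
    unfolding M_def Ys_def using rij unfolding Ys_def by auto
  have joined: "\<exists>F. flow (reg ({i, j} \<union> K)) (i # a) (j # b) F \<and> real_arcs F \<and>
    F `` {i # a} = (#) i ` (P `` {a} - (if a = tau y0 then {} else {c})) \<union> M `` {i # a} \<and>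
    (\<forall>x y. (x, y) \<in> P \<longrightarrow> y \<noteq> c \<longrightarrow> (i # x, i # y) \<in> F)"
  proof (rule join_copies[OF ij P(1) _ Q(1) _ KS R in1])
    show "tau y0 \<in> P\<inverse> `` {c}" using P(2) y0 unfolding X_def by auto
    show "y0 \<in> Q `` {c}" using y0 unfolding Y_def by simp
    show "Domain M \<subseteq> insert (i # a) ((#) i ` (P\<inverse> `` {c} - {tau y0}) \<union> Snk)"
    proof
      fix x assume "x \<in> Domain M"
      then obtain y where "y \<in> Y" "y \<noteq> y0" "x = i # tau y \<or> (x = r y # y \<and> y \<in> Ys)"
        unfolding M_def using YsY tau_id by auto
      then show "x \<in> insert (i # a) ((#) i ` (P\<inverse> `` {c} - {tau y0}) \<union> Snk)"
        using inj_onD[OF tau_inj, of y y0] y0 unfolding P(2) X_def Snk_def by auto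
    qed
    show "Range M \<subseteq> insert (j # b) ((#) j ` (Q `` {c} - {y0}) \<union> Src)"
      using YsY unfolding M_def Y_def[symmetric] Src_def by auto
    show "hd y = j" if "(x, y) \<in> M" "x \<in> Snk" for x y
    proof -
      from that(2) obtain y' where "y' \<in> Ys" "x = r y' # y'" unfolding Snk_def by auto
      then show ?thesis using that(1) rij unfolding M_def by auto
    qed
    show "\<exists>!y. (i # x, y) \<in> M" if "x \<in> P\<inverse> `` {c}" "x \<noteq> tau y0" for x using M_out that P(2) by simp
    show "\<exists>!y. (x, y) \<in> M" if xs: "x \<in> Snk" for x
    proof -
      obtain y where y: "y \<in> Ys" "x = r y # y" using xs unfolding Snk_def by auto
      have "(x, z) \<in> M \<longleftrightarrow> z = j # y" for z using y rij unfolding M_def by auto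
      then show ?thesis by simp
    qed
    show "\<exists>!x. (x, j # y) \<in> M" if "y \<in> Q `` {c}" "y \<noteq> y0" for y
    proof -
      have "(z, j # y) \<in> M \<longleftrightarrow> z = (if i \<in> set y then r y # y else i # y)" for z
        unfolding M_j using that unfolding Y_def by simp
      then show ?thesis by simp
    qed
    show "\<exists>!x. (x, y) \<in> M" if ys: "y \<in> Src" for y
    proof -
      obtain y' where y': "y' \<in> Ys" "y = r y' # tau y'" using ys unfolding Src_def by auto
      have "(z, y) \<in> M \<longleftrightarrow> z = i # tau y'" for z using y' rij inj_onD[OF r_inj'] unfolding M_def by auto
      then show ?thesis by simp
    qed
    show "real_arcs M" using rij ij(3) unfolding M_def by auto
  qed
  then obtain F where F: "flow (reg ({i, j} \<union> K)) (i # a) (j # b) F" "real_arcs F"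
    "F `` {i # a} = (#) i ` (P `` {a} - (if a = tau y0 then {} else {c})) \<union> M `` {i # a}"
    "\<And>x y. (x, y) \<in> P \<Longrightarrow> y \<noteq> c \<Longrightarrow> (i # x, i # y) \<in> F" by blast
  \<comment> \<open>At \<open>i # a\<close> only the arc from \<open>a\<close> to \<open>c\<close>
    can have been cut. In that case exactly one link replaces it; otherwise \<open>i # a\<close> has
    no link.\<close>
  have Fl: "card (F `` {i # a}) = l"
  proof (cases "a \<in> X \<and> a \<noteq> tau y0")
    case True
    then obtain z where z: "M `` {i # a} = {z}" using M_out[of a] by auto
    have "z \<notin> (#) i ` A" for A
    proof -
      have "(i # a, z) \<in> M" using z by auto
      then show ?thesis unfolding M_i using rij ij(3) unfolding Ys_def by (auto split: if_splits)
    qed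
    moreover have "c \<in> P `` {a}" using True P(2) by auto
    ultimately show ?thesis unfolding F(3) z using True fPa Pl l by (simp add: card_image)
  next
    case False
    have "M `` {i # a} = {}"
    proof -
      have "(i # a, z) \<notin> M" for z
        unfolding M_i using False inj_onD[OF tau_inj] y0(1) unfolding X_def by auto
      then show ?thesis by auto
    qed
    moreover have "P `` {a} - (if a = tau y0 then {} else {c}) = P `` {a}"
      using False P(2) by auto
    ultimately show ?thesis unfolding F(3) using Pl by (simp add: card_image)
  qed
  \<comment> \<open>The copies outside \<open>K\<close> are still missing. \<open>p'\<close> occurs
    in \<open>c\<close>, so a word \<open>x\<close> without it differs from \<open>c\<close>;
    \<open>q'\<close> lies outside \<open>c\<close>, hence outside \<open>K\<close>. The detour is
    made on the arc of \<open>P\<close> into such an \<open>x\<close>.\<close>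
  have "\<exists>p'\<in>set c. p' \<notin> K"
  proof (cases "i \<in> set y0")
    case True
    have "r y0 \<notin> K"
    proof
      assume "r y0 \<in> K"
      then obtain y where "y \<in> Ys" "r y0 = r y" unfolding K_def by auto
      then show False using r_inj[of y0 y] y0(1) True YsY[of y] by auto
    qed
    then show ?thesis using rY(1)[OF y0(1) True] by auto
  next
    case False
    then have "K = {}" using y0(2) unfolding K_def Ys_def by auto
    then show ?thesis using c(8) k1 by (cases c) auto
  qed
  then obtain p' where p': "p' \<in> set c" "p' \<notin> K" by auto
  have "card (S - {i, j} - set c) \<noteq> 0" using card_rest(2)[OF ij c(1)] m2 by simp
  then have "S - {i, j} - set c \<noteq> {}" by (metis card.empty)
  then obtain q' where q': "q' \<in> S" "q' \<noteq> i" "q' \<noteq> j" "q' \<notin> set c" by auto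
  have pS: "p' \<in> S" "p' \<noteq> i" "p' \<noteq> j" using p' c(1) unfolding arr_def by auto
  have pq: "p' \<noteq> q'" using p' q' by auto
  have "card (S - {i, p', q'}) = k + m - 2"
    using card_S fin ij pS q' pq by (subst card_Diff_subset) auto
  moreover have "2 \<le> k \<longrightarrow> 1 < (k + m - 2) * (k + m - 2 - 1)"
  proof
    assume "2 \<le> k"
    then have "2 * 1 \<le> (k + m - 2) * (k + m - 2 - 1)" using m2 by (intro mult_le_mono) auto
    then show "1 < (k + m - 2) * (k + m - 2 - 1)" by simp
  qed
  ultimately have "\<exists>x\<in>arr (S - {i, p', q'}) k. x \<notin> {a}"
    by (intro arr_avoid) (use fin k1 m2 room in auto)
  then obtain x where x: "x \<in> arr (S - {i, p', q'}) k" "x \<noteq> a" by auto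
  have x': "x \<in> arr (S - {i}) k" "p' \<notin> set x" "q' \<notin> set x" "x \<noteq> c" using x p' unfolding arr_def by auto
  obtain z where "(z, x) \<in> P" using dP(10)[OF x'(1) x(2) x'(4)] by blast
  then have zx: "(i # z, i # x) \<in> F" using F(4) x'(4) by simp
  have q'K: "q' \<notin> K" using q' Kc by auto
  have "\<exists>F'. sflow S (Suc k) (i # a) (j # b) F' \<and> card (F' `` {i # a}) = card (F `` {i # a}) \<and>
      (i # x \<noteq> j # b \<longrightarrow> F'\<inverse> `` {j # b} = F\<inverse> `` {j # b})"
    by (rule absorb_copies[OF F(1,2) _ _ _ pq zx x'(2,3)]) (use KS ij pS p' q' q'K in auto)
  then show ?thesis using Fl by auto
qed

section \<open>Containers using all neighbours of the centre\<close>

lemma nbr_set: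
  assumes "t \<in> S" "a \<in> arr (S - {t}) k" "c \<in> arr (S - {t}) k" "arr_adj a c"
  shows "\<exists>F. sflow (S - {t}) k a c F \<and> F\<inverse> `` {c} = {x \<in> arr (S - {t}) k. arr_adj x c}"
proof (rule copy_into[OF assms])
  let ?N = "{x \<in> arr (S - {t}) k. arr_adj x c}"
  have "?N = {x \<in> arr (S - {t}) k. arr_adj c x}" using adj_sym by auto
  then have "card ?N = k * m" using card_cp_nbrs[OF assms(1,3)] by simp
  moreover have "2 \<le> k * m" using k1 m2 by (metis le_trans mult_le_mono nat_mult_1)
  ultimately have c2: "2 \<le> card ?N" by simp
  show "?N \<noteq> {}"
  proof
    assume "?N = {}"
    with c2 show False by (simp only: card.empty)
  qed
  show "?N \<noteq> {a}"
  proof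
    assume "?N = {a}"
    with c2 show False by (simp only: card_1_singleton_iff) simp
  qed
qed simp

text \<open>
  The path \<open>i # a, i # c, j # c, j # y0\<close> uses up the two centres. The remaining neighbours of \<open>c\<close> in copy \<open>i\<close>
  that contain \<open>j\<close> enter the copies \<open>a ! q\<close>, and those in copy \<open>j\<close> that contain \<open>i\<close> are reached from the copies \<open>e q\<close>; in
  addition \<open>i # a\<close> enters the copies in \<open>E\<close> directly, and \<open>j # b\<close> is reached directly from those in \<open>T\<close>.
\<close>

lemma far_join:
  assumes f: "far i j a b" and pv: "pivot i j a p t" and cb: "a[p := t] \<noteq> b"
    and P: "sflow (S - {i}) k a (a[p := t]) P"
      "P\<inverse> `` {a[p := t]} = {x \<in> arr (S - {i}) k. arr_adj x (a[p := t])}"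
    and K: "K \<subseteq> S - {i, j}" and E: "E \<subseteq> K - set a" and aK: "set a - {j} \<subseteq> K"
    and T: "T \<subseteq> K - set b" and I: "I \<subseteq> {..<k}" and e: "inj_on e I"
    and y0: "y0 \<in> arr (S - {j}) k" "arr_adj (a[p := t]) y0" "\<And>q. q < k \<Longrightarrow> q \<in> I \<longleftrightarrow> a[p := t, q := i] \<noteq> y0"
      "i \<notin> set y0 \<Longrightarrow> y0 = b"
    and eK: "\<And>q. q \<in> I \<Longrightarrow> e q \<in> K - T \<and> e q \<notin> set (a[p := t]) - {a[p := t] ! q}"
    and crd: "card (E \<union> (set a - {j})) = card (T \<union> e ` I)"
    and ne: "E \<union> (set a - {j}) \<noteq> T \<union> e ` I \<or> E \<union> (set a - {j}) = K"
  shows "\<exists>F. flow (reg ({i, j} \<union> K)) (i # a) (j # b) F \<and> real_arcs F \<and>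
    card (F `` {i # a}) = k * m + card E + (if j \<in> set a then 0 else 1) \<and>
    (\<forall>x y. (x, y) \<in> P \<longrightarrow> y \<noteq> a[p := t] \<longrightarrow> (i # x, i # y) \<in> F)"
proof -
  define c where "c = a[p := t]"
  note c = pivotD[OF f pv, folded c_def]
  note cb = cb[folded c_def] and P = P[folded c_def] and eK = eK[folded c_def] and y0 = y0[folded c_def]
  have ij: "i \<in> S" "j \<in> S" "i \<noteq> j" and a: "a \<in> arr (S - {i}) k" and b: "b \<in> arr (S - {j}) k"
    and abq: "\<And>q. q < k \<Longrightarrow> a ! q \<noteq> b ! q"
    using f unfolding far_def by auto
  have ab: "a \<noteq> b" using abq[of 0] k1 by auto
  have fP: "flow (arr (S - {i}) k) a c P" "real_arcs P" using P(1) unfolding sflow_def by auto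
  note dP = flowD[OF fP(1)]
  have ap: "j \<in> set a \<Longrightarrow> a ! p = j" using pv unfolding pivot_def by auto
  have kS: "k * m \<ge> 1" using k1 m2 by simp
  obtain Q where Q: "sflow (S - {j}) k c b Q" "card (Q `` {c}) = k * m"
    using copy_spans[OF ij(2) c(3) b cb kS] by auto
  have fQ: "flow (arr (S - {j}) k) c b Q" "real_arcs Q" using Q(1) unfolding sflow_def by auto
  \<comment> \<open>\<open>Q\<close> has as many paths as \<open>c\<close> has neighbours in the
    copy, so it starts through all of them.\<close>
  have Qn: "Q `` {c} = {y \<in> arr (S - {j}) k. arr_adj c y}"
  proof (rule card_subset_eq)
    show "finite {y \<in> arr (S - {j}) k. arr_adj c y}" using fin by (simp add: finite_arr)
    show "Q `` {c} \<subseteq> {y \<in> arr (S - {j}) k. arr_adj c y}" using fQ(2) flowD(2)[OF fQ(1)] by auto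
    show "card (Q `` {c}) = card {y \<in> arr (S - {j}) k. arr_adj c y}" using Q(2) card_cp_nbrs[OF ij(2) c(3)] by simp
  qed
  have Ik: "q < k" if "q \<in> I" for q using I that by auto
  have cq: "c ! q \<in> set c" if "q < k" for q using that c(8) by simp
  have aq: "a ! q \<in> set a" if "q < k" for q using that c(11) by simp
  have up_set: "set (c[q := s]) = insert s (set c - {c ! q})" if "q < k" for q s
    using that c(8,9) by (simp add: set_update_distinct)
  have uq: "q = q'" if "c[q := s] = c[q' := s]" "q < k" "q' < k" "s \<notin> set c" for q q' s
    using update_inj[of q c q' s s] that c(8) by auto
  have js: "j \<in> set (c[q := j])" "i \<notin> set (c[q := j])" "i \<in> set (c[q := i])" "j \<notin> set (c[q := i])" if "q < k" for q
    using up_set[OF that] c(6,7) ij(3) by auto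
  have cji: "c[q := j] \<in> arr (S - {i}) k" "c[q := i] \<in> arr (S - {j}) k" "arr_adj c (c[q := j])" "arr_adj c (c[q := i])"
    if "q < k" for q
  proof -
    show "c[q := j] \<in> arr (S - {i}) k"
      by (rule arr_update[OF c(1) that]) (use c ij c(1) in \<open>auto simp: arr_def\<close>)
    show "c[q := i] \<in> arr (S - {j}) k"
      by (rule arr_update[OF c(1) that]) (use c ij c(1) in \<open>auto simp: arr_def\<close>)
    show "arr_adj c (c[q := j])" by (rule adj_updateI[OF c(1) that]) (use cq[OF that] c(7) in auto)
    show "arr_adj c (c[q := i])" by (rule adj_updateI[OF c(1) that]) (use cq[OF that] c(6) in auto)
  qed
  have aqj: "a ! q \<notin> set (c[q := j])" if "q < k" "a ! q \<noteq> j" for q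
  proof (cases "q = p")
    case True
    then show ?thesis using up_set[OF that(1)] c(19) that by auto
  next
    case False
    then have "c ! q = a ! q" unfolding c_def by simp
    then show ?thesis using up_set[OF that(1)] that by auto
  qed
  have na: "c[q := j] \<noteq> a" if "q < k" "a ! q \<noteq> j" for q
    using that c(8) by (metis nth_list_update_eq)
  define A where "A = E \<union> (set a - {j})"
  define B where "B = T \<union> e ` I"
  \<comment> \<open>\<open>c[q := j]\<close> moves to copy \<open>a ! q\<close>, whose symbol it
    lacks. For \<open>a ! q = j\<close> there is no such source: then \<open>q = p\<close>, and the
    word is \<open>a\<close> itself, which starts the central path.\<close>
  define Src where "Src = {a ! q # c[q := j] |q. q < k \<and> a ! q \<noteq> j} \<union> {s # a |s. s \<in> E}"
  define Snk where "Snk = {e q # c[q := i] |q. q \<in> I} \<union> {s # b |s. s \<in> T}"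
  have EK: "s \<in> K" "s \<notin> set a" "s \<noteq> i" "s \<noteq> j" "i \<noteq> s" if "s \<in> E" for s using that E K by auto
  have TK: "s \<in> K" "s \<notin> set b" "s \<noteq> i" "s \<noteq> j" "i \<noteq> s" if "s \<in> T" for s using that T K by auto
  have eqK: "e q \<in> K" "e q \<notin> T" "e q \<noteq> i" "e q \<noteq> j" "i \<noteq> e q" "e q \<notin> set (c[q := i])" if "q \<in> I" for q
    using eK[OF that] K up_set[OF Ik[OF that], of i] by auto
  have aqK: "a ! q \<in> K" "a ! q \<noteq> i" "i \<noteq> a ! q" "a ! q \<notin> E" if "q < k" "a ! q \<noteq> j" for q
    using aK aq[OF that(1)] that K E c(13) by auto
  have hSrc: "hd ` Src = A"
  proof -
    have "set a - {j} = (!) a ` {q. q < k \<and> a ! q \<noteq> j}" using c(11) by (auto simp: in_set_conv_nth)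
    moreover have "Src = (\<lambda>q. a ! q # c[q := j]) ` {q. q < k \<and> a ! q \<noteq> j} \<union> (\<lambda>s. s # a) ` E"
      unfolding Src_def by blast
    ultimately show ?thesis unfolding A_def by (simp add: image_Un image_image Un_commute)
  qed
  have hSnk: "hd ` Snk = B"
  proof -
    have "Snk = (\<lambda>q. e q # c[q := i]) ` I \<union> (\<lambda>s. s # b) ` T"
      unfolding Snk_def by blast
    then show ?thesis unfolding B_def by (simp add: image_Un image_image Un_commute)
  qed
  have a_inj: "q = q'" if "a ! q = a ! q'" "q < k" "q' < k" for q q' using that c(11,12) by (metis nth_eq_iff_index_eq)
  have e_inj: "q = q'" if "e q = e q'" "q \<in> I" "q' \<in> I" for q q'
    using inj_onD[OF e] that by auto
  have a_iff: "a ! q = a ! q' \<longleftrightarrow> q = q'" if "q < k" "q' < k" for q q' using a_inj that by blast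
  have e_iff: "e q = e q' \<longleftrightarrow> q = q'" if "q \<in> I" "q' \<in> I" for q q' using e_inj that by blast
  have u_iff: "c[q := s] = c[q' := s] \<longleftrightarrow> q = q'" if "q < k" "q' < k" "s \<notin> set c" for q q' s using uq that by blast
  have aE: "a ! q \<noteq> s" "s \<noteq> a ! q" if "q < k" "a ! q \<noteq> j" "s \<in> E" for q s using aqK(4) that by auto
  have eT: "e q \<noteq> s" "s \<noteq> e q" if "q \<in> I" "s \<in> T" for q s using eqK(2) that by auto
  have iS: "inj_on hd Src"
  proof (rule inj_onI)
    fix x y assume xy: "x \<in> Src" "y \<in> Src" "hd x = hd y"
    consider q where "x = a ! q # c[q := j]" "q < k" "a ! q \<noteq> j" | s where "x = s # a" "s \<in> E"
      using xy(1) unfolding Src_def by blast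
    then show "x = y"
    proof cases
      case (1 q)
      have "hd y \<notin> E" using xy(3) 1(1) aqK(4)[OF 1(2,3)] by simp
      then obtain q' where q': "y = a ! q' # c[q' := j]" "q' < k" using xy(2) unfolding Src_def by auto
      then have "q = q'" using xy(3) 1 a_inj[OF _ 1(2) q'(2)] by simp
      then show ?thesis using 1 q' by simp
    next
      case (2 s)
      then show ?thesis using xy(2,3) aqK(4) unfolding Src_def by auto
    qed
  qed
  have iT: "inj_on hd Snk"
  proof (rule inj_onI)
    fix x y assume xy: "x \<in> Snk" "y \<in> Snk" "hd x = hd y"
    consider q where "x = e q # c[q := i]" "q \<in> I" | s where "x = s # b" "s \<in> T"
      using xy(1) unfolding Snk_def by blast
    then show "x = y"
    proof cases
      case (1 q)
      have "hd y \<notin> T" using xy(3) 1(1) eqK(2)[OF 1(2)] by simp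
      then obtain q' where q': "y = e q' # c[q' := i]" "q' \<in> I" using xy(2) unfolding Snk_def by auto
      then have "q = q'" using xy(3) 1 e_inj[OF _ 1(2) q'(2)] by simp
      then show ?thesis using 1 q' by simp
    next
      case (2 s)
      then show ?thesis using xy(2,3) eqK(2) unfolding Snk_def by auto
    qed
  qed
  have in1: "Src \<subseteq> reg K" "Snk \<subseteq> reg K"
  proof -
    have "c[q := j] \<in> arr (S - {a ! q}) k" if "q < k" "a ! q \<noteq> j" for q
      using arr_other[OF cji(1)[OF that(1)] aqj[OF that]] .
    moreover have "a \<in> arr (S - {s}) k" if "s \<in> E" for s using arr_other[OF a EK(2)[OF that]] .
    ultimately show "Src \<subseteq> reg K" unfolding Src_def using aqK EK by auto
    have "c[q := i] \<in> arr (S - {e q}) k" if "q \<in> I" for q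
      using arr_other[OF cji(2)[OF Ik[OF that]] eqK(6)[OF that]] .
    moreover have "b \<in> arr (S - {s}) k" if "s \<in> T" for s using arr_other[OF b TK(2)[OF that]] .
    ultimately show "Snk \<subseteq> reg K" unfolding Snk_def using eqK TK by auto
  qed
  have dj: "Src \<inter> Snk = {}"
  proof -
    have "c[q := j] \<noteq> c[q' := i]" if "q < k" "q' < k" for q q' using js[OF that(1)] js[OF that(2)] by metis
    moreover have "c[q := j] \<noteq> b" if "q < k" for q using js[OF that] c(16) by metis
    moreover have "a \<noteq> c[q := i]" if "q < k" for q using js[OF that] c(13) by metis
    ultimately show ?thesis using ab Ik unfolding Src_def Snk_def by blast
  qed
  have "\<exists>R. pflow (reg K) {} {} Src Snk R \<and> real_arcs R"
  proof (rule routing)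
    show "card Src = card Snk" using crd card_image[OF iS] card_image[OF iT] unfolding hSrc hSnk A_def B_def by simp
    show "hd ` Src \<noteq> hd ` Snk \<or> hd ` Src = K" using ne unfolding hSrc hSnk A_def B_def .
  qed (use K in1 iS iT dj in auto)
  then obtain R where R: "pflow (reg K) {} {} Src Snk R" "real_arcs R" by blast
  \<comment> \<open>The neighbours of the centre that lie in both copies; one arc joins each to its
    mirror image without using another copy.\<close>
  define N where "N = {d \<in> arr (S - {i, j}) k. arr_adj c d}"
  define M where "M = {(i # d, j # d) |d. d \<in> N} \<union> {(i # c[q := j], a ! q # c[q := j]) |q. q < k \<and> a ! q \<noteq> j}
    \<union> {(i # a, s # a) |s. s \<in> E} \<union> {(e q # c[q := i], j # c[q := i]) |q. q \<in> I} \<union> {(s # b, j # b) |s. s \<in> T}"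
  have Nij: "i \<notin> set d" "j \<notin> set d" "d \<in> arr (S - {i}) k" "d \<in> arr (S - {j}) k" "arr_adj c d" "arr_adj d c" if "d \<in> N" for d
    using that adj_sym unfolding N_def arr_def by auto
  have Xcase: "x \<in> N \<or> (\<exists>q<k. x = c[q := j])" if x: "x \<in> arr (S - {i}) k" "arr_adj x c" for x
  proof -
    have "arr_adj c x" using x(2) adj_sym by blast
    then obtain q s where q: "q < k" "s \<in> S - {i}" "s \<notin> set c" "x = c[q := s]"
      using nbr_E[OF c(2) x(1)] by metis
    show ?thesis
    proof (cases "s = j")
      case False
      then have "j \<notin> set x" using q up_set[OF q(1)] c(7) by auto
      then have "x \<in> N" using x \<open>arr_adj c x\<close> unfolding N_def arr_def by auto
      then show ?thesis ..
    qed (use q in auto)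
  qed
  have Ycase: "y \<in> N \<or> (\<exists>q<k. y = c[q := i])" if y: "y \<in> arr (S - {j}) k" "arr_adj c y" for y
  proof -
    obtain q s where q: "q < k" "s \<in> S - {j}" "s \<notin> set c" "y = c[q := s]"
      using nbr_E[OF c(3) y] by metis
    show ?thesis
    proof (cases "s = i")
      case False
      then have "i \<notin> set y" using q up_set[OF q(1)] c(6) by auto
      then have "y \<in> N" using y unfolding N_def arr_def by auto
      then show ?thesis ..
    qed (use q in auto)
  qed
  have M_i: "(i # x, z) \<in> M \<longleftrightarrow> (x \<in> N \<and> z = j # x) \<or> (\<exists>q<k. a ! q \<noteq> j \<and> x = c[q := j] \<and> z = a ! q # x) \<or>
      (x = a \<and> (\<exists>s\<in>E. z = s # a))" for x z
    unfolding M_def using eqK(3) TK(3) by auto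
  have M_j: "(z, j # y) \<in> M \<longleftrightarrow> (y \<in> N \<and> z = i # y) \<or> (\<exists>q\<in>I. y = c[q := i] \<and> z = e q # y) \<or>
      (y = b \<and> (\<exists>s\<in>T. z = s # b))" for y z
    unfolding M_def using EK(4) by auto
  have M_k: "(z, s # x) \<in> M \<longleftrightarrow> (\<exists>q<k. a ! q \<noteq> j \<and> s = a ! q \<and> x = c[q := j] \<and> z = i # x) \<or>
      (s \<in> E \<and> x = a \<and> z = i # a)" if "s \<noteq> j" for z s x
    unfolding M_def using that by auto
  have joined: "\<exists>F. flow (reg ({i, j} \<union> K)) (i # a) (j # b) F \<and> real_arcs F \<and>
    F `` {i # a} = (#) i ` (P `` {a} - (if a = a then {} else {c})) \<union> M `` {i # a} \<and>
    (\<forall>x y. (x, y) \<in> P \<longrightarrow> y \<noteq> c \<longrightarrow> (i # x, i # y) \<in> F)"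
  proof (rule join_copies[OF ij P(1) _ Q(1) _ K R in1])
    show "a \<in> P\<inverse> `` {c}" unfolding P(2) using a c(4) by simp
    show "y0 \<in> Q `` {c}" unfolding Qn using y0 by simp
    show "Domain M \<subseteq> insert (i # a) ((#) i ` (P\<inverse> `` {c} - {a}) \<union> Snk)"
    proof
      fix x assume "x \<in> Domain M"
      then consider d where "x = i # d" "d \<in> N" | q where "x = i # c[q := j]" "q < k" | "x = i # a" | "x \<in> Snk"
        unfolding M_def Snk_def by auto
      then show "x \<in> insert (i # a) ((#) i ` (P\<inverse> `` {c} - {a}) \<union> Snk)"
      proof cases
        case (1 d)
        then show ?thesis unfolding P(2) using Nij[OF 1(2)] by auto
      next
        case (2 q)
        then show ?thesis unfolding P(2) using cji[OF 2(2)] adj_sym by auto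
      qed auto
    qed
    show "Range M \<subseteq> insert (j # b) ((#) j ` (Q `` {c} - {y0}) \<union> Src)"
    proof
      fix y assume "y \<in> Range M"
      then consider d where "y = j # d" "d \<in> N" | q where "y = j # c[q := i]" "q \<in> I" | "y = j # b" | "y \<in> Src"
        unfolding M_def Src_def by auto
      then show "y \<in> insert (j # b) ((#) j ` (Q `` {c} - {y0}) \<union> Src)"
      proof cases
        case (1 d)
        then show ?thesis unfolding Qn using Nij[OF 1(2)] y0(4) by auto
      next
        case (2 q)
        have "c[q := i] \<noteq> y0" using y0(3)[OF Ik[OF 2(2)]] 2(2) by simp
        then show ?thesis unfolding Qn using cji[OF Ik[OF 2(2)]] 2 by auto
      qed auto
    qed
    show "hd y = j" if "(x, y) \<in> M" "x \<in> Snk" for x y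
    proof -
      have "hd x \<noteq> i" using hd_reg[of x K] in1(2) that(2) K by auto
      then show ?thesis using that(1) unfolding M_def by auto
    qed
    show "\<exists>!y. (i # x, y) \<in> M" if x: "x \<in> P\<inverse> `` {c}" "x \<noteq> a" for x
    proof -
      have xa: "x \<in> arr (S - {i}) k" "arr_adj x c" using x(1) unfolding P(2) by auto
      from Xcase[OF xa] show ?thesis
      proof
        assume "x \<in> N"
        then have "(i # x, z) \<in> M \<longleftrightarrow> z = j # x" for z unfolding M_i using x(2) Nij[of x] js by auto
        then show ?thesis by simp
      next
        assume "\<exists>q<k. x = c[q := j]"
        then obtain q where q: "q < k" "x = c[q := j]" by auto
        have "a ! q \<noteq> j"
        proof
          assume "a ! q = j"
          then have "q = p" using ap aq[OF q(1)] a_inj[of q p] q(1) c(20) by auto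
          then have "x = a" using q(2) \<open>a ! q = j\<close> unfolding c_def by auto
          then show False using x(2) by simp
        qed
        then have "(i # x, z) \<in> M \<longleftrightarrow> z = a ! q # x" for z
          unfolding M_i using x(2) Nij(2)[of x] js(1)[OF q(1)] q c(7) by (auto simp: u_iff)
        then show ?thesis by simp
      qed
    qed
    show "\<exists>!y. (x, y) \<in> M" if x: "x \<in> Snk" for x
    proof -
      consider q where "x = e q # c[q := i]" "q \<in> I" | s where "x = s # b" "s \<in> T"
        using x unfolding Snk_def by auto
      then show ?thesis
      proof cases
        case (1 q)
        then have "(x, z) \<in> M \<longleftrightarrow> z = j # c[q := i]" for z
          unfolding M_def using eqK(1-5)[OF 1(2)] 1 by (auto simp: e_iff eT)
        then show ?thesis by simp
      next
        case (2 s)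
        then have "(x, z) \<in> M \<longleftrightarrow> z = j # b" for z
          unfolding M_def using TK[OF 2(2)] 2 by (auto simp: eT)
        then show ?thesis by simp
      qed
    qed
    show "\<exists>!x. (x, j # y) \<in> M" if y: "y \<in> Q `` {c}" "y \<noteq> y0" "y \<noteq> b" for y
    proof -
      have ya: "y \<in> arr (S - {j}) k" "arr_adj c y" using y(1) unfolding Qn by auto
      from Ycase[OF ya] show ?thesis
      proof
        assume "y \<in> N"
        then have "(z, j # y) \<in> M \<longleftrightarrow> z = i # y" for z unfolding M_j using y(3) Nij[of y] js Ik by auto
        then show ?thesis by simp
      next
        assume "\<exists>q<k. y = c[q := i]"
        then obtain q where q: "q < k" "y = c[q := i]" by auto
        then have "q \<in> I" using y(2) y0(3) by auto
        then have "(z, j # y) \<in> M \<longleftrightarrow> z = e q # y" for z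
          unfolding M_j using y(3) Nij(1)[of y] js(3)[OF q(1)] q c(6) Ik by (auto simp: u_iff)
        then show ?thesis by simp
      qed
    qed
    show "\<exists>!x. (x, y) \<in> M" if y: "y \<in> Src" for y
    proof -
      consider q where "y = a ! q # c[q := j]" "q < k" "a ! q \<noteq> j" | s where "y = s # a" "s \<in> E"
        using y unfolding Src_def by auto
      then show ?thesis
      proof cases
        case (1 q)
        have "(z, y) \<in> M \<longleftrightarrow> z = i # c[q := j]" for z
          unfolding 1(1) M_k[OF 1(3)] using aqK(4)[OF 1(2,3)] a_inj[OF _ 1(2)] 1(2,3) by blast
        then show ?thesis by simp
      next
        case (2 s)
        have "(z, y) \<in> M \<longleftrightarrow> z = i # a" for z
          unfolding 2(1) M_k[OF EK(4)[OF 2(2)]] using aE 2(2) by blast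
        then show ?thesis by simp
      qed
    qed
    have "arr_adj x y" if "(x, y) \<in> M" for x y
    proof -
      from that consider d where "x = i # d" "y = j # d" | q where "x = i # c[q := j]" "y = a ! q # c[q := j]" "q < k" "a ! q \<noteq> j"
        | s where "x = i # a" "y = s # a" "s \<in> E" | q where "x = e q # c[q := i]" "y = j # c[q := i]" "q \<in> I"
        | s where "x = s # b" "y = j # b" "s \<in> T"
        unfolding M_def by blast
      then show ?thesis
      proof cases
        case (2 q)
        then show ?thesis using aqK(3)[of q] by simp
      next
        case (3 s)
        then show ?thesis using EK(5)[of s] by simp
      next
        case (4 q)
        then show ?thesis using eqK(4)[of q] by simp
      next
        case (5 s)
        then show ?thesis using TK(4)[of s] by simp
      qed (use ij(3) in simp)
    qed
    then show "real_arcs M" by blast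
  qed
  then obtain F where F: "flow (reg ({i, j} \<union> K)) (i # a) (j # b) F" "real_arcs F"
    "F `` {i # a} = (#) i ` (P `` {a}) \<union> M `` {i # a}"
    "\<forall>x y. (x, y) \<in> P \<longrightarrow> y \<noteq> c \<longrightarrow> (i # x, i # y) \<in> F" by auto
  have Pl: "card (P `` {a}) = k * m"
  proof -
    have "{x \<in> arr (S - {i}) k. arr_adj x c} = {x \<in> arr (S - {i}) k. arr_adj c x}" using adj_sym by auto
    then show ?thesis using flow_card_out_in[OF fP(1)] P(2) card_cp_nbrs[OF ij(1) c(2)] by simp
  qed
  have fPa: "finite (P `` {a})" by (rule finite_subset[OF _ dP(1)]) (use dP(2) in auto)
  have fE: "finite E" using E K fin by (meson Diff_subset finite_Diff finite_subset)
  \<comment> \<open>\<open>a\<close> is itself a neighbour of the centre, so \<open>i # a\<close>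
    has a link to \<open>j # a\<close> unless \<open>a\<close> contains \<open>j\<close>. This is
    the additional one in the count.\<close>
  have "a \<in> N \<longleftrightarrow> j \<notin> set a" using a c(5) unfolding N_def arr_def by auto
  moreover have "(i # a, z) \<in> M \<longleftrightarrow> (a \<in> N \<and> z = j # a) \<or> (\<exists>s\<in>E. z = s # a)" for z
    unfolding M_i using na by blast
  ultimately have Ma: "M `` {i # a} = (\<lambda>s. s # a) ` E \<union> (if j \<in> set a then {} else {j # a})"
    by auto
  have "card (M `` {i # a}) = card E + (if j \<in> set a then 0 else 1)"
  proof -
    have "card ((\<lambda>s. s # a) ` E) = card E" by (rule card_image) (auto simp: inj_on_def)
    moreover have "j # a \<notin> (\<lambda>s. s # a) ` E" using EK(4) by auto
    ultimately show ?thesis unfolding Ma using fE by simp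
  qed
  moreover have "(#) i ` (P `` {a}) \<inter> M `` {i # a} = {}" unfolding Ma using EK(3) ij(3) by auto
  moreover have "finite (M `` {i # a})" unfolding Ma using fE by simp
  ultimately have "card (F `` {i # a}) = k * m + card E + (if j \<in> set a then 0 else 1)"
    unfolding F(3) using fPa Pl by (subst card_Un_disjoint) (auto simp: card_image)
  then show ?thesis using F(1,2,4) unfolding c_def by blast
qed

text \<open>The central path continues in copy \<open>j\<close> through \<open>c[qs := i]\<close>,
  the one word for which no copy has to be assigned.\<close>

lemma far_join_special:
  assumes f: "far i j a b" and pv: "pivot i j a p t" and cb: "a[p := t] \<noteq> b"
    and P: "sflow (S - {i}) k a (a[p := t]) P"
      "P\<inverse> `` {a[p := t]} = {x \<in> arr (S - {i}) k. arr_adj x (a[p := t])}"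
    and K: "K \<subseteq> S - {i, j}" and E: "E \<subseteq> K - set a" and aK: "set a - {j} \<subseteq> K"
    and T: "T \<subseteq> K - set b" and qs: "qs < k" and e: "inj_on e ({..<k} - {qs})"
    and eK: "\<And>q. q < k \<Longrightarrow> q \<noteq> qs \<Longrightarrow> e q \<in> K - T \<and> e q \<notin> set (a[p := t]) - {a[p := t] ! q}"
    and crd: "card (E \<union> (set a - {j})) = card (T \<union> e ` ({..<k} - {qs}))"
    and ne: "E \<union> (set a - {j}) \<noteq> T \<union> e ` ({..<k} - {qs}) \<or> E \<union> (set a - {j}) = K"
  shows "\<exists>F. flow (reg ({i, j} \<union> K)) (i # a) (j # b) F \<and> real_arcs F \<and>
    card (F `` {i # a}) = k * m + card E + (if j \<in> set a then 0 else 1) \<and>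
    (\<forall>x y. (x, y) \<in> P \<longrightarrow> y \<noteq> a[p := t] \<longrightarrow> (i # x, i # y) \<in> F)"
proof (rule far_join[OF f pv cb P K E aK T _ e])
  note c = pivotD[OF f pv]
  let ?c = "a[p := t]"
  have ij: "i \<in> S" "i \<noteq> j" using f unfolding far_def by auto
  have q: "?c ! qs \<in> set ?c" using qs c(8) by simp
  show "?c[qs := i] \<in> arr (S - {j}) k"
    by (rule arr_update[OF c(1) qs]) (use c ij c(1) in \<open>auto simp: arr_def\<close>)
  show "arr_adj ?c (?c[qs := i])" by (rule adj_updateI[OF c(1) qs]) (use q c(6) in auto)
  show "i \<notin> set (?c[qs := i]) \<Longrightarrow> ?c[qs := i] = b"
    using set_update_distinct[of ?c qs i] c(8,9) qs by simp
  show "q \<in> {..<k} - {qs} \<longleftrightarrow> ?c[q := i] \<noteq> ?c[qs := i]" if "q < k" for q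
    using update_inj(1)[of q ?c qs i i] that qs c(6,8) by auto
qed (use eK crd ne in auto)

text \<open>When \<open>j\<close> occurs in \<open>a\<close>, its position is forced. Otherwise
  position 0 is taken and \<open>m - 1\<close> symbols are available, at least two of them for
  \<open>m \<ge> 3\<close>, so that \<open>b ! 0\<close> can be avoided.\<close>

lemma pivot_ex:
  assumes "far i j a b"
  shows "\<exists>p t. pivot i j a p t \<and> (j \<notin> set a \<and> m \<ge> 3 \<longrightarrow> t \<noteq> b ! p)"
proof -
  have ij: "i \<in> S" "j \<in> S" "i \<noteq> j" and a: "a \<in> arr (S - {i}) k" using assms unfolding far_def by auto
  have la: "length a = k" using a unfolding arr_def by simp
  show ?thesis
  proof (cases "j \<in> set a")
    case True
    then obtain p where p: "p < k" "a ! p = j" using la by (metis in_set_conv_nth)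
    have "card (S - {i} - set a) \<noteq> 0" using card_free[OF ij(1) a] m2 by simp
    then have "S - {i} - set a \<noteq> {}" by (metis card.empty)
    then obtain t where "t \<in> S - {i} - set a" by blast
    then show ?thesis using p True unfolding pivot_def by (intro exI[of _ p] exI[of _ t]) auto
  next
    case False
    then have "a \<in> arr (S - {i, j}) k" using a unfolding arr_def by auto
    then have cE: "card (S - {i, j} - set a) = m - 1" using card_rest(2)[OF ij] by simp
    have "\<exists>t\<in>S - {i, j} - set a. m \<ge> 3 \<longrightarrow> t \<noteq> b ! 0"
    proof (rule ccontr)
      assume n: "\<not> ?thesis"
      have "S - {i, j} - set a \<noteq> {}" using cE m2 by (metis card.empty diff_is_0_eq not_less_eq_eq numeral_2_eq_2 One_nat_def)
      then have "m \<ge> 3" "S - {i, j} - set a \<subseteq> {b ! 0}" using n by auto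
      then show False using cE card_mono[of "{b ! 0}" "S - {i, j} - set a"] by simp
    qed
    then obtain t where "t \<in> S - {i, j} - set a" "m \<ge> 3 \<longrightarrow> t \<noteq> b ! 0" by blast
    then show ?thesis using False k1 unfolding pivot_def by (intro exI[of _ 0] exI[of _ t]) auto
  qed
qed

text \<open>Either a second position of the new word still carries the symbol of \<open>a\<close>,
  hence not that of \<open>b\<close>; or \<open>i\<close> tells the words apart, since the centre
  never contains it.\<close>

lemma pivot_ne:
  assumes "far i j a b" "pivot i j a p t" "k \<ge> 2 \<or> i \<in> set b"
  shows "a[p := t] \<noteq> b"
proof (cases "i \<in> set b")
  case True
  then show ?thesis using pivotD(6)[OF assms(1,2)] by auto
next
  case False
  then obtain q where q: "q < k" "q \<noteq> p" using assms(3) by (cases "p = 0") (auto intro: that[of 0] that[of 1])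
  then have "a[p := t] ! q = a ! q" by simp
  then show ?thesis using q assms(1) unfolding far_def by metis
qed

text \<open>\<open>Th\<close> reserves \<open>m\<close> copies from which the \<open>r\<close>
  direct entrances of \<open>j # b\<close> are chosen later; \<open>m\<close> is exactly the number
  that the assignment \<open>e\<close> allows. \<open>choice\<close> selects \<open>T\<close> only
  after the copies \<open>C\<close> used by \<open>e\<close> are known, so that sources and sinks
  occupy different sets of copies; for \<open>r = m\<close> both fill all \<open>k + m - 1\<close>
  copies instead. The size of \<open>E\<close> accounts for the path through \<open>j # a\<close>,
  present when \<open>j\<close> is not in \<open>a\<close>.\<close>

lemma far_join_all_copies:
  assumes f: "far i j a b" and pv: "pivot i j a p t" and cb: "a[p := t] \<noteq> b" and r: "1 \<le> r" "r \<le> m"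
    and Th: "Th \<subseteq> S - {i, j}" "card Th = m"
    and E: "E \<subseteq> S - {i, j} - set a" "card E = (if j \<in> set a then r else r - 1)"
    and choice: "\<And>C. C \<subseteq> S - {i, j} - Th \<Longrightarrow> card C = k - 1 \<Longrightarrow>
      \<exists>T\<subseteq>Th - set b. card T = r \<and> (r = m \<or> E \<union> (set a - {j}) \<noteq> T \<union> C)"
  shows "\<exists>F. sflow S (Suc k) (i # a) (j # b) F \<and> card (F `` {i # a}) = k * m + r"
proof -
  define c where "c = a[p := t]"
  note c = pivotD[OF f pv, folded c_def]
  have ij: "i \<in> S" "j \<in> S" "i \<noteq> j" and a: "a \<in> arr (S - {i}) k" using f unfolding far_def by auto
  obtain P where P: "sflow (S - {i}) k a c P" "P\<inverse> `` {c} = {x \<in> arr (S - {i}) k. arr_adj x c}"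
    using nbr_set[OF ij(1) a c(2,4)] by blast
  define K where "K = S - {i, j}"
  have cK: "card K = k + m - 1" "finite K" using card_rest(1)[OF ij] fin unfolding K_def by auto
  have ccK: "set c \<subseteq> K" using c(1) unfolding arr_def K_def by auto
  have D: "finite (K - set c)" "(K - set c) \<inter> set c = {}" "card (K - set c) = m - 1"
    using card_rest(2)[OF ij c(1)] cK unfolding K_def by auto
  have "Th \<subseteq> K - set c \<union> set c" "card Th \<le> Suc (card (K - set c))" using Th D(3) unfolding K_def by auto
  then obtain qs e where e: "qs < k" "inj_on e ({..<k} - {qs})"
    "\<forall>q. q < k \<longrightarrow> q \<noteq> qs \<longrightarrow> e q \<in> insert (c ! q) (K - set c) - Th"
    by (rule assign_specials[OF c(9,8) k1 D(1,2)])
  define C where "C = e ` ({..<k} - {qs})"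
  have cC: "card C = k - 1" unfolding C_def using card_image[OF e(2)] e(1) by simp
  have eK: "e q \<in> K - Th \<and> e q \<notin> set c - {c ! q}" if "q < k" "q \<noteq> qs" for q
    using e(3)[rule_format, OF that] ccK c(8) that by auto
  then have CS: "C \<subseteq> S - {i, j} - Th" unfolding C_def K_def by auto
  obtain T where T: "T \<subseteq> Th - set b" "card T = r" "r = m \<or> E \<union> (set a - {j}) \<noteq> T \<union> C"
    using choice[OF CS cC] by blast
  have fS: "finite T" "finite E" "finite C"
    using T(1) Th(1) E(1) fin unfolding C_def by (auto intro: finite_subset[of _ S])
  have "card (set a - {j}) = (if j \<in> set a then k - 1 else k)" using c(11,12) by (simp add: distinct_card)
  then have cA: "card (E \<union> (set a - {j})) = r + k - 1"
    using E fS r(1) k1 by (subst card_Un_disjoint) auto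
  have cB: "card (T \<union> C) = r + k - 1"
    using T CS cC fS k1 by (subst card_Un_disjoint) auto
  have AK: "E \<union> (set a - {j}) \<subseteq> K" using E(1) c(13,17) unfolding K_def by auto
  have "\<exists>F. flow (reg ({i, j} \<union> K)) (i # a) (j # b) F \<and> real_arcs F \<and>
    card (F `` {i # a}) = k * m + card E + (if j \<in> set a then 0 else 1) \<and>
    (\<forall>x y. (x, y) \<in> P \<longrightarrow> y \<noteq> a[p := t] \<longrightarrow> (i # x, i # y) \<in> F)"
  proof (rule far_join_special[OF f pv cb P[unfolded c_def]])
    show "E \<union> (set a - {j}) \<noteq> T \<union> e ` ({..<k} - {qs}) \<or> E \<union> (set a - {j}) = K"
    proof (cases "r = m")
      case True
      then have "card (E \<union> (set a - {j})) = card K" using cA cK m2 k1 by simp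
      then show ?thesis using card_subset_eq[OF cK(2) AK] by simp
    next
      case False
      then show ?thesis using T(3) unfolding C_def by auto
    qed
    show "card (E \<union> (set a - {j})) = card (T \<union> e ` ({..<k} - {qs}))" using cA cB unfolding C_def by simp
    show "e q \<in> K - T \<and> e q \<notin> set (a[p := t]) - {a[p := t] ! q}" if "q < k" "q \<noteq> qs" for q
      using eK[OF that] T(1) unfolding c_def by auto
  qed (use E(1) AK T(1) Th(1) e(1,2) in \<open>auto simp: K_def\<close>)
  then obtain F where F: "flow (reg ({i, j} \<union> K)) (i # a) (j # b) F" "real_arcs F"
    "card (F `` {i # a}) = k * m + card E + (if j \<in> set a then 0 else 1)" by blast
  have "{i, j} \<union> K = S" using ij unfolding K_def by auto
  then have "sflow S (Suc k) (i # a) (j # b) F" using F reg_S unfolding sflow_def by simp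
  moreover have "card (F `` {i # a}) = k * m + r" using F(3) E(2) r(1) by simp
  ultimately show ?thesis by blast
qed

lemma card_outer:
  assumes "far i j a b"
  shows "card (S - {i, j} - set a) = (if j \<in> set a then m else m - 1)"
    "card (S - {i, j} - set b) = (if i \<in> set b then m else m - 1)"
proof -
  have ij: "i \<in> S" "j \<in> S" "i \<noteq> j" and a: "a \<in> arr (S - {i}) k" and b: "b \<in> arr (S - {j}) k"
    using assms unfolding far_def by auto
  show "card (S - {i, j} - set a) = (if j \<in> set a then m else m - 1)"
  proof (cases "j \<in> set a")
    case True
    then have "S - {i, j} - set a = S - {i} - set a" by auto
    then show ?thesis using card_free[OF ij(1) a] True by simp
  next
    case False
    then have "a \<in> arr (S - {i, j}) k" using a unfolding arr_def by auto
    then show ?thesis using card_rest(2)[OF ij] False by simp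
  qed
  show "card (S - {i, j} - set b) = (if i \<in> set b then m else m - 1)"
  proof (cases "i \<in> set b")
    case True
    then have "S - {i, j} - set b = S - {j} - set b" by auto
    then show ?thesis using card_free[OF ij(2) b] True by simp
  next
    case False
    then have "b \<in> arr (S - {i, j}) k" using b unfolding arr_def by auto
    then show ?thesis using card_rest(2)[OF ij] False by simp
  qed
qed

text \<open>When \<open>i\<close> occurs in \<open>b\<close>, there are \<open>m\<close> symbols
  outside \<open>b\<close>, \<open>i\<close> and \<open>j\<close>, and all of them are
  reserved.\<close>

lemma far_spans_high_meeting:
  assumes f: "far i j a b" and ib: "i \<in> set b" and r: "1 \<le> r" "r \<le> m"
  shows "\<exists>F. sflow S (Suc k) (i # a) (j # b) F \<and> card (F `` {i # a}) = k * m + r"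
proof -
  define Th where "Th = S - {i, j} - set b"
  have Th: "card Th = m" "finite Th" using card_outer[OF f] ib fin unfolding Th_def by auto
  obtain E where E: "E \<subseteq> S - {i, j} - set a" "card E = (if j \<in> set a then r else r - 1)"
  proof (rule obtain_subset_with_card_n)
    show "(if j \<in> set a then r else r - 1) \<le> card (S - {i, j} - set a)"
      using card_outer(1)[OF f] r by auto
  qed (use that in auto)
  obtain p t where pv: "pivot i j a p t" using pivot_ex[OF f] by blast
  have cb: "a[p := t] \<noteq> b" using pivot_ne[OF f pv] ib by blast
  show ?thesis
  proof (rule far_join_all_copies[OF f pv cb r _ Th(1) E])
    show "\<exists>T\<subseteq>Th - set b. card T = r \<and> (r = m \<or> E \<union> (set a - {j}) \<noteq> T \<union> C)"
      if C: "C \<subseteq> S - {i, j} - Th" for C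
    proof -
      obtain T1 where T1: "T1 \<subseteq> Th" "card T1 = r" using r Th by (metis obtain_subset_with_card_n)
      have Tb: "Th - set b = Th" unfolding Th_def by auto
      show ?thesis
      proof (cases "r = m \<or> E \<union> (set a - {j}) \<noteq> T1 \<union> C")
        case True
        then show ?thesis using T1 Tb by auto
      next
        case False
        then have A: "E \<union> (set a - {j}) = T1 \<union> C" "r < m" using r by auto
        obtain x where x: "x \<in> T1" using T1(2) r(1) by fastforce
        have "\<not> Th \<subseteq> T1" using T1 Th A(2) by (metis card_mono finite_subset not_less)
        then obtain y where y: "y \<in> Th" "y \<notin> T1" by auto
        \<comment> \<open>Exchanging one element of \<open>T1\<close> destroys an unwanted equality:
          \<open>x\<close> is still among the source copies but no longer among the sink copies,
          because \<open>C\<close> avoids \<open>Th\<close>.\<close>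
        define T2 where "T2 = insert y (T1 - {x})"
        have fT: "finite T1" using T1(1) Th(2) finite_subset by blast
        have "card T2 = r" unfolding T2_def using fT x y T1(2) r(1) by simp
        moreover have "T2 \<subseteq> Th" unfolding T2_def using T1 y by auto
        moreover have "x \<notin> T2 \<union> C" unfolding T2_def using x y C T1(1) by auto
        then have "E \<union> (set a - {j}) \<noteq> T2 \<union> C" using A(1) x by auto
        ultimately show ?thesis using Tb by auto
      qed
    qed
  qed (use ib in \<open>auto simp: Th_def\<close>)
qed

text \<open>Only \<open>m - 1\<close> symbols lie outside \<open>b\<close>, \<open>i\<close> and
  \<open>j\<close>, so \<open>b ! 0\<close> is reserved as well to reach \<open>m\<close>. Neither
  \<open>T\<close> nor \<open>C\<close> contains \<open>b ! 0\<close>, so placing it in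
  \<open>E\<close> makes the source copies differ from the sink copies. For \<open>r = 1\<close>,
  where \<open>E\<close> is empty, a symbol of \<open>C\<close> does this, since \<open>C\<close>
  consists of symbols of \<open>b\<close> and these do not occur in \<open>a\<close>.\<close>

lemma far_spans_high_disjoint:
  assumes f: "far i j a b" and dis: "i \<notin> set b" "j \<notin> set a" "set a \<inter> set b = {}" and pv: "pivot i j a p t" and cb: "a[p := t] \<noteq> b"
    and r: "1 \<le> r" "r < m"
  shows "\<exists>F. sflow S (Suc k) (i # a) (j # b) F \<and> card (F `` {i # a}) = k * m + r"
proof -
  have b: "length b = k" "set b \<subseteq> S - {j}" using f unfolding far_def arr_def by auto
  have b0: "b ! 0 \<in> set b" using b(1) k1 by simp
  define Ev where "Ev = S - {i, j} - set b"
  have Ev: "card Ev = m - 1" "finite Ev" using card_outer(2)[OF f] dis fin unfolding Ev_def by auto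
  define Th where "Th = insert (b ! 0) Ev"
  have Th: "card Th = m" using Ev b0 r unfolding Th_def Ev_def by simp
  have b0S: "b ! 0 \<in> S - {i, j} - set a" using b b0 dis by auto
  obtain E where E: "E \<subseteq> S - {i, j} - set a" "card E = r - 1" "r \<ge> 2 \<longrightarrow> b ! 0 \<in> E"
  proof (cases "r = 1")
    case True
    then show ?thesis using that[of "{}"] by simp
  next
    case False
    have "card (S - {i, j} - set a - {b ! 0}) = m - 2"
      using card_outer(1)[OF f] dis b0S fin by simp
    then obtain E0 where E0: "E0 \<subseteq> S - {i, j} - set a - {b ! 0}" "card E0 = r - 2"
      using r by (metis diff_le_mono less_imp_le obtain_subset_with_card_n)
    have "finite E0" using E0(1) fin finite_subset by (metis finite_Diff)
    then have "card (insert (b ! 0) E0) = r - 1" using E0 False r by (subst card_insert_disjoint) auto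
    then show ?thesis using that[of "insert (b ! 0) E0"] E0(1) b0S by auto
  qed
  show ?thesis
  proof (rule far_join_all_copies[OF f pv cb _ _ _ Th E(1)])
    show "\<exists>T\<subseteq>Th - set b. card T = r \<and> (r = m \<or> E \<union> (set a - {j}) \<noteq> T \<union> C)"
      if C: "C \<subseteq> S - {i, j} - Th" "card C = k - 1" for C
    proof -
      have "r \<le> card Ev" using Ev r by simp
      have bC: "b ! 0 \<notin> T \<union> C" if "T \<subseteq> Ev" for T using that C(1) b0 unfolding Th_def Ev_def by auto
      have "\<exists>T\<subseteq>Ev. card T = r \<and> E \<union> (set a - {j}) \<noteq> T \<union> C"
      proof (cases "r = 1")
        case False
        then have "b ! 0 \<in> E" using E(3) r by simp
        then show ?thesis using \<open>r \<le> card Ev\<close> bC by (metis UnCI obtain_subset_with_card_n)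
      next
        case True
        then have "E = {}" using E(1,2) fin by (metis card_0_eq diff_self_eq_0 finite_Diff finite_subset)
        have "set b \<noteq> {}" "set a \<noteq> {}" using b0 f k1 unfolding far_def arr_def by auto
        show ?thesis
        proof (cases "C = {}")
          case False
          then obtain y where y: "y \<in> C" by auto
          then have "y \<in> set b" using C(1) unfolding Th_def Ev_def by auto
          then have "y \<notin> set a" using dis by auto
          moreover obtain T where "T \<subseteq> Ev" "card T = r" using \<open>r \<le> card Ev\<close> by (metis obtain_subset_with_card_n)
          ultimately show ?thesis using y \<open>E = {}\<close> by (intro exI[of _ T]) auto
        next
          \<comment> \<open>No assigned copy exists, and \<open>T\<close> is a single symbol. As
            \<open>k = 1\<close> forces \<open>m \<ge> 3\<close>, it can be chosen outside
            \<open>a\<close>.\<close>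
          case CE: True
          then have "k = 1" using C(2) k1 by simp
          then have "card (set a) \<le> 1" using f card_length[of a] unfolding far_def arr_def by simp
          moreover have "card Ev \<ge> 2" using Ev \<open>k = 1\<close> room by simp
          ultimately have "\<not> Ev \<subseteq> set a" using card_mono[of "set a" Ev] by auto
          then obtain y where "y \<in> Ev" "y \<notin> set a" by auto
          then show ?thesis using \<open>E = {}\<close> CE True by (intro exI[of _ "{y}"]) auto
        qed
      qed
      then obtain T where T: "T \<subseteq> Ev" "card T = r" "E \<union> (set a - {j}) \<noteq> T \<union> C" by blast
      then show ?thesis using T unfolding Th_def Ev_def by auto
    qed
  qed (use dis r b0S E(2) in \<open>auto simp: Th_def Ev_def\<close>)
qed

text \<open>
  Here \<open>j # b\<close> must also be entered from \<open>i # b\<close>, which lies on a path of the container in copy \<open>i\<close>. That path is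
  cut after \<open>i # b\<close>, and its tail is reached from \<open>i # a\<close> through a copy \<open>u\<close> left free for this purpose.
\<close>

lemma far_spans_max_disjoint:
  assumes f: "far i j a b" and dis: "i \<notin> set b" "j \<notin> set a" "set a \<inter> set b = {}" and k2: "k \<ge> 2" and m3: "m \<ge> 3"
  shows "\<exists>F. sflow S (Suc k) (i # a) (j # b) F \<and> card (F `` {i # a}) = k * m + m"
proof -
  obtain p t where pv: "pivot i j a p t" and tb: "t \<noteq> b ! p" using pivot_ex[OF f] dis m3 by blast
  have cb: "a[p := t] \<noteq> b" using pivot_ne[OF f pv] k2 by blast
  define c where "c = a[p := t]"
  note c = pivotD[OF f pv, folded c_def]
  have ij: "i \<in> S" "j \<in> S" "i \<noteq> j" and a: "a \<in> arr (S - {i}) k" and b: "b \<in> arr (S - {j}) k"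
    and abq: "\<And>q. q < k \<Longrightarrow> a ! q \<noteq> b ! q"
    using f unfolding far_def by auto
  have ab: "a \<noteq> b" using abq[of 0] k1 by auto
  obtain P where P: "sflow (S - {i}) k a c P" "P\<inverse> `` {c} = {x \<in> arr (S - {i}) k. arr_adj x c}"
    using nbr_set[OF ij(1) a c(2,4)] by blast
  have fP: "flow (arr (S - {i}) k) a c P" "real_arcs P" using P(1) unfolding sflow_def by auto
  have bi: "b \<in> arr (S - {i}) k" using arr_other[OF b dis(1)] .
  obtain d where d: "(b, d) \<in> P" using flowD(9)[OF fP(1) bi] ab cb unfolding c_def by blast
  have dV: "d \<in> arr (S - {i}) k" "arr_adj b d" using d fP(2) flowD(2)[OF fP(1)] by auto
  obtain s g where s: "s < k" "g \<notin> set b" "g \<in> S - {i}" "d = b[s := g]"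
    using adj_arr[OF bi dV] by metis
  have other: "\<exists>q<k. q \<noteq> s" using k2 by (cases "s = 0") (auto intro: exI[of _ 0] exI[of _ 1])
  \<comment> \<open>\<open>d\<close> agrees with \<open>b\<close> off position \<open>s\<close>,
    whereas \<open>a\<close> and \<open>c\<close> agree with \<open>b\<close> nowhere;
    \<open>k \<ge> 2\<close> supplies a position that tells them apart.\<close>
  have dc: "d \<noteq> c"
  proof
    assume dcq: "d = c"
    obtain q where q: "q < k" "q \<noteq> s" using other by blast
    then have "c ! q = b ! q" using dcq s(4) by auto
    then show False using q abq[of q] tb c(21) unfolding c_def by (cases "q = p") auto
  qed
  have da: "a \<noteq> d"
  proof
    assume ad: "a = d"
    obtain q where q: "q < k" "q \<noteq> s" using other by blast
    then have "a ! q = b ! q" using ad s(4) by auto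
    then show False using abq q by blast
  qed
  \<comment> \<open>The symbol lost between \<open>b\<close> and \<open>d\<close>. It is absent from
    \<open>a\<close> and from \<open>d\<close>, so copy \<open>u\<close> can lead from
    \<open>i # a\<close> to \<open>i # d\<close>.\<close>
  define u where "u = b ! s"
  have u: "u \<in> set b" "u \<in> S" "u \<noteq> i" "u \<noteq> j" "u \<notin> set a"
    using s(1) c(14,16,18) dis unfolding u_def by auto
  have ud: "u \<notin> set d"
    using s c(14,15) u(1) unfolding u_def by (auto simp: set_update_distinct)
  define K where "K = S - {i, j, u}"
  have cK: "card K = k + m - 2" "finite K"
  proof -
    have "K = S - {i, j} - {u}" unfolding K_def by auto
    then show "card K = k + m - 2" using card_rest(1)[OF ij] u fin by simp
  qed (simp add: K_def fin)
  define Ev where "Ev = S - {i, j} - set b"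
  have Ev: "card Ev = m - 1" "finite Ev" "Ev \<subseteq> K" using card_outer(2)[OF f] dis fin u unfolding Ev_def K_def by auto
  define E where "E = S - {i, j} - set a - {u}"
  have E: "card E = m - 2" "finite E" "E \<subseteq> K - set a" using card_outer(1)[OF f] dis fin u unfolding E_def K_def by auto
  define D where "D = S - {i, j} - set c"
  have D: "finite D" "D \<inter> set c = {}" "card D = m - 1" "D \<union> set c = S - {i, j}"
    using card_rest(2)[OF ij c(1)] fin c(1) unfolding D_def arr_def by auto
  \<comment> \<open>All \<open>m - 1\<close> copies in \<open>Ev\<close> send direct entrances to
    \<open>j # b\<close>. With \<open>u\<close> reserved in addition, the total is \<open>m\<close>,
    the most that the assignment allows.\<close>
  have "card (insert u Ev) = m" using Ev u m3 unfolding Ev_def by simp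
  then have "card (insert u Ev) \<le> Suc (card D)" using D(3) by simp
  note cu = this
  have "insert u Ev \<subseteq> D \<union> set c" unfolding D(4) Ev_def using u by auto
  then obtain qs e where e: "qs < k" "inj_on e ({..<k} - {qs})"
    "\<forall>q. q < k \<longrightarrow> q \<noteq> qs \<longrightarrow> e q \<in> insert (c ! q) D - insert u Ev"
    using cu by (rule assign_specials[OF c(9,8) k1 D(1,2)])
  have eK: "e q \<in> K - Ev \<and> e q \<notin> set c - {c ! q}" if "q < k" "q \<noteq> qs" for q
  proof -
    have q: "c ! q \<in> set c" using that(1) c(8) by simp
    have 1: "e q \<in> insert (c ! q) D" "e q \<notin> insert u Ev" using e(3)[rule_format, OF that] by blast+
    have "e q = c ! q \<or> e q \<in> D" using 1(1) by simp
    then have "e q \<in> D \<union> set c" "e q \<notin> set c - {c ! q}" using q D(2) by auto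
    moreover have "e q \<noteq> u" "e q \<notin> Ev" using 1(2) by simp_all
    ultimately show ?thesis unfolding D(4) K_def by simp
  qed
  \<comment> \<open>Sources and sinks both fill \<open>K\<close>. The container built on these
    copies has \<open>k * m + (m - 2) + 1\<close> paths, and the rerouting adds the last
    one.\<close>
  have A: "E \<union> (set a - {j}) = K"
    using c(13,17) dis(2) u unfolding E_def K_def by auto
  have "card (Ev \<union> e ` ({..<k} - {qs})) = card K"
  proof -
    have "card (e ` ({..<k} - {qs})) = k - 1" using card_image[OF e(2)] e(1) by simp
    moreover have "Ev \<inter> e ` ({..<k} - {qs}) = {}" using eK by auto
    ultimately show ?thesis using Ev cK k1 m2 by (subst card_Un_disjoint) auto
  qed
  then have crd: "card (E \<union> (set a - {j})) = card (Ev \<union> e ` ({..<k} - {qs}))" using A by simp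
  have "\<exists>F. flow (reg ({i, j} \<union> K)) (i # a) (j # b) F \<and> real_arcs F \<and>
    card (F `` {i # a}) = k * m + card E + (if j \<in> set a then 0 else 1) \<and>
    (\<forall>x y. (x, y) \<in> P \<longrightarrow> y \<noteq> a[p := t] \<longrightarrow> (i # x, i # y) \<in> F)"
    by (rule far_join_special[OF f pv cb P[unfolded c_def] _ E(3) _ _ e(1,2) _ crd])
      (use A Ev(3) eK in \<open>auto simp: K_def Ev_def c_def\<close>)
  then obtain F where F: "flow (reg ({i, j} \<union> K)) (i # a) (j # b) F" "real_arcs F"
    "card (F `` {i # a}) = k * m + card E + 1"
    "\<And>x y. (x, y) \<in> P \<Longrightarrow> y \<noteq> c \<Longrightarrow> (i # x, i # y) \<in> F" using dis(2) unfolding c_def by auto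
  have bd: "(i # b, i # d) \<in> F" using F(4)[OF d dc] .
  have aud: "a \<in> arr (S - {u}) k" "d \<in> arr (S - {u}) k"
    using arr_other[OF a u(5)] arr_other[OF dV(1) ud] by auto
  obtain H where H: "pflow (cp u) {} {} {u # a} {u # d} H" "real_arcs H"
    using ham_copy[OF u(2) aud da] by blast
  have disj: "reg ({i, j} \<union> K) \<inter> cp u = {}"
    using reg_disj[of "{i, j} \<union> K" "{u}"] u by (auto simp: reg_single K_def)
  have jp: "i # b \<noteq> i # a" "i # d \<noteq> j # b" "u # a \<in> cp u" "u # d \<in> cp u" using ab ij(3) aud by auto
  note J = flow_jump[OF F(1) bd H(1) disj jp(3,4,1,2)]
  let ?F = "F - {(i # b, i # d)} \<union> H \<union> {(i # b, j # b), (i # a, u # a), (u # d, i # d)}"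
  have "{i, j} \<union> K \<union> {u} = S" using ij u unfolding K_def by auto
  then have "reg ({i, j} \<union> K) \<union> cp u = arr S (Suc k)"
    using reg_Un[of "{i, j} \<union> K" "{u}"] reg_S by (simp add: reg_single)
  then have "flow (arr S (Suc k)) (i # a) (j # b) ?F" using J(1) by simp
  moreover have "real_arcs ?F" using F(2) H(2) ij(3) u by auto
  moreover have "finite (F `` {i # a})"
    by (rule finite_subset[OF _ flowD(1)[OF F(1)]]) (use flowD(2)[OF F(1)] in auto)
  then have "card (?F `` {i # a}) = k * m + m" unfolding J(2) using J(3) F(3) E(1) m3 by simp
  ultimately show ?thesis unfolding sflow_def by blast
qed

text \<open>For \<open>k = 1\<close> the centre \<open>[t]\<close> is adjacent to
  \<open>b = [y]\<close>, so the central path goes from the centre of copy \<open>j\<close> straight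
  to \<open>j # b\<close>. The only position keeps its own copy \<open>y\<close>, and
  \<open>i # b\<close>, a neighbour of the centre avoiding \<open>j\<close>, is linked to
  \<open>j # b\<close> by a single arc; no path has to be cut for it.\<close>

lemma far_spans_max_disjoint_one:
  assumes f: "far i j a b" and dis: "i \<notin> set b" "j \<notin> set a" "set a \<inter> set b = {}" and k: "k = 1"
  shows "\<exists>F. sflow S (Suc k) (i # a) (j # b) F \<and> card (F `` {i # a}) = k * m + m"
proof -
  have m3: "m \<ge> 3" using room k by simp
  obtain p t where pv: "pivot i j a p t" and tb: "t \<noteq> b ! p" using pivot_ex[OF f] dis m3 by blast
  have p: "p = 0" using pivotD(20)[OF f pv] k by simp
  obtain x where x: "a = [x]" using pivotD(11)[OF f pv] k by (metis One_nat_def length_0_conv length_Suc_conv)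
  obtain y where y: "b = [y]" using pivotD(14)[OF f pv] k by (metis One_nat_def length_0_conv length_Suc_conv)
  have ij: "i \<in> S" "j \<in> S" "i \<noteq> j" and a: "a \<in> arr (S - {i}) k" and b: "b \<in> arr (S - {j}) k"
    using f unfolding far_def by auto
  have xy: "x \<in> S" "y \<in> S" "x \<noteq> i" "y \<noteq> j" "y \<noteq> i" "x \<noteq> j" "x \<noteq> y"
    using a b dis unfolding x y arr_def by auto
  have tS: "t \<in> S" "t \<noteq> i" "t \<noteq> j" "t \<noteq> x" "t \<noteq> y" using pv tb unfolding pivot_def x y p by auto
  have c: "a[p := t] = [t]" unfolding x p by simp
  obtain P where P: "sflow (S - {i}) k a (a[p := t]) P"
    "P\<inverse> `` {a[p := t]} = {x \<in> arr (S - {i}) k. arr_adj x (a[p := t])}"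
    using nbr_set[OF ij(1) a pivotD(2,4)[OF f pv]] by blast
  define K where "K = S - {i, j}"
  define E where "E = K - {x}"
  define T where "T = K - {y}"
  have A: "E \<union> (set a - {j}) = K" using xy unfolding E_def K_def x by auto
  have B: "T \<union> (\<lambda>_. y) ` {0::nat} = K" using xy unfolding T_def K_def by auto
  have "\<exists>F. flow (reg ({i, j} \<union> K)) (i # a) (j # b) F \<and> real_arcs F \<and>
    card (F `` {i # a}) = k * m + card E + (if j \<in> set a then 0 else 1) \<and>
    (\<forall>x y. (x, y) \<in> P \<longrightarrow> y \<noteq> a[p := t] \<longrightarrow> (i # x, i # y) \<in> F)"
  proof (rule far_join[OF f pv _ P, where I = "{0}" and ?y0.0 = b and e = "\<lambda>_. y" and T = T])
    show "arr_adj (a[p := t]) b" unfolding c y adj_update using tS by auto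
    show "q \<in> {0} \<longleftrightarrow> a[p := t, q := i] \<noteq> b" if "q < k" for q
      using that k xy unfolding c y by auto
    show "card (E \<union> (set a - {j})) = card (T \<union> (\<lambda>_. y) ` {0::nat})" unfolding A B ..
    show "y \<in> K - T \<and> y \<notin> set (a[p := t]) - {a[p := t] ! q}" for q
      using xy tS unfolding c T_def K_def by auto
  qed (use A b k tS in \<open>auto simp: E_def T_def K_def x y p\<close>)
  then obtain F where F: "flow (reg ({i, j} \<union> K)) (i # a) (j # b) F" "real_arcs F"
    "card (F `` {i # a}) = k * m + card E + (if j \<in> set a then 0 else 1)" by blast
  have "{i, j} \<union> K = S" using ij unfolding K_def by auto
  then have "sflow S (Suc k) (i # a) (j # b) F" using F reg_S unfolding sflow_def by simp
  moreover have "card E = m - 1" using card_outer(1)[OF f] dis unfolding E_def K_def x by simp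
  then have "card (F `` {i # a}) = k * m + m" using F(3) dis(2) m2 by simp
  ultimately show ?thesis by blast
qed

text \<open>Assumption \<open>c\<close> is arranged by the choice of the first position: a symbol
  shared by the two words is moved to the front of the first, and if there is none the words are
  disjoint.\<close>

lemma far_spans:
  assumes f: "far i j a b" and c: "i \<in> set b \<or> (j \<notin> set a \<and> set a \<inter> set b = {})" and l: "1 \<le> l" "l \<le> Suc k * m"
  shows "\<exists>F. sflow S (Suc k) (i # a) (j # b) F \<and> card (F `` {i # a}) = l"
proof -
  have ij: "i \<in> S" "j \<in> S" "i \<noteq> j" and a: "a \<in> arr (S - {i}) k" and b: "b \<in> arr (S - {j}) k"
    using f unfolding far_def by auto
  have ex: "\<exists>p t. pivot i j a p t \<and> a[p := t] \<noteq> b"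
  proof (cases "k \<ge> 2 \<or> i \<in> set b")
    case True
    then show ?thesis using pivot_ex[OF f] pivot_ne[OF f] by blast
  next
    case False
    then have "m \<ge> 3" "j \<notin> set a" using room c by auto
    then obtain p t where pv: "pivot i j a p t" "t \<noteq> b ! p" using pivot_ex[OF f] by blast
    then have "a[p := t] ! p = t" using pivotD(21)[OF f pv(1)] by simp
    then show ?thesis using pv by metis
  qed
  then obtain p t where pv: "pivot i j a p t" "a[p := t] \<noteq> b" by blast
  consider "l = 1" | "2 \<le> l" "l \<le> k * m" | r where "l = k * m + r" "1 \<le> r" "r \<le> m"
  proof -
    have "l = k * m + (l - k * m)" "l - k * m \<le> m" if "k * m < l" using l that by auto
    then show ?thesis using that l(1) by (metis One_nat_def Suc_1 Suc_leI le_neq_implies_less less_eq_Suc_le not_le zero_less_diff)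
  qed
  then show ?thesis
  proof cases
    case 1
    then show ?thesis using spans_one[of "i # a" "j # b"] ij a b by (auto simp: arr_Cons)
  next
    case 2
    then show ?thesis using far_spans_low[OF f pv] by blast
  next
    case (3 r)
    show ?thesis
    proof (cases "i \<in> set b")
      case True
      then show ?thesis using far_spans_high_meeting[OF f True 3(2,3)] 3(1) by simp
    next
      case False
      then have dis: "i \<notin> set b" "j \<notin> set a" "set a \<inter> set b = {}" using c by auto
      show ?thesis
      proof (cases "r < m")
        case True
        then show ?thesis using far_spans_high_disjoint[OF f dis pv 3(2) True] 3(1) by simp
      next
        case False
        then have r: "r = m" using 3 by simp
        show ?thesis
        proof (cases "k = 1")
          case True
          then show ?thesis using far_spans_max_disjoint_one[OF f dis True] 3(1) r by simp
        next
          case False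
          then have k2: "k \<ge> 2" using k1 by simp
          have ca: "card (set a) = k" "card (set b) = k" "finite (set a)" "finite (set b)" "set a \<subseteq> S" "set b \<subseteq> S" "i \<notin> set a" "j \<notin> set b"
            using a b unfolding arr_def by (auto simp: distinct_card)
          \<comment> \<open>\<open>i\<close>, \<open>j\<close> and the two disjoint words account
            for \<open>2 + 2 * k\<close> of the \<open>k + 1 + m\<close> symbols, so
            \<open>m \<ge> k + 1\<close>.\<close>
          have "card ({i, j} \<union> (set a \<union> set b)) = 2 + (k + k)"
            using ca dis ij by (subst card_Un_disjoint) (auto simp: card_Un_disjoint)
          moreover have "card ({i, j} \<union> (set a \<union> set b)) \<le> card S"
            using ca ij fin by (intro card_mono) auto
          ultimately have "m \<ge> 3" using card_S k2 by simp
          then show ?thesis using far_spans_max_disjoint[OF f dis k2] 3(1) r by simp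
        qed
      qed
    qed
  qed
qed

lemma spans_step: "spans S (Suc k)"
  unfolding spans_def
proof (intro ballI impI allI)
  fix u v l
  assume u: "u \<in> arr S (Suc k)" and v: "v \<in> arr S (Suc k)" and uv: "u \<noteq> v"
    and l: "1 \<le> l \<and> l \<le> Suc k * (card S - Suc k)"
  have lm: "1 \<le> l" "l \<le> Suc k * m" using l card_S by auto
  show "\<exists>F. sflow S (Suc k) u v F \<and> card (F `` {u}) = l"
  proof (cases "\<exists>p<Suc k. u ! p = v ! p")
    case True
    then show ?thesis using spans_agree[OF u v uv _ _ lm] by blast
  next
    case False
    have len: "length x = Suc k" if "x \<in> arr S (Suc k)" for x using that unfolding arr_def by simp
    obtain p where p: "p < Suc k" "u ! p \<in> set v \<or> set u \<inter> set v = {}"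
    proof (cases "set u \<inter> set v = {}")
      case True
      then show ?thesis using that[of 0] by simp
    next
      case False
      then obtain s where "s \<in> set u" "s \<in> set v" by auto
      then show ?thesis using that len[OF u] by (metis in_set_conv_nth)
    qed
    obtain a where a: "swp p u = u ! p # a" "u ! p \<in> S" "a \<in> arr (S - {u ! p}) k" using swp_Cons[OF u p(1)] .
    obtain b where b: "swp p v = v ! p # b" "v ! p \<in> S" "b \<in> arr (S - {v ! p}) k" using swp_Cons[OF v p(1)] .
    have ne: "swp p u ! q \<noteq> swp p v ! q" if "q < Suc k" for q
      using False that p(1) nth_swp[of p u q] nth_swp[of p v q] len u v by (auto split: if_splits)
    have f: "far (u ! p) (v ! p) a b"
      unfolding far_def
    proof (intro conjI allI impI)
      show "u ! p \<noteq> v ! p" using False p(1) by auto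
      show "a ! q \<noteq> b ! q" if "q < k" for q using ne[of "Suc q"] a(1) b(1) that by simp
    qed (use a b in auto)
    have su: "set u = insert (u ! p) (set a)" "set v = insert (v ! p) (set b)"
      using set_swp[of p u] set_swp[of p v] a(1) b(1) p(1) len u v by auto
    have "u ! p \<in> set b \<or> (v ! p \<notin> set a \<and> set a \<inter> set b = {})"
      using p(2) False p(1) unfolding su by auto
    then obtain F where "sflow S (Suc k) (u ! p # a) (v ! p # b) F" "card (F `` {u ! p # a}) = l"
      using far_spans[OF f _ lm] by blast
    then show ?thesis using sflow_swp[of S "Suc k" p u v F] u v p(1) a(1) b(1) by auto
  qed
qed

end

section \<open>Base cases and the theorem\<close>

lemma adj_single: "arr_adj [x] [y] \<longleftrightarrow> x \<noteq> y"
  using adj_irrefl by (cases "x = y") auto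

lemma successively_singles:
  "distinct zs \<Longrightarrow> successively arr_adj (map (\<lambda>z. [z]) zs)"
  by (induction zs rule: induct_list012) (auto simp: adj_single)

lemma arr_one: "arr S (Suc 0) = (\<lambda>z. [z]) ` S"
  unfolding arr_def by (auto simp: length_Suc_conv)

text \<open>One long path takes up everything that is not prescribed: from \<open>x\<close> through
  \<open>rs\<close> to some \<open>g\<close> in \<open>G\<close> other than \<open>x\<close>, then
  to \<open>y\<close>. The other elements of \<open>G\<close> give paths with one inner vertex, and
  \<open>x\<close>, if prescribed, the direct edge.\<close>

lemma spans_into_complete:
  assumes fin: "finite S"
  shows "spans_into S (Suc 0)"
  unfolding spans_into_def
proof (intro ballI impI allI)
  fix u v L
  assume u: "u \<in> arr S (Suc 0)" and v: "v \<in> arr S (Suc 0)" and adj: "arr_adj u v"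
    and L: "L \<subseteq> {x \<in> arr S (Suc 0). arr_adj x v} \<and> L \<noteq> {} \<and> L \<noteq> {u}"
  obtain x y where xy: "u = [x]" "v = [y]" "x \<in> S" "y \<in> S" using u v by (auto simp: arr_one)
  have ne: "x \<noteq> y" using adj xy by (simp add: adj_single)
  define G where "G = {g. [g] \<in> L}"
  have LG: "L = (\<lambda>z. [z]) ` G" using L unfolding G_def by (auto simp: arr_one)
  have G: "G \<subseteq> S" "y \<notin> G" "G \<noteq> {}" "G \<noteq> {x}"
  proof -
    show "G \<subseteq> S" using L unfolding G_def by (auto simp: arr_one)
    show "y \<notin> G" using L adj_irrefl unfolding G_def xy by auto
    show "G \<noteq> {}" "G \<noteq> {x}" using L xy(1) unfolding LG by auto
  qed
  then obtain g where g: "g \<in> G" "g \<noteq> x" by blast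
  obtain gs where gs: "set gs = G - {x, g}" "distinct gs"
    using finite_distinct_list[of "G - {x, g}"] G(1) fin finite_subset by blast
  obtain rs where rs: "set rs = S - G - {x, y}" "distinct rs"
    using finite_distinct_list[of "S - G - {x, y}"] fin by blast
  let ?s = "\<lambda>z. [z]"
  define ps where "ps = map ?s (rs @ [g]) # map (\<lambda>h. [[h]]) gs"
  have cps: "concat ps = map ?s (rs @ [g] @ gs)" unfolding ps_def by simp
  have d: "distinct (x # rs @ [g] @ gs @ [y])" using ne g gs rs G(1,2) xy by auto
  have "\<exists>F. flow ({u, v} \<union> set (concat ps)) u v F \<and> F `` {u} = hd ` set ps \<union> (if x \<in> G then {v} else {}) \<and>
    F\<inverse> `` {v} = last ` set ps \<union> (if x \<in> G then {u} else {}) \<and> (\<forall>(x,y)\<in>F. arr_adj x y)"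
  proof (rule paths_flow)
    show "u \<noteq> v" using xy ne by simp
    show "distinct (concat ps)" unfolding cps using d by (auto simp: distinct_map inj_on_def)
    show "u \<notin> set (concat ps)" "v \<notin> set (concat ps)" unfolding cps xy using d by auto
    show "[] \<notin> set ps" unfolding ps_def by auto
    show "\<forall>p\<in>set ps. successively arr_adj (u # p @ [v])"
    proof
      fix p assume "p \<in> set ps"
      then consider "p = map ?s (rs @ [g])" | h where "h \<in> set gs" "p = [[h]]" unfolding ps_def by auto
      then show "successively arr_adj (u # p @ [v])"
      proof cases
        case 1
        then have "u # p @ [v] = map ?s (x # rs @ [g] @ [y])" using xy by simp
        moreover have "distinct (x # rs @ [g] @ [y])" using d by auto
        ultimately show ?thesis using successively_singles by metis
      next
        case (2 h)
        then show ?thesis using xy d by (auto simp: adj_single)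
      qed
    qed
    show "x \<in> G \<longrightarrow> arr_adj u v" using adj by simp
  qed
  then obtain F where F: "flow ({u, v} \<union> set (concat ps)) u v F"
    "F\<inverse> `` {v} = last ` set ps \<union> (if x \<in> G then {u} else {})" "real_arcs F" by blast
  have "{u, v} \<union> set (concat ps) = arr S (Suc 0)"
    unfolding cps arr_one xy using gs rs g G xy by auto
  moreover have "last ` set ps = ?s ` insert g (set gs)" unfolding ps_def by (auto simp: last_map image_iff)
  then have "last ` set ps \<union> (if x \<in> G then {u} else {}) = L" unfolding LG gs xy using g by auto
  ultimately show "\<exists>F. sflow S (Suc 0) u v F \<and> F\<inverse> `` {v} = L" using F unfolding sflow_def by auto
qed

text \<open>For adjacent ends a path count reduces to a choice of that many predecessors of
  \<open>v\<close>. For \<open>l = 1\<close> it must be a neighbour other than \<open>u\<close>,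
  which \<open>two\<close> guarantees.\<close>

lemma spans_of_into:
  assumes i: "spans_into S k" and fin: "finite S" and u: "u \<in> arr S k" and v: "v \<in> arr S k" and adj: "arr_adj u v"
    and l: "1 \<le> l" "l \<le> k * (card S - k)" and two: "2 \<le> k * (card S - k)"
  shows "\<exists>F. sflow S k u v F \<and> card (F `` {u}) = l"
proof -
  define N where "N = {x \<in> arr S k. arr_adj x v}"
  have "N = {x \<in> arr S k. arr_adj v x}" unfolding N_def using adj_sym by auto
  then have N: "card N = k * (card S - k)" using card_nbrs[OF fin v] by simp
  have fN: "finite N" unfolding N_def using finite_arr[OF fin] by simp
  have uN: "u \<in> N" unfolding N_def using u adj by simp
  obtain L where L: "L \<subseteq> N" "card L = l" "L \<noteq> {u}"
  proof (cases "l = 1")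
    case True
    have "\<not> N \<subseteq> {u}" using card_mono[of "{u}" N] N two by auto
    then obtain z where "z \<in> N" "z \<noteq> u" by auto
    then show ?thesis using that[of "{z}"] True by auto
  next
    case False
    obtain L where "L \<subseteq> N" "card L = l" using l(2) N by (metis obtain_subset_with_card_n)
    moreover from this have "L \<noteq> {u}" using False by auto
    ultimately show ?thesis using that by blast
  qed
  have "L \<noteq> {}" using L(2) l(1) by auto
  then obtain F where F: "sflow S k u v F" "F\<inverse> `` {v} = L"
    using i u v adj L unfolding spans_into_def N_def by blast
  have "card (F `` {u}) = card (F\<inverse> `` {v})"
    by (rule flow_card_out_in[of "arr S k"]) (use F(1) in \<open>simp add: sflow_def\<close>)
  then show ?thesis using F L(2) by auto
qed

lemma spans_complete:
  assumes fin: "finite S" and c: "card S \<ge> 3"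
  shows "spans S (Suc 0)"
  unfolding spans_def
proof (intro ballI impI allI)
  fix u v l
  assume uv: "u \<in> arr S (Suc 0)" "v \<in> arr S (Suc 0)" "u \<noteq> v" "1 \<le> l \<and> l \<le> Suc 0 * (card S - Suc 0)"
  then have "arr_adj u v" by (auto simp: arr_one adj_single)
  then show "\<exists>F. sflow S (Suc 0) u v F \<and> card (F `` {u}) = l"
    using spans_of_into[OF spans_into_complete[OF fin] fin uv(1,2)] uv(4) c by simp
qed

section \<open>The exceptional case: two-letter words over four symbols\<close>

text \<open>A certificate that simplification can check. The graph has 12 vertices, so ten distinct
  inner vertices together with \<open>u\<close> and \<open>v\<close> cover it.\<close>

definition small_ok :: "nat \<Rightarrow> nat \<Rightarrow> nat \<Rightarrow> nat \<Rightarrow> nat list \<Rightarrow> nat list \<Rightarrow> nat list list list \<Rightarrow> bool \<Rightarrow> bool" where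
  "small_ok i a b c u v ps d \<longleftrightarrow> distinct (u # v # concat ps) \<and> length (concat ps) = 10 \<and>
     (\<forall>x\<in>set (u # v # concat ps). x \<in> arr {i, a, b, c} 2) \<and> [] \<notin> set ps \<and>
     (\<forall>p\<in>set ps. successively arr_adj (u # p @ [v])) \<and> (d \<longrightarrow> arr_adj u v)"

lemma card_small:
  assumes "distinct [i, a, b, c]"
  shows "card (arr {i, a, b, c} 2) = 12" "finite (arr {i, a, b, c} 2)"
proof -
  have c4: "card {i, a, b, c} = 4" using assms by simp
  have "card (arr {i, a, b, c} 2) = \<Prod>{card {i, a, b, c} - 2 + 1..card {i, a, b, c}}"
    unfolding arr_def by (rule card_lists_distinct_length_eq) (use c4 in simp_all)
  also have "\<dots> = \<Prod>{3..4::nat}" unfolding c4 by simp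
  also have "{3..4::nat} = {3, 4}" by auto
  finally show "card (arr {i, a, b, c} 2) = 12" by simp
qed (simp add: finite_arr)

lemma small_flow:
  assumes ds: "distinct [i, a, b, c]" and ok: "small_ok i a b c u v ps d"
  shows "\<exists>F. sflow {i, a, b, c} 2 u v F \<and> card (F `` {u}) = card (hd ` set ps \<union> (if d then {v} else {}))"
    "\<exists>F. sflow {i, a, b, c} 2 u v F \<and> F\<inverse> `` {v} = last ` set ps \<union> (if d then {u} else {})"
proof -
  note ok = ok[unfolded small_ok_def]
  have e: "set (u # v # concat ps) = arr {i, a, b, c} 2"
  proof (rule card_subset_eq[OF card_small(2)[OF ds]])
    have "card (set (u # v # concat ps)) = length (u # v # concat ps)" by (rule distinct_card) (use ok in blast)
    then show "card (set (u # v # concat ps)) = card (arr {i, a, b, c} 2)"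
      using ok card_small(1)[OF ds] by simp
  qed (use ok in blast)
  have "\<exists>F. flow ({u, v} \<union> set (concat ps)) u v F \<and> F `` {u} = hd ` set ps \<union> (if d then {v} else {}) \<and>
    F\<inverse> `` {v} = last ` set ps \<union> (if d then {u} else {}) \<and> (\<forall>(x,y)\<in>F. arr_adj x y)"
    by (rule paths_flow) (use ok in auto)
  moreover have "{u, v} \<union> set (concat ps) = arr {i, a, b, c} 2" using e by simp
  ultimately obtain F where "sflow {i, a, b, c} 2 u v F" "F `` {u} = hd ` set ps \<union> (if d then {v} else {})"
    "F\<inverse> `` {v} = last ` set ps \<union> (if d then {u} else {})" unfolding sflow_def by metis
  then show "\<exists>F. sflow {i, a, b, c} 2 u v F \<and> card (F `` {u}) = card (hd ` set ps \<union> (if d then {v} else {}))"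
    "\<exists>F. sflow {i, a, b, c} 2 u v F \<and> F\<inverse> `` {v} = last ` set ps \<union> (if d then {u} else {})" by metis+
qed

text \<open>Besides \<open>[i, a]\<close>, the neighbours of \<open>[i, b]\<close> are
  \<open>[i, c]\<close>, \<open>[a, b]\<close> and \<open>[c, b]\<close>; a family of paths is given
  for each nonempty subset of these. The direct edge can be added to any family, so it is a
  parameter \<open>d\<close>.\<close>

lemma small_into:
  assumes ds: "distinct [i, a, b, c]"
  shows "\<And>d. L \<subseteq> {[i, c], [a, b], [c, b]} \<Longrightarrow> L \<noteq> {} \<Longrightarrow> \<exists>F. sflow {i, a, b, c} 2 [i, a] [i, b] F \<and> F\<inverse> `` {[i, b]} = L \<union> (if d then {[i, a]} else {})"
proof -
  fix d assume L: "L \<subseteq> {[i, c], [a, b], [c, b]}" "L \<noteq> {}"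
  have p0: "small_ok i a b c [i, a] [i, b] [[[b, a], [b, i], [a, i], [c, i], [c, a], [c, b], [a, b], [a, c], [b, c], [i, c]]] d"
    unfolding small_ok_def using ds by (simp add: arr_def)
  have p1: "small_ok i a b c [i, a] [i, b] [[[i, c], [a, c], [a, i], [b, i], [b, c], [b, a], [c, a], [c, i], [c, b], [a, b]]] d"
    unfolding small_ok_def using ds by (simp add: arr_def)
  have p2: "small_ok i a b c [i, a] [i, b] [[[i, c], [a, c], [a, b], [a, i], [b, i], [b, c], [b, a], [c, a], [c, i], [c, b]]] d"
    unfolding small_ok_def using ds by (simp add: arr_def)
  have p3: "small_ok i a b c [i, a] [i, b] [[[i, c]], [[b, a], [b, i], [b, c], [a, c], [a, i], [c, i], [c, a], [c, b], [a, b]]] d"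
    unfolding small_ok_def using ds by (simp add: arr_def)
  have p4: "small_ok i a b c [i, a] [i, b] [[[i, c]], [[b, a], [b, i], [b, c], [a, c], [a, b], [a, i], [c, i], [c, a], [c, b]]] d"
    unfolding small_ok_def using ds by (simp add: arr_def)
  have p5: "small_ok i a b c [i, a] [i, b] [[[i, c], [a, c], [a, i], [a, b]], [[b, a], [b, c], [b, i], [c, i], [c, a], [c, b]]] d"
    unfolding small_ok_def using ds by (simp add: arr_def)
  have p6: "small_ok i a b c [i, a] [i, b] [[[i, c]], [[b, a], [b, i], [b, c], [a, c], [a, i], [a, b]], [[c, a], [c, i], [c, b]]] d"
    unfolding small_ok_def using ds by (simp add: arr_def)
  have "L \<in> Pow {[i, c], [a, b], [c, b]}" using L by simp
  then consider "L = {[i, c]}" | "L = {[a, b]}" | "L = {[c, b]}" | "L = {[i, c], [a, b]}" | "L = {[i, c], [c, b]}" | "L = {[a, b], [c, b]}" | "L = {[i, c], [a, b], [c, b]}"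
    using L(2) unfolding Pow_insert Pow_empty by (auto simp: insert_commute)
  then show "\<exists>F. sflow {i, a, b, c} 2 [i, a] [i, b] F \<and> F\<inverse> `` {[i, b]} = L \<union> (if d then {[i, a]} else {})"
  proof cases
    case 1
    then show ?thesis using small_flow(2)[OF ds p0] by (simp add: insert_commute)
  next
    case 2
    then show ?thesis using small_flow(2)[OF ds p1] by (simp add: insert_commute)
  next
    case 3
    then show ?thesis using small_flow(2)[OF ds p2] by (simp add: insert_commute)
  next
    case 4
    then show ?thesis using small_flow(2)[OF ds p3] by (simp add: insert_commute)
  next
    case 5
    then show ?thesis using small_flow(2)[OF ds p4] by (simp add: insert_commute)
  next
    case 6
    then show ?thesis using small_flow(2)[OF ds p5] by (simp add: insert_commute)
  next
    case 7
    then show ?thesis using small_flow(2)[OF ds p6] by (simp add: insert_commute)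
  qed
qed

text \<open>Up to renaming symbols, a second vertex not adjacent to \<open>[i, a]\<close> is
  \<open>[a, i]\<close>, \<open>[a, b]\<close>, \<open>[b, i]\<close> or \<open>[b, c]\<close>; this
  lemma and the next three list paths for each. The degree is 4, hence four values of
  \<open>l\<close>.\<close>

lemma small_far_ai:
  assumes ds: "distinct [i, a, b, c]" and l: "l \<in> {1, 2, 3, 4}"
  shows "\<exists>F. sflow {i, a, b, c} 2 [i, a] [a, i] F \<and> card (F `` {[i, a]}) = l"
proof -
  have p1: "small_ok i a b c [i, a] [a, i] [[[i, b], [i, c], [a, c], [a, b], [c, b], [c, i], [c, a], [b, a], [b, c], [b, i]]] False"
    unfolding small_ok_def using ds by (simp add: arr_def)
  have p2: "small_ok i a b c [i, a] [a, i] [[[i, b], [i, c], [a, c]], [[b, a], [b, c], [b, i], [c, i], [c, a], [c, b], [a, b]]] False"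
    unfolding small_ok_def using ds by (simp add: arr_def)
  have p3: "small_ok i a b c [i, a] [a, i] [[[i, b], [i, c], [a, c]], [[b, a], [b, c], [b, i]], [[c, a], [c, i], [c, b], [a, b]]] False"
    unfolding small_ok_def using ds by (simp add: arr_def)
  have p4: "small_ok i a b c [i, a] [a, i] [[[i, b], [a, b]], [[i, c], [a, c]], [[b, a], [b, c], [b, i]], [[c, a], [c, b], [c, i]]] False"
    unfolding small_ok_def using ds by (simp add: arr_def)
  consider "l = 1" | "l = 2" | "l = 3" | "l = 4" using l by blast
  then show ?thesis
  proof cases
    case 1
    then show ?thesis using small_flow(1)[OF ds p1] ds by (simp add: eval_nat_numeral)
  next
    case 2
    then show ?thesis using small_flow(1)[OF ds p2] ds by (simp add: eval_nat_numeral)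
  next
    case 3
    then show ?thesis using small_flow(1)[OF ds p3] ds by (simp add: eval_nat_numeral)
  next
    case 4
    then show ?thesis using small_flow(1)[OF ds p4] ds by (simp add: eval_nat_numeral)
  qed
qed

lemma small_far_ab:
  assumes ds: "distinct [i, a, b, c]" and l: "l \<in> {1, 2, 3, 4}"
  shows "\<exists>F. sflow {i, a, b, c} 2 [i, a] [a, b] F \<and> card (F `` {[i, a]}) = l"
proof -
  have p1: "small_ok i a b c [i, a] [a, b] [[[i, b], [i, c], [a, c], [a, i], [b, i], [b, c], [b, a], [c, a], [c, i], [c, b]]] False"
    unfolding small_ok_def using ds by (simp add: arr_def)
  have p2: "small_ok i a b c [i, a] [a, b] [[[i, b]], [[i, c], [a, c], [a, i], [b, i], [b, c], [b, a], [c, a], [c, i], [c, b]]] False"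
    unfolding small_ok_def using ds by (simp add: arr_def)
  have p3: "small_ok i a b c [i, a] [a, b] [[[i, b]], [[i, c], [a, c]], [[b, a], [b, c], [b, i], [a, i], [c, i], [c, a], [c, b]]] False"
    unfolding small_ok_def using ds by (simp add: arr_def)
  have p4: "small_ok i a b c [i, a] [a, b] [[[i, b]], [[i, c], [a, c]], [[b, a], [b, c], [b, i], [a, i]], [[c, a], [c, i], [c, b]]] False"
    unfolding small_ok_def using ds by (simp add: arr_def)
  consider "l = 1" | "l = 2" | "l = 3" | "l = 4" using l by blast
  then show ?thesis
  proof cases
    case 1
    then show ?thesis using small_flow(1)[OF ds p1] ds by (simp add: eval_nat_numeral)
  next
    case 2
    then show ?thesis using small_flow(1)[OF ds p2] ds by (simp add: eval_nat_numeral)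
  next
    case 3
    then show ?thesis using small_flow(1)[OF ds p3] ds by (simp add: eval_nat_numeral)
  next
    case 4
    then show ?thesis using small_flow(1)[OF ds p4] ds by (simp add: eval_nat_numeral)
  qed
qed

lemma small_far_bi:
  assumes ds: "distinct [i, a, b, c]" and l: "l \<in> {1, 2, 3, 4}"
  shows "\<exists>F. sflow {i, a, b, c} 2 [i, a] [b, i] F \<and> card (F `` {[i, a]}) = l"
proof -
  have p1: "small_ok i a b c [i, a] [b, i] [[[i, b], [i, c], [a, c], [a, i], [a, b], [c, b], [c, i], [c, a], [b, a], [b, c]]] False"
    unfolding small_ok_def using ds by (simp add: arr_def)
  have p2: "small_ok i a b c [i, a] [b, i] [[[i, b], [i, c], [a, c], [a, i], [a, b], [c, b], [c, i]], [[c, a], [b, a], [b, c]]] False"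
    unfolding small_ok_def using ds by (simp add: arr_def)
  have p3: "small_ok i a b c [i, a] [b, i] [[[i, b], [i, c], [a, c], [a, b], [a, i]], [[b, a], [b, c]], [[c, a], [c, b], [c, i]]] False"
    unfolding small_ok_def using ds by (simp add: arr_def)
  have p4: "small_ok i a b c [i, a] [b, i] [[[i, b], [a, b], [a, i]], [[i, c], [a, c], [b, c]], [[b, a]], [[c, a], [c, b], [c, i]]] False"
    unfolding small_ok_def using ds by (simp add: arr_def)
  consider "l = 1" | "l = 2" | "l = 3" | "l = 4" using l by blast
  then show ?thesis
  proof cases
    case 1
    then show ?thesis using small_flow(1)[OF ds p1] ds by (simp add: eval_nat_numeral)
  next
    case 2
    then show ?thesis using small_flow(1)[OF ds p2] ds by (simp add: eval_nat_numeral)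
  next
    case 3
    then show ?thesis using small_flow(1)[OF ds p3] ds by (simp add: eval_nat_numeral)
  next
    case 4
    then show ?thesis using small_flow(1)[OF ds p4] ds by (simp add: eval_nat_numeral)
  qed
qed

lemma small_far_bc:
  assumes ds: "distinct [i, a, b, c]" and l: "l \<in> {1, 2, 3, 4}"
  shows "\<exists>F. sflow {i, a, b, c} 2 [i, a] [b, c] F \<and> card (F `` {[i, a]}) = l"
proof -
  have p1: "small_ok i a b c [i, a] [b, c] [[[i, b], [i, c], [a, c], [a, i], [a, b], [c, b], [c, i], [c, a], [b, a], [b, i]]] False"
    unfolding small_ok_def using ds by (simp add: arr_def)
  have p2: "small_ok i a b c [i, a] [b, c] [[[i, b], [i, c]], [[b, a], [b, i], [a, i], [c, i], [c, a], [c, b], [a, b], [a, c]]] False"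
    unfolding small_ok_def using ds by (simp add: arr_def)
  have p3: "small_ok i a b c [i, a] [b, c] [[[i, b], [i, c]], [[b, a]], [[c, a], [c, i], [c, b], [a, b], [a, c], [a, i], [b, i]]] False"
    unfolding small_ok_def using ds by (simp add: arr_def)
  have p4: "small_ok i a b c [i, a] [b, c] [[[i, b], [a, b], [a, i], [a, c]], [[i, c]], [[b, a]], [[c, a], [c, b], [c, i], [b, i]]] False"
    unfolding small_ok_def using ds by (simp add: arr_def)
  consider "l = 1" | "l = 2" | "l = 3" | "l = 4" using l by blast
  then show ?thesis
  proof cases
    case 1
    then show ?thesis using small_flow(1)[OF ds p1] ds by (simp add: eval_nat_numeral)
  next
    case 2
    then show ?thesis using small_flow(1)[OF ds p2] ds by (simp add: eval_nat_numeral)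
  next
    case 3
    then show ?thesis using small_flow(1)[OF ds p3] ds by (simp add: eval_nat_numeral)
  next
    case 4
    then show ?thesis using small_flow(1)[OF ds p4] ds by (simp add: eval_nat_numeral)
  qed
qed

lemma arr_two: "u \<in> arr S 2 \<longleftrightarrow> (\<exists>x y. u = [x, y] \<and> x \<in> S \<and> y \<in> S \<and> x \<noteq> y)"
  unfolding arr_def numeral_2_eq_2 by (auto simp: length_Suc_conv)

lemma four_elements:
  assumes "card S = 4" "i \<in> S" "a \<in> S" "b \<in> S" "distinct [i, a, b]"
  obtains c where "distinct [i, a, b, c]" "S = {i, a, b, c}"
proof -
  have fS: "finite S" using assms(1) by (metis card.infinite zero_neq_numeral)
  have "card (S - {i, a, b}) = 1" using assms fS by (subst card_Diff_subset) auto
  then obtain c where c: "S - {i, a, b} = {c}" by (rule card_1_singletonE)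
  then have "c \<in> S" "c \<notin> {i, a, b}" "S \<subseteq> {i, a, b, c}" by blast+
  then have "S = {i, a, b, c}" using assms by auto
  then show ?thesis using that[of c] assms(5) \<open>c \<notin> {i, a, b}\<close> by auto
qed

lemma spans_into_small:
  assumes c4: "card S = 4"
  shows "spans_into S 2"
  unfolding spans_into_def
proof (intro ballI impI allI)
  fix u v L
  assume u: "u \<in> arr S 2" and v: "v \<in> arr S 2" and adj: "arr_adj u v"
    and L: "L \<subseteq> {x \<in> arr S 2. arr_adj x v} \<and> L \<noteq> {} \<and> L \<noteq> {u}"
  have first: "\<exists>F. sflow S 2 [i, a] [i, b] F \<and> F\<inverse> `` {[i, b]} = L'"
    if iab: "i \<in> S" "a \<in> S" "b \<in> S" "i \<noteq> a" "i \<noteq> b" "a \<noteq> b"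
      and L': "L' \<subseteq> {x \<in> arr S 2. arr_adj x [i, b]}" "L' \<noteq> {}" "L' \<noteq> {[i, a]}" for i a b L'
  proof -
    have "distinct [i, a, b]" using iab by simp
    then obtain c where c: "distinct [i, a, b, c]" "S = {i, a, b, c}"
      by (rule four_elements[OF c4 iab(1-3)])
    have sub: "L' \<subseteq> {[i, a], [i, c], [a, b], [c, b]}"
    proof
      fix x assume "x \<in> L'"
      then have x0: "x \<in> arr S 2" "arr_adj x [i, b]" using L'(1) by auto
      from x0(1) obtain p q where x: "x = [p, q]" "p \<in> S" "q \<in> S" "p \<noteq> q" unfolding arr_two by blast
      have "arr_adj [p, q] [i, b]" using x0(2) x(1) by simp
      then have "p = i \<and> q \<noteq> b \<or> p \<noteq> i \<and> q = b" by (cases "p = i") (auto simp: adj_single)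
      moreover have "p \<in> {i, a, b, c}" "q \<in> {i, a, b, c}" using x(2,3) c(2) by simp_all
      ultimately show "x \<in> {[i, a], [i, c], [a, b], [c, b]}" using x(1,4) by auto
    qed
    define M where "M = L' - {[i, a]}"
    have M: "M \<subseteq> {[i, c], [a, b], [c, b]}" "M \<noteq> {}"
      using sub subset_singletonD[of L' "[i, a]"] L'(2,3) unfolding M_def by blast+
    have "L' = M \<union> (if [i, a] \<in> L' then {[i, a]} else {})" unfolding M_def by auto
    then show ?thesis using small_into[OF c(1) M, of "[i, a] \<in> L'"] c(2) by simp
  qed
  have len: "length x = 2" if "x \<in> arr S 2" for x using that unfolding arr_def by simp
  obtain p where p: "p < 2" "u ! p = v ! p"
  proof -
    obtain q t where "q < 2" "v = u[q := t]" using adj_arr[OF u v adj] by metis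
    then show ?thesis using that[of "1 - q"] len[OF u] by (cases "q = 0") auto
  qed
  obtain x y where su: "swp p u = [x, y]" "x \<in> S" "y \<in> S" "x \<noteq> y" using swp_arr[OF u p(1)] arr_two by blast
  obtain x' z where sv: "swp p v = [x', z]" "x' \<in> S" "z \<in> S" "x' \<noteq> z" using swp_arr[OF v p(1)] arr_two by blast
  have "x = u ! p" "x' = v ! p" using hd_swp[of p u] hd_swp[of p v] su sv p len u v by auto
  then have xx: "x' = x" using p by simp
  have adjs: "arr_adj (swp p x) (swp p y) \<longleftrightarrow> arr_adj x y" if "x \<in> arr S 2" "y \<in> arr S 2" for x y
    using adj_swp[of p x y] len that p(1) by simp
  have inv: "swp p (swp p x) = x" if "x \<in> arr S 2" for x using swp_swp len that p(1) by metis
  have yz: "y \<noteq> z" using adjs[OF u v] adj su sv xx adj_irrefl by auto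
  have "swp p ` L \<subseteq> {x \<in> arr S 2. arr_adj x (swp p v)}" using L swp_arr[OF _ p(1)] adjs[OF _ v] by auto
  moreover have "swp p ` L \<noteq> {swp p u}"
  proof
    assume *: "swp p ` L = {swp p u}"
    have "x = u" if "x \<in> L" for x
    proof -
      have "swp p x = swp p u" using * that by auto
      then show ?thesis using inv[OF u] inv[of x] L that by auto
    qed
    then show False using L by auto
  qed
  ultimately obtain F where F: "sflow S 2 (swp p u) (swp p v) F" "F\<inverse> `` {swp p v} = swp p ` L"
    using first[of x y z "swp p ` L"] su sv xx yz L by auto
  obtain F' where F': "sflow S 2 u v F'" "F'\<inverse> `` {v} = swp p ` swp p ` L"
    using sflow_swp[OF F(1) p(1) u v] F(2) by auto
  moreover have "swp p ` swp p ` L = L" using inv L by (force simp: image_image)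
  ultimately show "\<exists>F. sflow S 2 u v F \<and> F\<inverse> `` {v} = L" by auto
qed

lemma spans_small:
  assumes c4: "card S = 4"
  shows "spans S 2"
  unfolding spans_def
proof (intro ballI impI allI)
  fix u v l
  assume u: "u \<in> arr S 2" and v: "v \<in> arr S 2" and uv: "u \<noteq> v" and l: "1 \<le> l \<and> l \<le> 2 * (card S - 2)"
  have fS: "finite S" using c4 by (metis card.infinite zero_neq_numeral)
  have l4: "l \<in> {1, 2, 3, 4}" using l c4 by auto
  obtain i a where ia: "u = [i, a]" "i \<in> S" "a \<in> S" "i \<noteq> a" using u arr_two by blast
  obtain x y where xy: "v = [x, y]" "x \<in> S" "y \<in> S" "x \<noteq> y" using v arr_two by blast
  show "\<exists>F. sflow S 2 u v F \<and> card (F `` {u}) = l"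
  proof (cases "arr_adj u v")
    case True
    then show ?thesis using spans_of_into[OF spans_into_small[OF c4] fS u v] l c4 by simp
  next
    case False
    then have d: "x \<noteq> i" "y \<noteq> a" using uv unfolding ia xy by (auto simp: adj_single)
    consider "x = a" "y = i" | "x = a" "y \<noteq> i" | "x \<noteq> a" "y = i" | "x \<noteq> a" "y \<noteq> i" by blast
    then show ?thesis
    proof cases
      case 1
      have "card (S - {i, a}) = 2" using c4 fS ia by (subst card_Diff_subset) auto
      then have "S - {i, a} \<noteq> {}" by (metis card.empty zero_neq_numeral)
      then obtain b where b: "b \<in> S" "distinct [i, a, b]" using ia(4) by auto
      obtain c where c: "distinct [i, a, b, c]" "S = {i, a, b, c}"
        by (rule four_elements[OF c4 ia(2,3) b])
      show ?thesis using small_far_ai[OF c(1) l4] 1 c(2) ia xy by simp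
    next
      case 2
      then have b: "y \<in> S" "distinct [i, a, y]" using ia xy d by auto
      obtain c where c: "distinct [i, a, y, c]" "S = {i, a, y, c}"
        by (rule four_elements[OF c4 ia(2,3) b])
      show ?thesis using small_far_ab[OF c(1) l4] 2 c(2) ia xy by simp
    next
      case 3
      then have b: "x \<in> S" "distinct [i, a, x]" using ia xy d by auto
      obtain c where c: "distinct [i, a, x, c]" "S = {i, a, x, c}"
        by (rule four_elements[OF c4 ia(2,3) b])
      show ?thesis using small_far_bi[OF c(1) l4] 3 c(2) ia xy by simp
    next
      case 4
      then have b: "x \<in> S" "distinct [i, a, x]" using ia xy d by auto
      obtain c where c: "distinct [i, a, x, c]" "S = {i, a, x, c}"
        by (rule four_elements[OF c4 ia(2,3) b])
      then have "c = y" using 4 xy d by auto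
      then show ?thesis using small_far_bc[OF c(1) l4] c(2) ia xy by simp
    qed
  qed
qed

text \<open>Removing a symbol along with a position preserves \<open>m\<close>, so \<open>m\<close>
  is fixed during the induction, while \<open>S\<close> varies because each copy has its own symbol
  set. The step from \<open>k = 1\<close> with \<open>m = 2\<close> is replaced by the explicit
  case.\<close>

lemma spans_all:
  assumes "m \<ge> 2" "k \<ge> 1" "finite S" "card S = k + m"
  shows "spans S k \<and> spans_into S k"
  using assms(2-4)
proof (induction k arbitrary: S rule: dec_induct)
  case base
  then show ?case using spans_complete[of S] spans_into_complete[of S] assms(1) by simp
next
  case (step k)
  show ?case
  proof (cases "k = 1 \<and> m = 2")
    case True
    then have "card S = 4" using step.prems by simp
    then show ?thesis using spans_small spans_into_small True by (simp add: numeral_2_eq_2)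
  next
    case False
    interpret arr_step S k m
    proof
      show "k \<ge> 2 \<or> m \<ge> 3" using False step.hyps assms(1) by auto
      show "spans (S - {t}) k" "spans_into (S - {t}) k" if "t \<in> S" for t
        using step.IH[of "S - {t}"] step.prems that by auto
    qed (use step assms(1) in auto)
    show ?thesis using spans_step spans_into_step by blast
  qed
qed

theorem theorem1:
  fixes n k :: nat
  assumes "n \<ge> 4" and "k \<ge> 1" and "n - k \<ge> 2"
  shows "\<forall>l. 1 \<le> l \<and> l \<le> k * (n - k) \<longrightarrow>
           star_connected (arr_vertices n k) arr_adj l"
proof (intro allI impI)
  fix l assume l: "1 \<le> l \<and> l \<le> k * (n - k)"
  have V: "arr_vertices n k = arr {1..n} k" unfolding arr_vertices_def arr_def ..
  have s: "spans {1..n} k" using spans_all[of "n - k" k "{1..n}"] assms by simp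
  show "star_connected (arr_vertices n k) arr_adj l"
    unfolding star_connected_def V
  proof (intro ballI impI)
    fix u v assume "u \<in> arr {1..n} k" "v \<in> arr {1..n} k" "u \<noteq> v"
    then obtain F where "sflow {1..n} k u v F" "card (F `` {u}) = l"
      using s l unfolding spans_def by fastforce
    then show "\<exists>C. is_star_container (arr {1..n} k) arr_adj l u v C"
      using flow_imp_star_container[of "arr {1..n} k" u v F l arr_adj] l unfolding sflow_def by simp
  qed
qed

end
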